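(* Let $\kappa$ be a singular cardinal with $\operatorname{cf}(\kappa)=\lambda>\omega$ such that $\tau^\lambda<\kappa$ for all $\tau<\kappa$. Let $\mathbb{P}$ be any of the forcings $\mathbb{M}_\kappa$, $\mathbb{M}^{\mathrm{stat}}_\kappa$, $\mathbb{M}^{\mathrm{club}}_\kappa$, ${}^{\mathrm{scl}}\mathbb{M}_\kappa$, ${}^{\mathrm{scl}}\mathbb{M}^{\mathrm{club}}_\kappa$, $\mathbb{L}_\kappa$, $\mathbb{L}^{\mathrm{stat}}_\kappa$, $\mathbb{L}^{\mathrm{club}}_\kappa$. Then $\mathbb{P}$ is not $(\lambda,2)$-distributive, i.e. forcing with $\mathbb{P}$ adds a function from $\lambda$ to $2$ that is not in the ground model.
   Context: Fix a strictly increasing sequence $\vec\kappa=\langle\kappa_\alpha:\alpha<\lambda\rangle$ of regular infinite cardinals with supremum $\kappa$. Let $N=\bigcup_{\alpha<\lambda}\prod_{\beta<\alpha}\kappa_\beta$ (functions $t$ with $\mathrm{dom}(t)$ an ordinal $<\lambda$ and $t(\beta)<\kappa_\beta$), ordered by end-extension $\sqsubseteq$. A tree is a nonempty $T\subseteq N$ closed under initial segments. For $t\in T$, $\mathrm{Succ}_T(t)$ is the set of immediate successors $t^\frown\langle\beta\rangle\in T$ and $\mathrm{OSucc}_T(t)=\{\beta: t^\frown\langle\beta\rangle\in T\}$. $T$ is $(<\lambda)$-closed if every node has a proper extension in $T$ and whenever $\delta<\lambda$ is a limit and $f$ has domain $\delta$ with $f\restriction\beta\in T$ for all $\beta<\delta$,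 then $f\in T$. $T$ is ever-branching if for all $s\in T$ and $\alpha<\lambda$ there is $t\in T$, $s\sqsubseteq t$, with $|\mathrm{Succ}_T(t)|\ge\kappa_\alpha$ ($t$ is then called $\kappa_\alpha$-splitting). $T$ is perfect if it is $(<\lambda)$-closed and ever-branching. All forcings are ordered by inclusion. $\mathbb{M}_\kappa$: perfect trees. $\mathbb{M}^{\mathrm{stat}}_\kappa$ (resp. $\mathbb{M}^{\mathrm{club}}_\kappa$): perfect trees $p$ such that every node has an extension $t\in p$ with $\mathrm{OSucc}_p(t)$ a stationary subset of $\{\beta<\kappa_{\mathrm{dom}(t)}:\operatorname{cf}\beta=\omega\}$ (resp. containing a club subset of $\kappa_{\mathrm{dom}(t)}$). The splitting-closed versions ${}^{\mathrm{scl}}\mathbb{M}_\kappa$, ${}^{\mathrm{scl}}\mathbb{M}^{\mathrm{club}}_\kappa$ consist of conditions $p$ of the respective forcing such that for every $\delta<\lambda$ and every $\sqsubseteq$-increasing sequence $\langle t_\alpha:\alpha<\delta\rangle$ of nodes of $p$ with $t_\alpha$ $\kappa_\alpha$-splitting, the union $\bigcup_\alpha t_\alpha$ is a $\kappa_\delta$-splitting node of $p$ (in the club version, splitting in the sense that the ordinal successor set contains a club). $\mathbb{L}_\kappa$: $(<\lambda)$-closed trees $p$ with a node $s$ (the stem) comparable with every node of $p$ such that every $t\in p$ with $s\sqsubseteq t$ satisfies $|\mathrm{Succ}_p(t)|=\kappa_{\mathrm{dom}(t)}$; $\mathbb{L}^{\mathrm{stat}}_\kappa$ (resp. $\mathbb{L}^{\mathrm{club}}_\kappa$)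 additionally requires $\mathrm{OSucc}_p(t)$ to be a stationary subset of $\{\beta<\kappa_{\mathrm{dom}(t)}:\operatorname{cf}\beta=\omega\}$ (resp. to contain a club subset of $\kappa_{\mathrm{dom}(t)}$) for all such $t$.
   Formalization: In the splitting-closed forcings, δ ranges only over limit ordinals below λ and the sequences of nodes are strictly increasing; with δ=0 and δ=1 allowed, the root would have to be κ_1-splitting although it has at most κ_0 successors, so those forcings would be empty. *)

theory Defs
  imports Main "HOL-Library.FuncSet"
begin

unbundle cardinal_syntax

section \<open>Ordinals and cardinals\<close>

text \<open>
  Ordinals are the elements of an arbitrary type of class \<^class>\<open>wellorder\<close>; the ordinal \<open>a\<close> is
  identified with the set \<open>{..<a}\<close> of its predecessors.  The relation below presents \<open>a\<close> in
  the form used by the library of cardinals.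
\<close>

definition ord_rel :: "'o::wellorder \<Rightarrow> 'o rel" where
  "ord_rel a = {(x, y). x \<le> y \<and> y < a}"

definition is_cardinal :: "'o::wellorder \<Rightarrow> bool" where
  "is_cardinal a \<longleftrightarrow> Card_order (ord_rel a)"

definition regular_infinite_cardinal :: "'o::wellorder \<Rightarrow> bool" where
  "regular_infinite_cardinal a \<longleftrightarrow> Cinfinite (ord_rel a) \<and> regularCard (ord_rel a)"

definition is_limit :: "'o::wellorder \<Rightarrow> bool" where
  "is_limit d \<longleftrightarrow> (\<exists>x. x < d) \<and> (\<forall>x<d. \<exists>y<d. x < y)"

definition cf :: "'o::wellorder \<Rightarrow> 'o" where
  "cf a = (LEAST b. \<exists>f. f ` {..<b} \<subseteq> {..<a} \<and> (\<forall>x<a. \<exists>y<b. x \<le> f y))"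

text \<open>Only meaningful if the type has an element with infinitely many predecessors.\<close>

definition omega :: "'o::wellorder" where
  "omega = (LEAST b. infinite {..<b})"

definition singular_cardinal :: "'o::wellorder \<Rightarrow> bool" where
  "singular_cardinal a \<longleftrightarrow> Cinfinite (ord_rel a) \<and> cf a < a"

definition club_in :: "'o::wellorder set \<Rightarrow> 'o \<Rightarrow> bool" where
  "club_in C m \<longleftrightarrow> C \<subseteq> {..<m} \<and> (\<forall>x<m. \<exists>y\<in>C. x \<le> y) \<and>
     (\<forall>d<m. is_limit d \<and> (\<forall>x<d. \<exists>y\<in>C. x < y \<and> y < d) \<longrightarrow> d \<in> C)"

definition stationary_in :: "'o::wellorder set \<Rightarrow> 'o \<Rightarrow> bool" where
  "stationary_in S m \<longleftrightarrow> S \<subseteq> {..<m} \<and> (\<forall>C. club_in C m \<longrightarrow> S \<inter> C \<noteq> {})"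

definition cardinal_sequence :: "'o::wellorder \<Rightarrow> 'o \<Rightarrow> ('o \<Rightarrow> 'o) \<Rightarrow> bool" where
  "cardinal_sequence \<kappa> lam k \<longleftrightarrow>
     (\<forall>\<alpha><lam. regular_infinite_cardinal (k \<alpha>)) \<and>
     strict_mono_on {..<lam} k \<and>
     (\<forall>\<alpha><lam. k \<alpha> \<le> \<kappa>) \<and> (\<forall>b. (\<forall>\<alpha><lam. k \<alpha> \<le> b) \<longrightarrow> \<kappa> \<le> b)"


section \<open>Trees\<close>

text \<open>
  Nodes are partial functions whose domain is an ordinal; on such functions end-extension is
  \<^const>\<open>map_le\<close>.  Throughout, \<open>lam\<close> is the height and \<open>k\<close> the sequence of cardinals.
\<close>

type_synonym 'o node = "'o \<rightharpoonup> 'o"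

definition nodes :: "'o::wellorder \<Rightarrow> ('o \<Rightarrow> 'o) \<Rightarrow> 'o node set" where
  "nodes lam k = {t. \<exists>\<alpha><lam. dom t = {..<\<alpha>} \<and> (\<forall>\<beta><\<alpha>. the (t \<beta>) < k \<beta>)}"

definition len :: "'o::wellorder node \<Rightarrow> 'o" where
  "len t = (THE \<alpha>. dom t = {..<\<alpha>})"

definition is_tree :: "'o::wellorder \<Rightarrow> ('o \<Rightarrow> 'o) \<Rightarrow> 'o node set \<Rightarrow> bool" where
  "is_tree lam k T \<longleftrightarrow> T \<noteq> {} \<and> T \<subseteq> nodes lam k \<and>
     (\<forall>t\<in>T. \<forall>s\<in>nodes lam k. s \<subseteq>\<^sub>m t \<longrightarrow> s \<in> T)"

definition OSucc :: "'o::wellorder node set \<Rightarrow> 'o node \<Rightarrow> 'o set" where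
  "OSucc T t = {\<beta>. t(len t \<mapsto> \<beta>) \<in> T}"

definition Succ :: "'o::wellorder node set \<Rightarrow> 'o node \<Rightarrow> 'o node set" where
  "Succ T t = {t(len t \<mapsto> \<beta>) |\<beta>. t(len t \<mapsto> \<beta>) \<in> T}"

definition lt_closed :: "'o::wellorder \<Rightarrow> 'o node set \<Rightarrow> bool" where
  "lt_closed lam T \<longleftrightarrow> (\<forall>t\<in>T. \<exists>u\<in>T. t \<subseteq>\<^sub>m u \<and> t \<noteq> u) \<and>
     (\<forall>\<delta> f. \<delta> < lam \<and> is_limit \<delta> \<and> dom f = {..<\<delta>} \<and> (\<forall>\<beta><\<delta>. f |` {..<\<beta>} \<in> T) \<longrightarrow> f \<in> T)"

definition splitting :: "('o::wellorder \<Rightarrow> 'o) \<Rightarrow> 'o node set \<Rightarrow> 'o \<Rightarrow> 'o node \<Rightarrow> bool" where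
  "splitting k T \<alpha> t \<longleftrightarrow> |{..<k \<alpha>}| \<le>o |Succ T t|"

definition stat_branching :: "('o::wellorder \<Rightarrow> 'o) \<Rightarrow> 'o node set \<Rightarrow> 'o node \<Rightarrow> bool" where
  "stat_branching k T t \<longleftrightarrow> OSucc T t \<subseteq> {\<beta>. \<beta> < k (len t) \<and> cf \<beta> = omega} \<and>
     stationary_in (OSucc T t) (k (len t))"

definition club_branching :: "('o::wellorder \<Rightarrow> 'o) \<Rightarrow> 'o node set \<Rightarrow> 'o node \<Rightarrow> bool" where
  "club_branching k T t \<longleftrightarrow> (\<exists>C. club_in C (k (len t)) \<and> C \<subseteq> OSucc T t)"

definition ever_branching :: "'o::wellorder \<Rightarrow> ('o \<Rightarrow> 'o) \<Rightarrow> 'o node set \<Rightarrow> bool" where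
  "ever_branching lam k T \<longleftrightarrow> (\<forall>s\<in>T. \<forall>\<alpha><lam. \<exists>t\<in>T. s \<subseteq>\<^sub>m t \<and> splitting k T \<alpha> t)"

definition perfect_tree :: "'o::wellorder \<Rightarrow> ('o \<Rightarrow> 'o) \<Rightarrow> 'o node set \<Rightarrow> bool" where
  "perfect_tree lam k T \<longleftrightarrow> is_tree lam k T \<and> lt_closed lam T \<and> ever_branching lam k T"

text \<open>
  Closure under unions of increasing sequences of splitting nodes, where \<open>spl \<alpha> t\<close> says that
  \<open>t\<close> is \<open>k \<alpha>\<close>-splitting.  Here \<open>\<delta>\<close> ranges over limit ordinals and the sequences are strictly
  increasing: for \<open>\<delta> = 0\<close> the condition would make the root \<open>k 0\<close>-splitting and for \<open>\<delta> = 1\<close> it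
  would then make the root \<open>k 1\<close>-splitting, which is impossible.
\<close>

definition splitting_closed ::
  "'o::wellorder \<Rightarrow> ('o \<Rightarrow> 'o node \<Rightarrow> bool) \<Rightarrow> 'o node set \<Rightarrow> bool" where
  "splitting_closed lam spl T \<longleftrightarrow>
     (\<forall>\<delta> t. \<delta> < lam \<and> is_limit \<delta> \<and>
        (\<forall>\<alpha><\<delta>. t \<alpha> \<in> T \<and> spl \<alpha> (t \<alpha>)) \<and>
        (\<forall>\<alpha> \<beta>. \<alpha> < \<beta> \<and> \<beta> < \<delta> \<longrightarrow> t \<alpha> \<subseteq>\<^sub>m t \<beta> \<and> t \<alpha> \<noteq> t \<beta>) \<longrightarrow>
        (\<exists>u\<in>T. Map.graph u = (\<Union>\<alpha>\<in>{..<\<delta>}. Map.graph (t \<alpha>)) \<and> spl \<delta> u))"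


section \<open>The tree forcings\<close>

definition MM :: "'o::wellorder \<Rightarrow> ('o \<Rightarrow> 'o) \<Rightarrow> 'o node set set" where
  "MM lam k = {p. perfect_tree lam k p}"

definition MM_stat :: "'o::wellorder \<Rightarrow> ('o \<Rightarrow> 'o) \<Rightarrow> 'o node set set" where
  "MM_stat lam k = {p. perfect_tree lam k p \<and> (\<forall>s\<in>p. \<exists>t\<in>p. s \<subseteq>\<^sub>m t \<and> stat_branching k p t)}"

definition MM_club :: "'o::wellorder \<Rightarrow> ('o \<Rightarrow> 'o) \<Rightarrow> 'o node set set" where
  "MM_club lam k = {p. perfect_tree lam k p \<and> (\<forall>s\<in>p. \<exists>t\<in>p. s \<subseteq>\<^sub>m t \<and> club_branching k p t)}"

definition scl_MM :: "'o::wellorder \<Rightarrow> ('o \<Rightarrow> 'o) \<Rightarrow> 'o node set set" where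
  "scl_MM lam k = {p \<in> MM lam k. splitting_closed lam (splitting k p) p}"

definition scl_MM_club :: "'o::wellorder \<Rightarrow> ('o \<Rightarrow> 'o) \<Rightarrow> 'o node set set" where
  "scl_MM_club lam k = {p \<in> MM_club lam k.
     splitting_closed lam (\<lambda>\<alpha> t. splitting k p \<alpha> t \<and> club_branching k p t) p}"

definition laver_stem ::
  "'o::wellorder \<Rightarrow> ('o \<Rightarrow> 'o) \<Rightarrow> 'o node set \<Rightarrow> 'o node \<Rightarrow> bool" where
  "laver_stem lam k p s \<longleftrightarrow> s \<in> p \<and> (\<forall>t\<in>p. s \<subseteq>\<^sub>m t \<or> t \<subseteq>\<^sub>m s) \<and>
     (\<forall>t\<in>p. s \<subseteq>\<^sub>m t \<longrightarrow> |Succ p t| =o |{..<k (len t)}| )"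

definition LL :: "'o::wellorder \<Rightarrow> ('o \<Rightarrow> 'o) \<Rightarrow> 'o node set set" where
  "LL lam k = {p. is_tree lam k p \<and> lt_closed lam p \<and> (\<exists>s. laver_stem lam k p s)}"

definition LL_stat :: "'o::wellorder \<Rightarrow> ('o \<Rightarrow> 'o) \<Rightarrow> 'o node set set" where
  "LL_stat lam k = {p. is_tree lam k p \<and> lt_closed lam p \<and>
     (\<exists>s. laver_stem lam k p s \<and> (\<forall>t\<in>p. s \<subseteq>\<^sub>m t \<longrightarrow> stat_branching k p t))}"

definition LL_club :: "'o::wellorder \<Rightarrow> ('o \<Rightarrow> 'o) \<Rightarrow> 'o node set set" where
  "LL_club lam k = {p. is_tree lam k p \<and> lt_closed lam p \<and>
     (\<exists>s. laver_stem lam k p s \<and> (\<forall>t\<in>p. s \<subseteq>\<^sub>m t \<longrightarrow> club_branching k p t))}"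


section \<open>Forcing\<close>

text \<open>
  A forcing is a set \<open>P\<close> of conditions with an order \<open>le\<close> (\<open>le q p\<close>: \<open>q\<close> is stronger than \<open>p\<close>).
  A statement of the forcing language is represented by the predicate \<open>\<lambda>p. p \<tturnstile> \<phi>\<close> on conditions;
  the definitions are the usual recursive clauses of the forcing relation, quantifiers being
  bounded by ground-model sets.

  A set \<open>\<tau>\<close> of pairs \<open>(x, u)\<close> with \<open>x \<in> A\<close> and \<open>u \<in> P\<close> is a name for the subset
  \<open>{x. \<exists>u\<in>G. (x, u) \<in> \<tau>}\<close> of the ground-model set \<open>A\<close> in the extension by a generic filter \<open>G\<close>.
  Every subset of \<open>A\<close> in the extension has such a name.
\<close>

type_synonym 'c stmt = "'c \<Rightarrow> bool"

definition f_mem :: "'c set \<Rightarrow> ('c \<Rightarrow> 'c \<Rightarrow> bool) \<Rightarrow> 'x \<Rightarrow> ('x \<times> 'c) set \<Rightarrow> 'c stmt" where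
  "f_mem P le x \<tau> = (\<lambda>p. \<forall>q\<in>P. le q p \<longrightarrow> (\<exists>r\<in>P. le r q \<and> (\<exists>u\<in>P. (x, u) \<in> \<tau> \<and> le r u)))"

definition f_not :: "'c set \<Rightarrow> ('c \<Rightarrow> 'c \<Rightarrow> bool) \<Rightarrow> 'c stmt \<Rightarrow> 'c stmt" where
  "f_not P le \<phi> = (\<lambda>p. \<forall>q\<in>P. le q p \<longrightarrow> \<not> \<phi> q)"

definition f_and :: "'c stmt \<Rightarrow> 'c stmt \<Rightarrow> 'c stmt" where
  "f_and \<phi> \<psi> = (\<lambda>p. \<phi> p \<and> \<psi> p)"

definition f_all :: "'i set \<Rightarrow> ('i \<Rightarrow> 'c stmt) \<Rightarrow> 'c stmt" where
  "f_all I \<phi> = (\<lambda>p. \<forall>i\<in>I. \<phi> i p)"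

definition f_ex :: "'c set \<Rightarrow> ('c \<Rightarrow> 'c \<Rightarrow> bool) \<Rightarrow> 'i set \<Rightarrow> ('i \<Rightarrow> 'c stmt) \<Rightarrow> 'c stmt" where
  "f_ex P le I \<phi> = (\<lambda>p. \<forall>q\<in>P. le q p \<longrightarrow> (\<exists>r\<in>P. le r q \<and> (\<exists>i\<in>I. \<phi> i r)))"

text \<open>\<open>\<tau>\<close> is a function from \<open>X\<close> to \<open>Y\<close>, for a name \<open>\<tau>\<close> of a subset of \<open>X \<times> Y\<close>.\<close>

definition f_is_function ::
  "'c set \<Rightarrow> ('c \<Rightarrow> 'c \<Rightarrow> bool) \<Rightarrow> 'x set \<Rightarrow> 'y set \<Rightarrow> (('x \<times> 'y) \<times> 'c) set \<Rightarrow> 'c stmt" where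
  "f_is_function P le X Y \<tau> =
     f_all X (\<lambda>x. f_and
       (f_ex P le Y (\<lambda>y. f_mem P le (x, y) \<tau>))
       (f_all {(y, z). y \<in> Y \<and> z \<in> Y \<and> y \<noteq> z} (\<lambda>(y, z).
          f_not P le (f_and (f_mem P le (x, y) \<tau>) (f_mem P le (x, z) \<tau>)))))"

text \<open>\<open>\<tau>\<close> is a ground-model function, for a name \<open>\<tau>\<close> of a function from \<open>X\<close> to \<open>Y\<close>.\<close>

definition f_in_ground_model ::
  "'c set \<Rightarrow> ('c \<Rightarrow> 'c \<Rightarrow> bool) \<Rightarrow> 'x set \<Rightarrow> 'y set \<Rightarrow> (('x \<times> 'y) \<times> 'c) set \<Rightarrow> 'c stmt" where
  "f_in_ground_model P le X Y \<tau> =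
     f_ex P le (X \<rightarrow>\<^sub>E Y) (\<lambda>g. f_all X (\<lambda>x. f_mem P le (x, g x) \<tau>))"

text \<open>
  Distributivity: every condition forces that all functions from \<open>X\<close> to \<open>Y\<close> lie in the ground
  model.  Adding a new function: some name is forced, by every condition, to be a function from
  \<open>X\<close> to \<open>Y\<close> outside the ground model.
\<close>

definition distributive :: "'c set \<Rightarrow> ('c \<Rightarrow> 'c \<Rightarrow> bool) \<Rightarrow> 'x set \<Rightarrow> 'y set \<Rightarrow> bool" where
  "distributive P le X Y \<longleftrightarrow>
     (\<forall>\<tau>. \<tau> \<subseteq> (X \<times> Y) \<times> P \<longrightarrow>
        (\<forall>p\<in>P. f_is_function P le X Y \<tau> p \<longrightarrow> f_in_ground_model P le X Y \<tau> p))"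

definition adds_new_function :: "'c set \<Rightarrow> ('c \<Rightarrow> 'c \<Rightarrow> bool) \<Rightarrow> 'x set \<Rightarrow> 'y set \<Rightarrow> bool" where
  "adds_new_function P le X Y \<longleftrightarrow>
     (\<exists>\<tau>. \<tau> \<subseteq> (X \<times> Y) \<times> P \<and>
        (\<forall>p\<in>P. f_and (f_is_function P le X Y \<tau>) (f_not P le (f_in_ground_model P le X Y \<tau>)) p))"

end

theory Submission
  imports Defs "HOL-Library.Nat_Bijection"
begin

text \<open>
  A name for a subset of the height \<open>lam\<close> is a family \<open>(D \<beta>)\<close> of open sets of conditions; it is
  new if no condition decides all of them. Three kinds of names are used.

  \<^item> Laver trees: at level \<open>\<gamma> + \<omega>\<close> there are an infinite set \<open>B\<close> of naturals and a scale in
    \<open>\<Prod>n\<in>B. k (\<gamma> + n)\<close> modulo finite. Fix \<open>A \<subseteq> B\<close> infinite and co-infinite in \<open>B\<close>, and colour a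
    node \<open>x\<close> of that level by whether \<open>{n \<in> B. f n \<le> x (\<gamma> + n)}\<close> equals \<open>A\<close> modulo finite for
    some \<open>f\<close> in the scale. For a large \<open>f\<close> every Laver tree has nodes realising \<open>A\<close> and \<open>B - A\<close>;
    as the scale is linearly ordered, the second node cannot also realise \<open>A\<close>.

  \<^item> Splitting-closed trees with clubs: a club of \<open>k \<beta>\<close> has points of cofinality \<open>\<omega>\<close> and of
    cofinality \<open>lam\<close>, so this cofinality for the successive values of the branch is undecided.

  \<^item> Other perfect trees: refine maximal antichains \<open>\<A> 0, \<A> 1, \<dots>\<close> such that passing from an
    element of \<open>\<A> n\<close> to one of \<open>\<A> (n + 1)\<close> lowers an ordinal rank at every splitting node: the
    order type of the splitting nodes below it or, for splitting-closed trees, the position of a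
    successor among its siblings. The name is the sequence of the sets \<open>A n\<close> of splitting levels,
    along the generic branch, of the generic element of \<open>\<A> n\<close>. If a condition decided them, the
    \<open>A n\<close> would have empty intersection by well-foundedness. But in the splitting-closed case each
    \<open>A n\<close> contains a club of \<open>lam\<close>, and otherwise, as \<open>lam\<close> has uncountable cofinality, the
    condition can be thinned out to split only at levels outside one fixed \<open>A n\<close>.
\<close>

text \<open>The generic branch is itself a new sequence of length \<open>lam\<close>, but with
  values in the \<open>k \<beta>\<close>; the difficulty is to extract bits. A bit read off a single
  value can be decided at the node in question: a set of regular size, or a stationary set, coloured
  with two colours has a one-coloured subset of the same kind. This is why in Laver trees a bit
  depends on infinitely many consecutive values, with a scale to control how the available values
  vary with the path. Sets containing a club cannot be thinned out in this way, so there the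
  cofinality of one value suffices. In the remaining perfect trees a condition also has a say in
  where it splits, so the bits are taken from the splitting nodes of the elements of antichains and
  not from the values of the branch. The hypothesis on powers enters as
  \<open>continuum_less_k\<close>: it makes families of continuum many functions bounded, which the
  construction of the scale needs.\<close>

lemma adds_new_functionI:
  fixes P :: "'a set set" and D :: "'x \<Rightarrow> 'a set set"
  assumes sub: "\<And>x. x \<in> X \<Longrightarrow> D x \<subseteq> P"
    and down: "\<And>x u r. x \<in> X \<Longrightarrow> u \<in> D x \<Longrightarrow> r \<in> P \<Longrightarrow> r \<subseteq> u \<Longrightarrow> r \<in> D x"
    and undecided: "\<And>q. q \<in> P \<Longrightarrow>
      \<exists>x\<in>X. (\<exists>r\<in>P. r \<subseteq> q \<and> (\<forall>r'\<in>P. r' \<subseteq> r \<longrightarrow> r' \<notin> D x)) \<and> (\<exists>r\<in>D x. r \<subseteq> q)"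
  shows "adds_new_function P (\<subseteq>) X {0, 1 :: nat}"
proof -
  \<comment> \<open>The conditions incompatible with all of \<open>D x\<close>. Together with
    \<open>D x\<close> they are dense, so \<open>\<tau>\<close> names a total function.\<close>
  define N where "N x = {u \<in> P. \<forall>r\<in>P. r \<subseteq> u \<longrightarrow> r \<notin> D x}" for x
  define \<tau> where "\<tau> = {((x, 1 :: nat), u) |x u. x \<in> X \<and> u \<in> D x} \<union>
    {((x, 0), u) |x u. x \<in> X \<and> u \<in> N x}"
  \<comment> \<open>As \<open>D x\<close> is open, forcing membership amounts to density of
    \<open>D x\<close> below \<open>p\<close>.\<close>
  have mem1: "f_mem P (\<subseteq>) (x, 1) \<tau> p \<longleftrightarrow> (\<forall>q\<in>P. q \<subseteq> p \<longrightarrow> (\<exists>r\<in>P. r \<subseteq> q \<and> r \<in> D x))"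
    if "x \<in> X" for x p
  proof -
    have "(\<exists>u\<in>P. ((x, 1), u) \<in> \<tau> \<and> r \<subseteq> u) \<longleftrightarrow> r \<in> D x" if "r \<in> P" for r
      using that sub[OF \<open>x \<in> X\<close>] down[OF \<open>x \<in> X\<close>] \<open>x \<in> X\<close> unfolding \<tau>_def by auto
    then show ?thesis unfolding f_mem_def by (metis (no_types, lifting))
  qed
  have mem0: "f_mem P (\<subseteq>) (x, 0) \<tau> p \<longleftrightarrow> (\<forall>q\<in>P. q \<subseteq> p \<longrightarrow> (\<exists>r\<in>P. r \<subseteq> q \<and> r \<in> N x))"
    if "x \<in> X" for x p
  proof -
    have "r \<in> N x" if "u \<in> N x" "r \<in> P" "r \<subseteq> u" for u r
      using that unfolding N_def by blast
    moreover have "N x \<subseteq> P" unfolding N_def by blast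
    ultimately have "(\<exists>u\<in>P. ((x, 0), u) \<in> \<tau> \<and> r \<subseteq> u) \<longleftrightarrow> r \<in> N x" if "r \<in> P" for r
      using that \<open>x \<in> X\<close> unfolding \<tau>_def by auto
    then show ?thesis unfolding f_mem_def by (metis (no_types, lifting))
  qed
  have not_both: "\<not> (f_mem P (\<subseteq>) (x, 0) \<tau> q \<and> f_mem P (\<subseteq>) (x, 1) \<tau> q)"
    if "x \<in> X" "q \<in> P" for x q
  proof
    assume "f_mem P (\<subseteq>) (x, 0) \<tau> q \<and> f_mem P (\<subseteq>) (x, 1) \<tau> q"
    then have m: "\<forall>q'\<in>P. q' \<subseteq> q \<longrightarrow> (\<exists>r\<in>P. r \<subseteq> q' \<and> r \<in> N x)"
      "\<forall>q'\<in>P. q' \<subseteq> q \<longrightarrow> (\<exists>r\<in>P. r \<subseteq> q' \<and> r \<in> D x)"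
      using mem0[OF that(1)] mem1[OF that(1)] by blast+
    then obtain r where r: "r \<in> P" "r \<subseteq> q" "r \<in> N x" using \<open>q \<in> P\<close> by blast
    then obtain r' where "r' \<in> P" "r' \<subseteq> r" "r' \<in> D x" using m(2) by blast
    then show False using r(3) unfolding N_def by blast
  qed
  have total: "\<exists>r\<in>P. r \<subseteq> q \<and> (\<exists>i\<in>{0, 1}. f_mem P (\<subseteq>) (x, i) \<tau> r)"
    if "x \<in> X" "q \<in> P" for x q
  proof (cases "\<exists>r\<in>P. r \<subseteq> q \<and> r \<in> D x")
    case True
    then obtain r where r: "r \<in> P" "r \<subseteq> q" "r \<in> D x" by blast
    then have "f_mem P (\<subseteq>) (x, 1) \<tau> r"
      unfolding mem1[OF that(1)] using down[OF that(1)] by blast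
    then show ?thesis using r by (intro bexI[of _ r]) simp_all
  next
    case False
    then have "q' \<in> N x" if "q' \<in> P" "q' \<subseteq> q" for q'
      using that unfolding N_def by blast
    then have "f_mem P (\<subseteq>) (x, 0) \<tau> q"
      unfolding mem0[OF that(1)] by blast
    then show ?thesis using that by (intro bexI[of _ q]) simp_all
  qed
  have fn: "f_is_function P (\<subseteq>) X {0, 1} \<tau> p" if "p \<in> P" for p
  proof -
    have "\<not> (f_mem P (\<subseteq>) (x, y) \<tau> q \<and> f_mem P (\<subseteq>) (x, z) \<tau> q)"
      if "x \<in> X" "q \<in> P" "y \<in> {0, 1}" "z \<in> {0, 1}" "y \<noteq> z" for x q y z
    proof -
      have "y = 0 \<and> z = 1 \<or> y = 1 \<and> z = 0" using that(3-5) by auto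
      then show ?thesis using not_both[OF that(1,2)] by (elim disjE conjE) (simp, metis)
    qed
    note unique = this
    show ?thesis
      unfolding f_is_function_def f_all_def f_and_def f_ex_def f_not_def
    proof (intro ballI conjI impI)
      fix x i
      assume x: "x \<in> X" and i: "i \<in> {(y, z). y \<in> {0, 1} \<and> z \<in> {0, 1} \<and> y \<noteq> (z :: nat)}"
      obtain y z where yz: "i = (y, z)" by fastforce
      then have "y \<in> {0, 1}" "z \<in> {0, 1}" "y \<noteq> z" using i by auto
      then show "(case i of (y, z) \<Rightarrow> \<lambda>p. \<forall>q\<in>P. q \<subseteq> p \<longrightarrow>
          \<not> (f_mem P (\<subseteq>) (x, y) \<tau> q \<and> f_mem P (\<subseteq>) (x, z) \<tau> q)) p"
        unfolding yz prod.case using unique[OF x] by blast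
    qed (rule total)
  qed
  have new: "\<not> f_in_ground_model P (\<subseteq>) X {0, 1} \<tau> q" if q: "q \<in> P" for q
  proof
    assume "f_in_ground_model P (\<subseteq>) X {0, 1} \<tau> q"
    then obtain r g where r: "r \<in> P" "r \<subseteq> q" "g \<in> X \<rightarrow>\<^sub>E {0, 1}"
      and g: "\<forall>x\<in>X. f_mem P (\<subseteq>) (x, g x) \<tau> r"
      unfolding f_in_ground_model_def f_ex_def f_all_def using q by blast
    obtain x r0 r1 where x: "x \<in> X" "r0 \<in> P" "r0 \<subseteq> r" "\<forall>r'\<in>P. r' \<subseteq> r0 \<longrightarrow> r' \<notin> D x"
      "r1 \<in> D x" "r1 \<subseteq> r"
      using undecided[OF r(1)] by blast
    have "g x = 0 \<or> g x = 1" using r(3) x(1) by (auto simp: PiE_def Pi_def)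
    then show False
    proof
      assume "g x = 0"
      then have "\<forall>q\<in>P. q \<subseteq> r \<longrightarrow> (\<exists>r\<in>P. r \<subseteq> q \<and> r \<in> N x)"
        using g x(1) mem0 by metis
      moreover have "r1 \<in> P" using x(1,5) sub by blast
      ultimately obtain r2 where "r2 \<in> P" "r2 \<subseteq> r1" "r2 \<in> N x"
        using x(6) by blast
      then show False using down[OF x(1,5)] unfolding N_def by blast
    next
      assume "g x = 1"
      then have "\<forall>q\<in>P. q \<subseteq> r \<longrightarrow> (\<exists>r\<in>P. r \<subseteq> q \<and> r \<in> D x)"
        using g x(1) mem1 by metis
      then obtain r2 where "r2 \<in> P" "r2 \<subseteq> r0" "r2 \<in> D x"
        using x(2,3) by blast
      then show False using x(4) by blast
    qed
  qed
  have "\<tau> \<subseteq> (X \<times> {0, 1}) \<times> P"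
    unfolding \<tau>_def N_def using sub by blast
  then show ?thesis
    unfolding adds_new_function_def using fn new
    by (intro exI[of _ \<tau>]) (auto simp: f_and_def f_not_def)
qed

text \<open>Non-emptiness matters: for an empty set of conditions both notions hold
  vacuously.\<close>

lemma adds_new_function_not_distributive:
  fixes P :: "'a set set"
  assumes "adds_new_function P (\<subseteq>) X Y" and "P \<noteq> {}"
  shows "\<not> distributive P (\<subseteq>) X Y"
  using assms unfolding adds_new_function_def distributive_def f_and_def f_not_def by blast

lemma wf_recursion: "wf r \<Longrightarrow> \<exists>f. \<forall>x. f x = H (cut f r x) x"
  using wfrec by metis

section \<open>Regular cardinals\<close>

lemma Field_ord_rel: "Field (ord_rel a) = {..<a}"
  unfolding Field_def ord_rel_def by force

lemma underS_ord_rel: "b < a \<Longrightarrow> underS (ord_rel a) b = {..<b}"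
  unfolding underS_def ord_rel_def by auto

lemma card_lessThan_less:
  assumes "Card_order (ord_rel m)" "b < m"
  shows "|{..<b}| <o |{..<m}|"
  using card_of_underS[OF assms(1), of b] assms(2) card_of_Field_ordIso[OF assms(1)]
    ordLess_ordIso_trans ordIso_symmetric
  unfolding Field_ord_rel underS_ord_rel[OF assms(2)] by (metis lessThan_iff)

lemma card_of_finite_less: "finite A \<Longrightarrow> infinite B \<Longrightarrow> |A| <o |B|"
  using finite_ordLess_infinite[of "|A|" "|B|"] card_of_Well_order Field_card_of by metis

text \<open>If \<open>X\<close> were unbounded it would be cofinal in the strict sense of
  \<open>cofinal\<close>, and \<open>regularCard\<close> would give it the full cardinality.\<close>

lemma regular_bounded:
  assumes m: "regular_infinite_cardinal m" and X: "X \<subseteq> {..<m}" "|X| <o |{..<m}|"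
  shows "\<exists>z<m. \<forall>x\<in>X. x < z"
proof (rule ccontr)
  assume no: "\<not> ?thesis"
  have C: "Card_order (ord_rel m)" "regularCard (ord_rel m)"
    "cinfinite (ord_rel m)"
    using m unfolding regular_infinite_cardinal_def by auto
  have inf: "infinite {..<m}"
    using C(3) by (simp add: cinfinite_def Field_ord_rel)
  \<comment> \<open>A last element \<open>a\<close> could be removed from the infinite set
    \<open>{..<m}\<close> without changing its cardinality, although \<open>m\<close> is a
    cardinal.\<close>
  have lim: "\<exists>b<m. a < b" if "a < m" for a
  proof (rule ccontr)
    assume "\<not> ?thesis"
    then have eq: "{..<m} = insert a {..<a}" using that by fastforce
    then have "|{..<m}| =o |{..<a}|"
      using inf infinite_imp_bij_betw2[of "{..<a}" a]
      by (metis Un_insert_right card_of_ordIso finite_insert ordIso_symmetric sup_bot_right)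
    then show False using card_lessThan_less[OF C(1) that]
      by (metis not_ordLess_ordIso ordIso_symmetric)
  qed
  have "cofinal X (ord_rel m)"
    unfolding cofinal_def Field_ord_rel
  proof
    fix a assume "a \<in> {..<m}"
    then obtain b where b: "b < m" "a < b" using lim by blast
    then obtain x where x: "x \<in> X" "b \<le> x" using no by force
    moreover have "x < m" using x X by auto
    ultimately show "\<exists>b\<in>X. a \<noteq> b \<and> (a, b) \<in> ord_rel m"
      using b unfolding ord_rel_def by (intro bexI[of _ x]) auto
  qed
  then have "|X| =o ord_rel m"
    using C(2) X(1) unfolding regularCard_def Field_ord_rel by blast
  then have "|X| =o |{..<m}|"
    using card_of_Field_ordIso[OF C(1)] unfolding Field_ord_rel
    using ordIso_symmetric ordIso_transitive by blast
  then show False using X(2) by (metis not_ordLess_ordIso)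
qed

lemma regular_unbounded_card:
  assumes m: "regular_infinite_cardinal m" and X: "X \<subseteq> {..<m}" "\<And>x. x < m \<Longrightarrow> \<exists>y\<in>X. x \<le> y"
  shows "|X| =o |{..<m}|"
proof -
  have "\<not> |X| <o |{..<m}|"
    using regular_bounded[OF m X(1)] X(2) by (meson leD)
  then show ?thesis
    using card_of_mono1[OF X(1)] ordLeq_iff_ordLess_or_ordIso by blast
qed

lemma regular_card_unbounded:
  assumes m: "regular_infinite_cardinal m" and X: "X \<subseteq> {..<m}" "|{..<m}| \<le>o |X|" and x: "x < m"
  shows "\<exists>y\<in>X. x \<le> y"
proof (rule ccontr)
  assume "\<not> ?thesis"
  then have "X \<subseteq> {..<x}" by force
  then have "|{..<m}| \<le>o |{..<x}|" using X(2) card_of_mono1 ordLeq_transitive by blast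
  then show False
    using card_lessThan_less[of m x] m x unfolding regular_infinite_cardinal_def
    by (meson not_ordLess_ordLeq)
qed

lemma regular_infinite:
  assumes "regular_infinite_cardinal m" shows "infinite {..<m}"
  using assms by (auto simp: regular_infinite_cardinal_def cinfinite_def Field_ord_rel)

lemma regular_limit:
  assumes m: "regular_infinite_cardinal m" and "x < m" shows "\<exists>y<m. x < y"
proof -
  have "|{x}| <o |{..<m}|"
    using regular_infinite[OF m] card_of_finite_less[of "{x}"] by blast
  then show ?thesis using regular_bounded[OF m, of "{x}"] assms by auto
qed

section \<open>Closed trees\<close>

text \<open>The type may have a largest element, so this is the ordinal successor only if something
  lies above \<open>a\<close>; below \<open>lam\<close> that is always the case.\<close>

definition next_ord :: "'o::wellorder \<Rightarrow> 'o" where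
  "next_ord a = (LEAST x. a < x)"

lemma next_ord:
  assumes "a < b" shows "a < next_ord a" "next_ord a \<le> b" "x < next_ord a \<longleftrightarrow> x \<le> a"
proof -
  show 1: "a < next_ord a" unfolding next_ord_def using assms by (rule LeastI)
  show "next_ord a \<le> b" unfolding next_ord_def using assms by (rule Least_le)
  show "x < next_ord a \<longleftrightarrow> x \<le> a"
    using 1 not_less_Least[of x "\<lambda>x. a < x"] unfolding next_ord_def by (meson leI le_less_trans)
qed

lemma least_ord: obtains z :: "'o::wellorder" where "\<And>x. \<not> x < z"
  using that[of "LEAST x. True"] by (simp add: Least_le leD)

lemma len_eq: "dom t = {..<a} \<Longrightarrow> len t = a"
  unfolding len_def by (auto simp: lessThan_eq_iff)

section \<open>Sequences of ordinals and end-extension\<close>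

definition is_seq :: "'o::wellorder node \<Rightarrow> bool" where
  "is_seq t \<longleftrightarrow> (\<exists>a. dom t = {..<a})"

lemma is_seqI: "dom t = {..<a} \<Longrightarrow> is_seq t"
  unfolding is_seq_def by blast

lemma dom_seq: "is_seq t \<Longrightarrow> dom t = {..<len t}"
  unfolding is_seq_def using len_eq by blast

lemma seq_restrict:
  assumes "is_seq t" "a \<le> len t"
  shows "is_seq (t |` {..<a})" "len (t |` {..<a}) = a" "t |` {..<a} \<subseteq>\<^sub>m t"
proof -
  have d: "dom (t |` {..<a}) = {..<a}" using assms dom_seq[OF assms(1)] by auto
  show "is_seq (t |` {..<a})" "len (t |` {..<a}) = a" using is_seqI[OF d] len_eq[OF d] by auto
  show "t |` {..<a} \<subseteq>\<^sub>m t" by (auto simp: map_le_def)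
qed

lemma seq_le_iff:
  assumes "is_seq s" "is_seq t"
  shows "s \<subseteq>\<^sub>m t \<longleftrightarrow> len s \<le> len t \<and> t |` {..<len s} = s"
proof
  assume le: "s \<subseteq>\<^sub>m t"
  have "{..<len s} \<subseteq> {..<len t}"
    using map_le_implies_dom_le[OF le] dom_seq assms by metis
  moreover have "t |` {..<len s} = s"
  proof
    fix x show "(t |` {..<len s}) x = s x"
    proof (cases "x < len s")
      case True
      then show ?thesis using le dom_seq[OF assms(1)] by (auto simp: map_le_def)
    next
      case False
      then have "x \<notin> dom s" using dom_seq[OF assms(1)] by simp
      then show ?thesis using False by (simp add: domIff)
    qed
  qed
  ultimately show "len s \<le> len t \<and> t |` {..<len s} = s" by simp
next
  assume "len s \<le> len t \<and> t |` {..<len s} = s"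
  then show "s \<subseteq>\<^sub>m t" using seq_restrict(3)[OF assms(2)] by metis
qed

lemma seq_le_comparable:
  assumes "is_seq s" "is_seq t" "is_seq u" "s \<subseteq>\<^sub>m u" "t \<subseteq>\<^sub>m u" "len s \<le> len t"
  shows "s \<subseteq>\<^sub>m t"
proof -
  have st: "u |` {..<len s} = s" "u |` {..<len t} = t"
    using assms seq_le_iff by metis+
  have "(u |` {..<len t}) |` {..<len s} = u |` {..<len s}"
    using assms(6) by (auto simp: restrict_map_def fun_eq_iff)
  then have "t |` {..<len s} = s" unfolding st .
  then show ?thesis using assms seq_le_iff by blast
qed

lemma seq_le_eq: "is_seq s \<Longrightarrow> is_seq t \<Longrightarrow> s \<subseteq>\<^sub>m t \<Longrightarrow> len t \<le> len s \<Longrightarrow> s = t"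
  by (metis antisym map_le_antisym seq_le_comparable map_le_refl)

lemma seq_le_value: "s \<subseteq>\<^sub>m t \<Longrightarrow> is_seq s \<Longrightarrow> x < len s \<Longrightarrow> t x = s x"
  using dom_seq[of s] by (auto simp: map_le_def)

lemma seq_append:
  assumes "is_seq t" "len t < m"
  shows "is_seq (t(len t \<mapsto> b))" "len (t(len t \<mapsto> b)) = next_ord (len t)" "t \<subseteq>\<^sub>m t(len t \<mapsto> b)"
    "t(len t \<mapsto> b) |` {..<len t} = t"
proof -
  have "dom (t(len t \<mapsto> b)) = insert (len t) {..<len t}" using dom_seq[OF assms(1)] by auto
  also have "\<dots> = {..<next_ord (len t)}" using next_ord(3)[OF assms(2)] by (auto simp: le_less)
  finally have d: "dom (t(len t \<mapsto> b)) = {..<next_ord (len t)}" .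
  show s: "is_seq (t(len t \<mapsto> b))" "len (t(len t \<mapsto> b)) = next_ord (len t)"
    using is_seqI[OF d] len_eq[OF d] by auto
  show l: "t \<subseteq>\<^sub>m t(len t \<mapsto> b)" using dom_seq[OF assms(1)] by (auto simp: map_le_def)
  show "t(len t \<mapsto> b) |` {..<len t} = t" using l s seq_le_iff[OF assms(1) s(1)] by blast
qed

lemma seq_append_le:
  assumes "is_seq t" "is_seq u" "t \<subseteq>\<^sub>m u" "len t < len u" "u (len t) = Some b"
  shows "t(len t \<mapsto> b) \<subseteq>\<^sub>m u"
  using assms by (auto simp: map_le_def)

text \<open>The usual restriction of a condition to a node: it forces the generic branch to pass
  through \<open>t\<close>.\<close>

definition cone :: "'o::wellorder node set \<Rightarrow> 'o node \<Rightarrow> 'o node set" where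
  "cone p t = {u \<in> p. u \<subseteq>\<^sub>m t \<or> t \<subseteq>\<^sub>m u}"

text \<open>Splitting in the weakest sense. The pruned trees below have a single successor at every
  node where they are not meant to split, so this notion sees exactly the intended nodes.\<close>

definition Split :: "'o::wellorder node set \<Rightarrow> 'o node set" where
  "Split p = {s \<in> p. \<exists>a\<in>OSucc p s. \<exists>b\<in>OSucc p s. a \<noteq> b}"

lemma OSucc_mono: "q \<subseteq> p \<Longrightarrow> OSucc q s \<subseteq> OSucc p s"
  unfolding OSucc_def by blast

lemma Split_mono: "q \<subseteq> p \<Longrightarrow> Split q \<subseteq> Split p"
  unfolding Split_def OSucc_def by blast

lemma cone_subset: "cone p t \<subseteq> p"
  unfolding cone_def by blast

lemma Succ_eq: "Succ T t = (\<lambda>b. t(len t \<mapsto> b)) ` OSucc T t"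
  unfolding Succ_def OSucc_def by blast

lemma card_Succ: "|Succ T t| =o |OSucc T t|"
proof -
  have inj: "inj_on (\<lambda>b. t(len t \<mapsto> b)) (OSucc T t)"
    by (rule inj_onI) (metis fun_upd_same option.inject)
  show ?thesis
    unfolding Succ_eq
    by (rule ordIso_symmetric[OF card_of_ordIsoI[OF inj_on_imp_bij_betw[OF inj]]])
qed

lemma splitting_iff: "splitting k T \<alpha> t \<longleftrightarrow> |{..<k \<alpha>}| \<le>o |OSucc T t|"
  unfolding splitting_def
  using ordLeq_ordIso_trans[OF _ card_Succ] ordLeq_ordIso_trans[OF _ ordIso_symmetric[OF card_Succ]]
  by (intro iffI)

text \<open>The hypotheses of the theorem in the form in which the arguments consume them:
  regularity of \<open>lam\<close> as boundedness of short sequences, singularity of the supremum as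
  \<open>lam_less_k\<close>, the arithmetic as \<open>continuum_less_k\<close>.\<close>

locale cardinal_tower =
  fixes lam :: "'o::wellorder" and k :: "'o \<Rightarrow> 'o"
  assumes k_regular: "\<And>\<alpha>. \<alpha> < lam \<Longrightarrow> regular_infinite_cardinal (k \<alpha>)"
    and k_mono: "\<And>\<alpha> \<beta>. \<alpha> < \<beta> \<Longrightarrow> \<beta> < lam \<Longrightarrow> k \<alpha> < k \<beta>"
    and lam_regular: "\<And>b f. b < lam \<Longrightarrow> f ` {..<b} \<subseteq> {..<lam} \<Longrightarrow> \<exists>z<lam. \<forall>y<b. f y < z"
    and omega_lam: "omega < lam"
    and infinite_omega: "infinite {..<omega::'o}"
    and lam_less_k: "\<exists>\<beta><lam. lam < k \<beta>"
    and continuum_less_k: "\<exists>\<gamma><lam. |UNIV :: nat set set| <o |{..<k \<gamma>}|"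
begin

lemma k_mono_le: "\<alpha> \<le> \<beta> \<Longrightarrow> \<beta> < lam \<Longrightarrow> k \<alpha> \<le> k \<beta>"
  using k_mono by (metis le_less)

lemma k_infinite: "\<alpha> < lam \<Longrightarrow> infinite {..<k \<alpha>}"
  using regular_infinite[OF k_regular] .

lemma lam_countable:
  assumes "\<And>n::nat. g n < lam"
  shows "\<exists>z<lam. \<forall>n. g n < z"
proof -
  obtain i :: "nat \<Rightarrow> 'o" where i: "inj i" "range i \<subseteq> {..<omega}"
    using infinite_omega infinite_countable_subset by blast
  have "(\<lambda>y. g (inv i y)) ` {..<omega} \<subseteq> {..<lam}" using assms by auto
  from lam_regular[OF omega_lam this] obtain z where "z < lam" "\<And>y. y < omega \<Longrightarrow> g (inv i y) < z"
    by blast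
  then show ?thesis using i by (metis inv_f_f lessThan_iff rangeI subsetD)
qed

lemma next_ord_lam: "a < lam \<Longrightarrow> next_ord a < lam"
  using lam_countable[of "\<lambda>_. a"] next_ord(2) by (metis le_less_trans)

lemma lam_next: "a < lam \<Longrightarrow> a < next_ord a"
  using next_ord(1) .

definition ctree :: "'o node set \<Rightarrow> bool" where
  "ctree p \<longleftrightarrow> is_tree lam k p \<and> lt_closed lam p"

lemma ctree_node:
  assumes "ctree p" "t \<in> p"
  shows "is_seq t" "len t < lam" "x < len t \<Longrightarrow> \<exists>b<k x. t x = Some b"
proof -
  obtain a where a: "a < lam" "dom t = {..<a}" "\<forall>\<beta><a. the (t \<beta>) < k \<beta>"
    using assms unfolding ctree_def is_tree_def nodes_def by blast
  then show "is_seq t" "len t < lam" using is_seqI[of t a] len_eq[of t a] by auto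
  show "\<exists>b<k x. t x = Some b" if "x < len t"
    using a that len_eq[OF a(2)] by (metis domD lessThan_iff option.sel)
qed

lemma nodes_le:
  assumes "t \<in> nodes lam k" "is_seq s" "s \<subseteq>\<^sub>m t" shows "s \<in> nodes lam k"
proof -
  obtain a where a: "a < lam" "dom t = {..<a}" "\<forall>\<beta><a. the (t \<beta>) < k \<beta>"
    using assms unfolding nodes_def by blast
  have "len s \<le> a" using assms(2,3) is_seqI[OF a(2)] seq_le_iff len_eq[OF a(2)] by metis
  then show ?thesis
    unfolding nodes_def using a dom_seq[OF assms(2)] seq_le_value[OF assms(3,2)]
    by (intro CollectI exI[of _ "len s"]) (force dest: less_le_trans)
qed

lemma ctree_le:
  assumes "ctree p" "t \<in> p" "is_seq s" "s \<subseteq>\<^sub>m t" shows "s \<in> p"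
  using assms nodes_le[of t s] unfolding ctree_def is_tree_def by blast

lemma ctree_restrict:
  assumes "ctree p" "t \<in> p" shows "t |` {..<a} \<in> p"
proof (cases "a \<le> len t")
  case True
  then show ?thesis
    using ctree_le[OF assms] seq_restrict ctree_node(1)[OF assms] by blast
next
  case False
  then have "dom t \<subseteq> {..<a}" using dom_seq[OF ctree_node(1)[OF assms]] by auto
  then have "x < a \<or> t x = None" for x by (metis domIff lessThan_iff subsetD)
  then have "(t |` {..<a}) x = t x" for x by (metis lessThan_iff restrict_in restrict_out)
  then have "t |` {..<a} = t" by blast
  then show ?thesis using assms by simp
qed

lemma OSucc_less: "ctree p \<Longrightarrow> t \<in> p \<Longrightarrow> b \<in> OSucc p t \<Longrightarrow> b < k (len t)"
  using ctree_node[of p t] ctree_node(3)[of p "t(len t \<mapsto> b)" "len t"] seq_append[of t lam b]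
    lam_next[of "len t"]
  unfolding OSucc_def by auto

lemma OSuccI:
  assumes "ctree p" "u \<in> p" "t \<subseteq>\<^sub>m u" "is_seq t" "len t < len u"
  shows "the (u (len t)) \<in> OSucc p t"
proof -
  obtain b where b: "u (len t) = Some b" using ctree_node(3)[OF assms(1,2,5)] by blast
  have "len t < lam" using assms ctree_node(2) less_trans by blast
  then show ?thesis
    using seq_append_le[OF assms(4) ctree_node(1)[OF assms(1,2)] assms(3,5) b]
      ctree_le[OF assms(1,2)] seq_append(1)[OF assms(4)] b
    unfolding OSucc_def by auto
qed

lemma ctree_nonempty: "ctree p \<Longrightarrow> \<exists>t. t \<in> p"
  unfolding ctree_def is_tree_def by blast

lemma ctree_proper_extension:
  assumes "ctree p" "t \<in> p" obtains u where "u \<in> p" "t \<subseteq>\<^sub>m u" "t \<noteq> u"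
  using assms unfolding ctree_def lt_closed_def by blast

lemma OSucc_nonempty:
  assumes "ctree p" "t \<in> p" shows "OSucc p t \<noteq> {}"
proof -
  obtain u where u: "u \<in> p" "t \<subseteq>\<^sub>m u" "t \<noteq> u"
    using ctree_proper_extension[OF assms] by blast
  then have "len t < len u"
    using seq_le_eq ctree_node(1) assms by (metis leI)
  then show ?thesis using OSuccI[OF assms(1) u(1,2) ctree_node(1)[OF assms]] by blast
qed

lemma ctree_limit:
  assumes "ctree p" "\<delta> < lam" "is_limit \<delta>" "dom f = {..<\<delta>}" "\<And>\<beta>. \<beta> < \<delta> \<Longrightarrow> f |` {..<\<beta>} \<in> p"
  shows "f \<in> p"
  using assms unfolding ctree_def lt_closed_def by blast

lemma ord_cases:
  obtains (zero) "\<And>x. \<not> x < (\<beta>::'o)" | (succ) \<alpha> where "\<alpha> < \<beta>" "\<beta> = next_ord \<alpha>" | (limit) "is_limit \<beta>"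
proof -
  have "\<beta> = next_ord \<alpha>" if "\<alpha> < \<beta>" "\<forall>y<\<beta>. \<not> \<alpha> < y" for \<alpha>
    using next_ord[OF that(1)] that by (metis less_le)
  then show ?thesis using that unfolding is_limit_def by blast
qed

text \<open>The branch copies \<open>t\<close> and then obeys the strategy \<open>\<sigma>\<close>.
  It stays in \<open>p\<close> at successors by the choice of \<open>\<sigma>\<close> and at limits
  by closure of the tree.\<close>

lemma follow_branch:
  assumes p: "ctree p" and t: "t \<in> p" and \<sigma>: "\<And>s. s \<in> p \<Longrightarrow> \<sigma> s \<in> OSucc p s"
  obtains b where "dom b = {..<lam}" "t \<subseteq>\<^sub>m b" "\<And>\<beta>. \<beta> < lam \<Longrightarrow> b |` {..<\<beta>} \<in> p"
    "\<And>\<beta>. len t \<le> \<beta> \<Longrightarrow> \<beta> < lam \<Longrightarrow> b \<beta> = Some (\<sigma> (b |` {..<\<beta>}))"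
proof -
  note tn = ctree_node[OF p t]
  define H :: "('o \<Rightarrow> 'o option) \<Rightarrow> 'o \<Rightarrow> 'o option" where
    "H b \<beta> = (if \<beta> < len t then t \<beta> else if \<beta> < lam then Some (\<sigma> (b |` {..<\<beta>})) else None)"
    for b \<beta>
  have "wf {(x::'o, y). x < y}" by (rule wf)
  from wf_recursion[OF this, of H] obtain b
    where b: "\<And>\<beta>. b \<beta> = H (cut b {(x, y). x < y} \<beta>) \<beta>" by blast
  have "cut b {(x, y). x < y} \<beta> |` {..<\<beta>} = b |` {..<\<beta>}" for \<beta>
    by (auto simp: cut_def restrict_map_def)
  then have b: "b \<beta> = (if \<beta> < len t then t \<beta> else if \<beta> < lam then Some (\<sigma> (b |` {..<\<beta>})) else None)" for \<beta>
    using b[of \<beta>] unfolding H_def by simp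
  have dom: "dom b = {..<lam}"
  proof -
    have "b x \<noteq> None \<longleftrightarrow> x < lam" for x
      using b[of x] tn(3)[of x] tn(2) by (cases "x < len t") auto
    then show ?thesis by (auto simp: dom_def)
  qed
  have tb: "t \<subseteq>\<^sub>m b" using b dom_seq[OF tn(1)] by (auto simp: map_le_def)
  have small: "b |` {..<\<beta>} \<in> p" if "\<beta> \<le> len t" for \<beta>
  proof -
    have "b |` {..<\<beta>} = t |` {..<\<beta>}" using b that by (auto simp: restrict_map_def fun_eq_iff)
    then show ?thesis using ctree_restrict[OF p t] by simp
  qed
  have in_p: "b |` {..<\<beta>} \<in> p" if "\<beta> < lam" for \<beta>
    using that
  proof (induction \<beta> rule: less_induct)
    case (less \<beta>)
    show ?case
    proof (cases "\<beta> \<le> len t")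
      case False
      have d: "dom (b |` {..<\<gamma>}) = {..<\<gamma>}" if "\<gamma> < lam" for \<gamma> using dom that by auto
      show ?thesis
      proof (cases \<beta> rule: ord_cases)
        case zero
        then show ?thesis using False by (meson leI)
      next
        case (succ \<alpha>)
        have a: "\<alpha> < lam" using succ less by auto
        then have r: "b |` {..<\<alpha>} \<in> p" using less succ by blast
        have l: "len (b |` {..<\<alpha>}) = \<alpha>" using len_eq[OF d[OF a]] .
        have ba: "b \<alpha> = Some (\<sigma> (b |` {..<\<alpha>}))"
          using False succ b[of \<alpha>] a next_ord(3)[OF succ(1), of "len t"]
          by (auto simp: not_le not_less)
        have "b |` {..<\<beta>} = (b |` {..<\<alpha>})(\<alpha> \<mapsto> \<sigma> (b |` {..<\<alpha>}))"
          using ba next_ord(3)[OF succ(1)] succ(2)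
          by (auto simp: restrict_map_def fun_eq_iff le_less)
        then show ?thesis using \<sigma>[OF r] l unfolding OSucc_def mem_Collect_eq by (simp only:)
      next
        case limit
        show ?thesis
        proof (rule ctree_limit[OF p less.prems limit d[OF less.prems]])
          fix \<gamma> assume g: "\<gamma> < \<beta>"
          then have "b |` {..<\<beta>} |` {..<\<gamma>} = b |` {..<\<gamma>}"
            by (auto simp: restrict_map_def fun_eq_iff)
          then show "b |` {..<\<beta>} |` {..<\<gamma>} \<in> p" using less g by auto
        qed
      qed
    qed (rule small)
  qed
  have "b \<beta> = Some (\<sigma> (b |` {..<\<beta>}))" if "len t \<le> \<beta>" "\<beta> < lam" for \<beta>
    using b[of \<beta>] that leD by fastforce
  then show ?thesis using that[OF dom tb in_p] by blast
qed

lemma branch: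
  assumes p: "ctree p" and t: "t \<in> p"
  obtains b where "dom b = {..<lam}" "t \<subseteq>\<^sub>m b" "\<And>\<beta>. \<beta> < lam \<Longrightarrow> b |` {..<\<beta>} \<in> p"
proof -
  have "(SOME a. a \<in> OSucc p s) \<in> OSucc p s" if "s \<in> p" for s
    using OSucc_nonempty[OF p that] some_in_eq by blast
  from follow_branch[OF p t, of "\<lambda>s. SOME a. a \<in> OSucc p s", OF this] that show ?thesis by metis
qed

lemma branch_restrict:
  assumes "dom b = {..<lam}" "\<beta> < lam"
  shows "is_seq (b |` {..<\<beta>})" "len (b |` {..<\<beta>}) = \<beta>"
proof -
  have "dom (b |` {..<\<beta>}) = {..<\<beta>}" using assms by auto
  then show "is_seq (b |` {..<\<beta>})" "len (b |` {..<\<beta>}) = \<beta>" using is_seqI len_eq by blast+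
qed

lemma branch_le:
  assumes "dom b = {..<lam}" "\<beta> < lam" "is_seq s" "s \<subseteq>\<^sub>m b" "len s \<le> \<beta>"
  shows "s \<subseteq>\<^sub>m b |` {..<\<beta>}"
  using assms dom_seq[OF assms(3)] by (auto simp: map_le_def restrict_map_def)

lemma extend_len:
  assumes p: "ctree p" and t: "t \<in> p" and "\<beta> < lam" "len t \<le> \<beta>"
  obtains u where "u \<in> p" "t \<subseteq>\<^sub>m u" "len u = \<beta>"
proof -
  obtain b where b: "dom b = {..<lam}" "t \<subseteq>\<^sub>m b" "\<And>\<beta>. \<beta> < lam \<Longrightarrow> b |` {..<\<beta>} \<in> p"
    using branch[OF p t] by blast
  then show ?thesis
    using that[of "b |` {..<\<beta>}"] branch_restrict[OF b(1)] branch_le[OF b(1)] assms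
      ctree_node(1)[OF p t] by blast
qed

lemma ctree_cone:
  assumes p: "ctree p" and t: "t \<in> p" shows "ctree (cone p t)"
  unfolding ctree_def
proof
  note tn = ctree_node[OF p t]
  have "\<forall>u\<in>cone p t. \<forall>s\<in>nodes lam k. s \<subseteq>\<^sub>m u \<longrightarrow> s \<in> cone p t"
  proof (intro ballI impI)
    fix u s assume u: "u \<in> cone p t" and s: "s \<in> nodes lam k" "s \<subseteq>\<^sub>m u"
    have ss: "is_seq s" using s(1) unfolding nodes_def is_seq_def by blast
    have up: "u \<in> p" using u cone_subset by blast
    have "s \<in> p" using ctree_le[OF p up ss s(2)] .
    moreover have "s \<subseteq>\<^sub>m t \<or> t \<subseteq>\<^sub>m s"
    proof (cases "u \<subseteq>\<^sub>m t")
      case True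
      then show ?thesis using s(2) map_le_trans by blast
    next
      case False
      then have "t \<subseteq>\<^sub>m u" using u unfolding cone_def by blast
      then show ?thesis
        using seq_le_comparable[OF ss tn(1) ctree_node(1)[OF p up] s(2)]
          seq_le_comparable[OF tn(1) ss ctree_node(1)[OF p up] _ s(2)] by (meson linear)
    qed
    ultimately show "s \<in> cone p t" unfolding cone_def by blast
  qed
  moreover have "t \<in> cone p t" using t unfolding cone_def by simp
  ultimately show "is_tree lam k (cone p t)"
    using p unfolding is_tree_def ctree_def cone_def by blast
  have 1: "\<exists>v\<in>cone p t. u \<subseteq>\<^sub>m v \<and> u \<noteq> v" if u: "u \<in> cone p t" for u
  proof (cases "t \<subseteq>\<^sub>m u")
    case True
    have "u \<in> p" using u cone_subset by blast
    then obtain v where v: "v \<in> p" "u \<subseteq>\<^sub>m v" "u \<noteq> v"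
      using ctree_proper_extension[OF p] by blast
    then have "v \<in> cone p t" using map_le_trans[OF True v(2)] unfolding cone_def by simp
    then show ?thesis using v(2,3) by blast
  next
    case False
    then have "u \<subseteq>\<^sub>m t" "u \<noteq> t" using u unfolding cone_def by auto
    then show ?thesis using \<open>t \<in> cone p t\<close> by blast
  qed
  have 2: "f \<in> cone p t"
    if f: "\<delta> < lam" "is_limit \<delta>" "dom f = {..<\<delta>}" "\<forall>\<beta><\<delta>. f |` {..<\<beta>} \<in> cone p t" for \<delta> f
  proof -
    have fp: "f \<in> p" using f ctree_limit[OF p] cone_subset by blast
    have fs: "is_seq f" "len f = \<delta>" using f(3) is_seqI len_eq by blast+
    have r: "is_seq (f |` {..<\<beta>})" "len (f |` {..<\<beta>}) = \<beta>" "f |` {..<\<beta>} \<subseteq>\<^sub>m f" if "\<beta> < \<delta>" for \<beta>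
      using seq_restrict[OF fs(1)] fs(2) that by auto
    \<comment> \<open>A limit node either has passed \<open>t\<close> at an earlier stage or is a
      union of initial segments of \<open>t\<close>.\<close>
    have "f \<subseteq>\<^sub>m t \<or> t \<subseteq>\<^sub>m f"
    proof (cases "\<exists>\<beta><\<delta>. t \<subseteq>\<^sub>m f |` {..<\<beta>}")
      case True
      then show ?thesis using r(3) map_le_trans by blast
    next
      case False
      then have le: "f |` {..<\<beta>} \<subseteq>\<^sub>m t" if "\<beta> < \<delta>" for \<beta> using f(4) that unfolding cone_def by blast
      have "f \<subseteq>\<^sub>m t" unfolding map_le_def
      proof
        fix x assume "x \<in> dom f"
        then obtain y where y: "x < y" "y < \<delta>" using f(2,3) unfolding is_limit_def by blast
        then have "x \<in> dom (f |` {..<y})" using f(3) by auto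
        then show "f x = t x" using le[OF y(2)] y(1) unfolding map_le_def by force
      qed
      then show ?thesis by blast
    qed
    then show ?thesis using fp unfolding cone_def by blast
  qed
  show "lt_closed lam (cone p t)"
    unfolding lt_closed_def using 1 2 by blast
qed

lemma OSucc_cone:
  assumes p: "ctree p" and "u \<in> p" "t \<subseteq>\<^sub>m u"
  shows "OSucc (cone p t) u = OSucc p u"
proof -
  have "t \<subseteq>\<^sub>m u(len u \<mapsto> b)" for b
    using assms map_le_trans seq_append(3) ctree_node[OF p assms(2)] by blast
  then show ?thesis unfolding OSucc_def cone_def by blast
qed

text \<open>A node of the cone that does not extend \<open>t\<close> lies properly below it, and
  there the only successor comparable with \<open>t\<close> is the one along
  \<open>t\<close>.\<close>

lemma Split_cone:
  assumes p: "ctree p" and t: "t \<in> p" and s: "s \<in> Split (cone p t)"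
  shows "t \<subseteq>\<^sub>m s"
proof (rule ccontr)
  assume no: "\<not> t \<subseteq>\<^sub>m s"
  have sc: "s \<in> p" "s \<subseteq>\<^sub>m t" using s no unfolding Split_def cone_def by blast+
  note sn = ctree_node[OF p sc(1)] and tn = ctree_node[OF p t]
  have lt: "len s < len t" using no seq_le_eq[OF sn(1) tn(1) sc(2)] by (metis leI map_le_refl)
  have "b = the (t (len s))" if b: "b \<in> OSucc (cone p t) s" for b
  proof -
    let ?u = "s(len s \<mapsto> b)"
    have u: "?u \<in> p" "?u \<subseteq>\<^sub>m t \<or> t \<subseteq>\<^sub>m ?u" using b unfolding OSucc_def cone_def by auto
    have l: "len s < len ?u" using seq_append(2)[OF sn(1,2)] lam_next sn(2) by auto
    have "t (len s) = ?u (len s)"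
      using u(2) seq_le_value[OF _ tn(1) lt] seq_le_value[OF _ ctree_node(1)[OF p u(1)] l] by metis
    then show ?thesis by simp
  qed
  then show False using s unfolding Split_def by blast
qed

text \<open>The tree \<open>r\<close> has nodes of length at least \<open>len t\<close>; comparable
  with \<open>t\<close>, they must extend it. Thus a condition below the cone has decided the branch
  up to \<open>t\<close>.\<close>

lemma ctree_subset_cone:
  assumes p: "ctree p" and t: "t \<in> p" and r: "ctree r" "r \<subseteq> cone p t"
  shows "t \<in> r"
proof -
  obtain r0 where r0: "r0 \<in> r" using ctree_nonempty[OF r(1)] by blast
  define m where "m = max (len r0) (len t)"
  have "m < lam" using ctree_node(2)[OF r(1) r0] ctree_node(2)[OF p t] unfolding m_def by simp
  then obtain u where u: "u \<in> r" "r0 \<subseteq>\<^sub>m u" "len u = m"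
    using extend_len[OF r(1) r0] max.cobounded1[of "len r0" "len t"] unfolding m_def by blast
  have "len t \<le> len u" using u m_def by simp
  moreover have "u \<subseteq>\<^sub>m t \<or> t \<subseteq>\<^sub>m u" "u \<in> p" using u r(2) unfolding cone_def by blast+
  ultimately have "t \<subseteq>\<^sub>m u"
    using seq_le_eq[OF ctree_node(1)[OF p] ctree_node(1)[OF p t]] by blast
  then show ?thesis using ctree_le[OF r(1) u(1)] ctree_node(1)[OF p t] by blast
qed

lemma ctree_has_len:
  assumes p: "ctree p" and "\<beta> < lam"
  obtains u where "u \<in> p" "len u = \<beta>"
proof -
  obtain t where t: "t \<in> p" using ctree_nonempty[OF p] by blast
  obtain b where b: "dom b = {..<lam}" "t \<subseteq>\<^sub>m b" "\<And>\<beta>. \<beta> < lam \<Longrightarrow> b |` {..<\<beta>} \<in> p"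
    using branch[OF p t] by blast
  then show ?thesis
    using that[of "b |` {..<\<beta>}"] branch_restrict[OF b(1)] assms by blast
qed

end

section \<open>New subsets from colourings and antichains\<close>

definition initial_rel :: "('o::wellorder node \<times> 'o node) set" where
  "initial_rel = {(s, t). is_seq s \<and> is_seq t \<and> s \<subseteq>\<^sub>m t \<and> s \<noteq> t}"

lemma initial_rel_len: "(s, t) \<in> initial_rel \<Longrightarrow> len s < len t"
  unfolding initial_rel_def using seq_le_eq[of s t] by (auto simp: not_le[symmetric])

lemma wf_initial_rel: "wf (initial_rel :: ('o::wellorder node \<times> 'o node) set)"
proof (rule wf_subset)
  show "wf (inv_image {(x::'o, y). x < y} len)" using wf by (rule wf_inv_image)
  show "initial_rel \<subseteq> inv_image {(x::'o, y). x < y} len" using initial_rel_len by (auto simp: in_inv_image)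
qed

text \<open>Each \<open>e n\<close> moves \<open>x\<close> down and preserves the relation, so the
  rank of \<open>x\<close> inside \<open>Z n\<close> drops with every \<open>n\<close>. To exhibit
  the descent in a single relation, compose: with \<open>\<psi> n\<close> equal to
  \<open>e 0 \<circ> \<dots> \<circ> e (n - 1)\<close>, the points \<open>\<psi> n x\<close> form a
  decreasing sequence.\<close>

lemma no_regressive_chain:
  assumes "wf R"
    and e: "\<And>n x. x \<in> Z (Suc n) \<Longrightarrow> e n x \<in> Z n \<and> (e n x, x) \<in> R"
    and mono: "\<And>n x y. x \<in> Z (Suc n) \<Longrightarrow> y \<in> Z (Suc n) \<Longrightarrow> (x, y) \<in> R \<Longrightarrow> (e n x, e n y) \<in> R"
  shows "\<exists>n::nat. x \<notin> Z n"
proof (rule ccontr)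
  assume "\<not> ?thesis"
  then have x: "x \<in> Z n" for n by blast
  define \<psi> where "\<psi> = rec_nat id (\<lambda>n f. f \<circ> e n)"
  have \<psi>: "\<psi> 0 = id" "\<psi> (Suc n) = \<psi> n \<circ> e n" for n unfolding \<psi>_def by simp_all
  have m: "(\<psi> n y, \<psi> n z) \<in> R" if "y \<in> Z n" "z \<in> Z n" "(y, z) \<in> R" for n y z
    using that
  proof (induction n arbitrary: y z)
    case (Suc n)
    have "(\<psi> n (e n y), \<psi> n (e n z)) \<in> R"
      using Suc.IH e[OF Suc.prems(1)] e[OF Suc.prems(2)] mono[OF Suc.prems] by blast
    then show ?case by (simp only: \<psi> o_apply)
  qed (simp add: \<psi>)
  have "(\<psi> (Suc n) x, \<psi> n x) \<in> R" for n
    using m[of "e n x" n x] e[OF x, of n] x by (simp only: \<psi> o_apply)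
  then have "\<exists>f. \<forall>n. (f (Suc n), f n) \<in> R" by (intro exI[of _ "\<lambda>n. \<psi> n x"]) simp
  then show False using assms(1) unfolding wf_iff_no_infinite_down_chain by simp
qed

text \<open>Zorn on the subsets of \<open>E\<close> in which distinct elements have no common
  extension in \<open>P\<close>. An element of \<open>E\<close> compatible with no member could be
  added to a maximal one.\<close>

lemma maximal_antichain:
  fixes E P :: "'a set set"
  obtains M where "M \<subseteq> E"
    "\<And>x y r. x \<in> M \<Longrightarrow> y \<in> M \<Longrightarrow> r \<in> P \<Longrightarrow> r \<subseteq> x \<Longrightarrow> r \<subseteq> y \<Longrightarrow> x = y"
    "\<And>x. x \<in> E \<Longrightarrow> x \<in> P \<Longrightarrow> \<exists>y\<in>M. \<exists>r\<in>P. r \<subseteq> x \<and> r \<subseteq> y"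
proof -
  define \<A> where "\<A> = {M. M \<subseteq> E \<and> (\<forall>x\<in>M. \<forall>y\<in>M. \<forall>r\<in>P. r \<subseteq> x \<and> r \<subseteq> y \<longrightarrow> x = y)}"
  have "\<Union>C \<in> \<A>" if C: "subset.chain \<A> C" for C
  proof -
    have sub: "C \<subseteq> \<A>" and lin: "\<And>X Y. X \<in> C \<Longrightarrow> Y \<in> C \<Longrightarrow> X \<subseteq> Y \<or> Y \<subseteq> X"
      using C unfolding subset.chain_def by blast+
    have "x = y" if "x \<in> \<Union>C" "y \<in> \<Union>C" "r \<in> P" "r \<subseteq> x" "r \<subseteq> y" for x y r
    proof -
      obtain X Y where XY: "X \<in> C" "Y \<in> C" "x \<in> X" "y \<in> Y" using \<open>x \<in> \<Union>C\<close> \<open>y \<in> \<Union>C\<close> by blast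
      then obtain Z where "Z \<in> C" "x \<in> Z" "y \<in> Z" using lin[of X Y] by blast
      then show ?thesis using that sub unfolding \<A>_def by blast
    qed
    moreover have "\<Union>C \<subseteq> E" using sub unfolding \<A>_def by blast
    ultimately show ?thesis unfolding \<A>_def by blast
  qed
  from subset_Zorn'[of \<A>, OF this] obtain M
    where M: "M \<in> \<A>" "\<And>X. X \<in> \<A> \<Longrightarrow> M \<subseteq> X \<Longrightarrow> X = M" by blast
  have ac: "x = y" if "x \<in> M" "y \<in> M" "r \<in> P" "r \<subseteq> x" "r \<subseteq> y" for x y r
    using M(1) that unfolding \<A>_def by blast
  have pd: "\<exists>y\<in>M. \<exists>r\<in>P. r \<subseteq> x \<and> r \<subseteq> y" if x: "x \<in> E" "x \<in> P" for x
  proof (rule ccontr)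
    assume no: "\<not> ?thesis"
    have "insert x M \<in> \<A>"
      unfolding \<A>_def
    proof (intro CollectI conjI ballI impI)
      show "insert x M \<subseteq> E" using M(1) x unfolding \<A>_def by blast
      fix y z r assume "y \<in> insert x M" "z \<in> insert x M" "r \<in> P" "r \<subseteq> y \<and> r \<subseteq> z"
      then show "y = z" using no ac by (elim insertE) metis+
    qed
    then have "x \<in> M" using M(2) by blast
    then show False using no x(2) by blast
  qed
  show ?thesis using that[of M] M(1) ac pd unfolding \<A>_def by blast
qed

context cardinal_tower begin

definition cone_closed :: "'o node set set \<Rightarrow> bool" where
  "cone_closed P \<longleftrightarrow> (\<forall>p\<in>P. ctree p \<and> (\<forall>t\<in>p. cone p t \<in> P))"

lemma cone_closedD:
  "cone_closed P \<Longrightarrow> p \<in> P \<Longrightarrow> ctree p" "cone_closed P \<Longrightarrow> p \<in> P \<Longrightarrow> t \<in> p \<Longrightarrow> cone p t \<in> P"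
  unfolding cone_closed_def by blast+

lemma comparable_same_len:
  "is_seq s \<Longrightarrow> is_seq t \<Longrightarrow> s \<subseteq>\<^sub>m t \<or> t \<subseteq>\<^sub>m s \<Longrightarrow> len s = len t \<Longrightarrow> s = t"
  using seq_le_eq[of s t] seq_le_eq[of t s] by auto

text \<open>Bit \<open>\<gamma>\<close> of the name is the colour of the generic branch at level
  \<open>\<rho> \<gamma>\<close>. The cone at a coloured node forces this bit to be 1; below the
  cone at an uncoloured node of the same level no condition does.\<close>

lemma level_colouring:
  assumes P: "cone_closed P"
    and col: "\<And>q. q \<in> P \<Longrightarrow> \<exists>\<gamma><lam. \<exists>t\<in>q. \<exists>u\<in>q. len t = \<rho> \<gamma> \<and> len u = \<rho> \<gamma> \<and> c \<gamma> t \<and> \<not> c \<gamma> u"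
  shows "adds_new_function P (\<subseteq>) {..<lam} {0, 1 :: nat}"
proof -
  define D where "D \<gamma> = {r \<in> P. \<exists>t. is_seq t \<and> len t = \<rho> \<gamma> \<and> c \<gamma> t \<and> (\<forall>v\<in>r. v \<subseteq>\<^sub>m t \<or> t \<subseteq>\<^sub>m v)}" for \<gamma>
  show ?thesis
  proof (rule adds_new_functionI[of _ D])
    fix q assume q: "q \<in> P"
    then obtain \<gamma> t u where \<gamma>: "\<gamma> < lam" and tu: "t \<in> q" "u \<in> q" "len t = \<rho> \<gamma>" "c \<gamma> t" "\<not> c \<gamma> u" "len u = \<rho> \<gamma>"
      using col by blast
    have qc: "ctree q" using cone_closedD(1)[OF P q] .
    note tn = ctree_node[OF qc tu(1)] and un = ctree_node[OF qc tu(2)]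
    have neg: "r' \<notin> D \<gamma>" if r': "r' \<in> P" "r' \<subseteq> cone q u" for r'
    proof
      assume "r' \<in> D \<gamma>"
      then obtain t' where t': "is_seq t'" "len t' = \<rho> \<gamma>" "c \<gamma> t'" "\<forall>v\<in>r'. v \<subseteq>\<^sub>m t' \<or> t' \<subseteq>\<^sub>m v"
        unfolding D_def by blast
      have "u \<in> r'" using ctree_subset_cone[OF qc tu(2) cone_closedD(1)[OF P r'(1)] r'(2)] .
      then have "t' = u" using comparable_same_len[OF t'(1) un(1)] t'(2,4) tu(6) by metis
      then show False using t'(3) tu(5) by blast
    qed
    have pos: "cone q t \<in> D \<gamma>"
      using cone_closedD(2)[OF P q tu(1)] tn(1) tu(3,4) unfolding D_def cone_def by auto
    show "\<exists>x\<in>{..<lam}. (\<exists>r\<in>P. r \<subseteq> q \<and> (\<forall>r'\<in>P. r' \<subseteq> r \<longrightarrow> r' \<notin> D x)) \<and> (\<exists>r\<in>D x. r \<subseteq> q)"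
    proof (intro bexI[of _ \<gamma>] conjI)
      show "\<exists>r\<in>P. r \<subseteq> q \<and> (\<forall>r'\<in>P. r' \<subseteq> r \<longrightarrow> r' \<notin> D \<gamma>)"
        using neg cone_closedD(2)[OF P q tu(2)] cone_subset[of q u] by (intro bexI[of _ "cone q u"]) simp_all
      show "\<exists>r\<in>D \<gamma>. r \<subseteq> q" using pos cone_subset[of q t] by (rule bexI[rotated])
      show "\<gamma> \<in> {..<lam}" using \<gamma> by simp
    qed
  qed (auto simp: D_def)
qed

lemma infinite_lam: "infinite {..<lam}"
  using infinite_omega omega_lam by (meson finite_subset less_imp_le lessThan_subset_iff)

text \<open>The antichain argument with the rank left abstract: \<open>Dr a r\<close> says that it
  drops from \<open>a\<close> to \<open>r\<close>. \<open>wfd\<close> rules out an infinite descent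
  at a common splitting node \<open>s\<close> whose successor on the branch is fixed by
  \<open>t\<close>. In \<open>fin\<close>, the set \<open>A n\<close> consists of the splitting
  levels that \<open>q\<close> decides for the generic element of the n-th antichain.\<close>

lemma antichain_matrix:
  assumes P: "cone_closed P"
    and drop: "\<And>p r. p \<in> P \<Longrightarrow> r \<in> P \<Longrightarrow> r \<subseteq> p \<Longrightarrow> \<exists>r'\<in>P. r' \<subseteq> r \<and> Dr p r'"
    and wfd: "\<And>a s t. (\<And>n. a n \<in> P) \<Longrightarrow> (\<And>n::nat. Dr (a n) (a (Suc n))) \<Longrightarrow>
      (\<And>n. s \<in> Split (a n)) \<Longrightarrow> (\<And>n. t \<in> a n) \<Longrightarrow> s \<subseteq>\<^sub>m t \<Longrightarrow> s \<noteq> t \<Longrightarrow> False"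
    and fin: "\<And>q A. q \<in> P \<Longrightarrow> (\<And>\<beta>. \<beta> < lam \<Longrightarrow> \<exists>n::nat. \<beta> \<notin> A n) \<Longrightarrow>
      (\<And>n r. r \<in> P \<Longrightarrow> r \<subseteq> q \<Longrightarrow> \<exists>r'\<in>P. r' \<subseteq> r \<and> (\<forall>s\<in>Split r'. len s \<in> A n)) \<Longrightarrow> False"
  shows "adds_new_function P (\<subseteq>) {..<lam} {0, 1 :: nat}"
proof -
  note Pc = cone_closedD(1)[OF P] and cone = cone_closedD(2)[OF P]
  have "\<exists>M. M \<subseteq> E \<and> (\<forall>x\<in>M. \<forall>y\<in>M. \<forall>r\<in>P. r \<subseteq> x \<longrightarrow> r \<subseteq> y \<longrightarrow> x = y) \<and>
    (\<forall>x\<in>E. x \<in> P \<longrightarrow> (\<exists>y\<in>M. \<exists>r\<in>P. r \<subseteq> x \<and> r \<subseteq> y))" for E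
    by (rule maximal_antichain[of E P]) meson
  then obtain M where M: "\<And>E. M E \<subseteq> E"
    "\<And>E x y r. x \<in> M E \<Longrightarrow> y \<in> M E \<Longrightarrow> r \<in> P \<Longrightarrow> r \<subseteq> x \<Longrightarrow> r \<subseteq> y \<Longrightarrow> x = y"
    "\<And>E x. x \<in> E \<Longrightarrow> x \<in> P \<Longrightarrow> \<exists>y\<in>M E. \<exists>r\<in>P. r \<subseteq> x \<and> r \<subseteq> y"
    by metis
  \<comment> \<open>By \<open>drop\<close> the candidates are dense below \<open>a\<close>, so
    \<open>B a\<close> is predense below \<open>a\<close> and the union over one antichain is
    predense again.\<close>
  define B where "B a = M {r \<in> P. r \<subseteq> a \<and> Dr a r}" for a
  have Bsub: "x \<in> P" "x \<subseteq> a" "Dr a x" if "x \<in> B a" for x a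
    using that M(1) unfolding B_def by blast+
  define \<A> where "\<A> = rec_nat (M P) (\<lambda>_ X. \<Union>a\<in>X. B a)"
  have \<A>: "\<A> 0 = M P" "\<A> (Suc n) = (\<Union>a\<in>\<A> n. B a)" for n unfolding \<A>_def by simp_all
  have \<A>P: "a \<in> P" if "a \<in> \<A> n" for a n
    using that Bsub(1) M(1)[of P] by (cases n) (auto simp: \<A>)
  have anti: "x = y" if "x \<in> \<A> n" "y \<in> \<A> n" "r \<in> P" "r \<subseteq> x" "r \<subseteq> y" for n x y r
    using that
  proof (induction n arbitrary: x y)
    case 0
    then show ?case using M(2) unfolding \<A> by blast
  next
    case (Suc n)
    then obtain a b where ab: "a \<in> \<A> n" "b \<in> \<A> n" "x \<in> B a" "y \<in> B b" unfolding \<A> by blast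
    have "r \<subseteq> a" "r \<subseteq> b" using Bsub(2)[OF ab(3)] Bsub(2)[OF ab(4)] Suc.prems by auto
    then have "a = b" using Suc.IH[OF ab(1,2)] Suc.prems by blast
    then show ?case using M(2) ab(3,4) Suc.prems unfolding B_def by blast
  qed
  have predense: "\<exists>a\<in>\<A> n. \<exists>r'\<in>P. r' \<subseteq> r \<and> r' \<subseteq> a" if "r \<in> P" for n r
    using that
  proof (induction n)
    case 0
    then show ?case using M(3)[of r P] unfolding \<A> by blast
  next
    case (Suc n)
    then obtain a r1 where a: "a \<in> \<A> n" "r1 \<in> P" "r1 \<subseteq> r" "r1 \<subseteq> a" by blast
    obtain r2 where r2: "r2 \<in> P" "r2 \<subseteq> r1" "Dr a r2" using drop[OF \<A>P[OF a(1)] a(2,4)] by blast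
    have "r2 \<subseteq> a" using r2 a by blast
    then have "\<exists>y\<in>B a. \<exists>r\<in>P. r \<subseteq> r2 \<and> r \<subseteq> y"
      unfolding B_def using M(3)[of r2 "{r \<in> P. r \<subseteq> a \<and> Dr a r}"] r2 by simp
    then obtain y r3 where y: "y \<in> B a" "r3 \<in> P" "r3 \<subseteq> r2" "r3 \<subseteq> y" by blast
    have "y \<in> \<A> (Suc n)" using y(1) a(1) unfolding \<A> by blast
    moreover have "r3 \<subseteq> r" using y(3) r2(2) a(3) by simp
    ultimately show ?case using y(2,4) by blast
  qed
  \<comment> \<open>Such an \<open>r\<close> decides that \<open>a\<close> is the generic element of
    the n-th antichain and that the branch passes through a splitting node of \<open>a\<close> at
    level \<open>\<beta>\<close>.\<close>
  define U where "U n \<beta> = {r \<in> P. \<exists>a\<in>\<A> n. r \<subseteq> a \<and> (\<exists>s\<in>Split a. len s = \<beta> \<and> (\<forall>v\<in>r. v \<subseteq>\<^sub>m s \<or> s \<subseteq>\<^sub>m v))}"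
    for n \<beta>
  \<comment> \<open>A bijection of the pairs \<open>(n, \<beta>)\<close> with the ordinals below
    \<open>lam\<close> turns countably many subsets of \<open>lam\<close> into one.\<close>
  have "|(UNIV::nat set) \<times> {..<lam}| =o |{..<lam}|"
    using card_of_Times_infinite[OF infinite_lam, of "UNIV::nat set"] infinite_lam
    by (simp add: infinite_iff_card_of_nat)
  then obtain \<phi> where \<phi>: "bij_betw \<phi> {..<lam} ((UNIV::nat set) \<times> {..<lam})"
    using card_of_ordIso ordIso_symmetric by blast
  have undec: "\<exists>n \<beta>. \<beta> < lam \<and> (\<exists>r\<in>P. r \<subseteq> q \<and> (\<forall>r'\<in>P. r' \<subseteq> r \<longrightarrow> r' \<notin> U n \<beta>)) \<and> (\<exists>r\<in>U n \<beta>. r \<subseteq> q)"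
    if q: "q \<in> P" for q
  proof (rule ccontr)
    assume no: "\<not> ?thesis"
    \<comment> \<open>As \<open>q\<close> leaves nothing undecided, one extension in
      \<open>U n \<beta>\<close> makes \<open>U n \<beta>\<close> dense below
      \<open>q\<close>.\<close>
    define A where "A n = {\<beta>. \<beta> < lam \<and> (\<exists>r\<in>U n \<beta>. r \<subseteq> q)}" for n
    have pos: "\<exists>r'\<in>U n \<beta>. r' \<subseteq> r" if "\<beta> \<in> A n" "r \<in> P" "r \<subseteq> q" for n \<beta> r
    proof -
      have "\<beta> < lam" "\<exists>r\<in>U n \<beta>. r \<subseteq> q" using that(1) unfolding A_def by simp_all
      then have "\<not> (\<forall>r'\<in>P. r' \<subseteq> r \<longrightarrow> r' \<notin> U n \<beta>)" using no that(2,3) by blast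
      then show ?thesis by blast
    qed
    \<comment> \<open>Below an element \<open>a\<close> of the antichain, every splitting node
      \<open>s\<close> of \<open>r'\<close> also splits \<open>a\<close>, so the cone at
      \<open>s\<close> witnesses that the level of \<open>s\<close> belongs to
      \<open>A n\<close>.\<close>
    have dense: "\<exists>r'\<in>P. r' \<subseteq> r \<and> (\<forall>s\<in>Split r'. len s \<in> A n)" if r: "r \<in> P" "r \<subseteq> q" for n r
    proof -
      obtain a r' where a: "a \<in> \<A> n" "r' \<in> P" "r' \<subseteq> r" "r' \<subseteq> a" using predense[OF r(1)] by blast
      have "len s \<in> A n" if s: "s \<in> Split r'" for s
      proof -
        have sr: "s \<in> r'" using s unfolding Split_def by blast
        have "cone r' s \<in> P" using cone[OF a(2) sr] .
        moreover have "cone r' s \<subseteq> a" "cone r' s \<subseteq> q" using a(3,4) r(2) cone_subset[of r' s] by auto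
        moreover have "s \<in> Split a" using s Split_mono[OF a(4)] by blast
        moreover have "\<forall>v\<in>cone r' s. v \<subseteq>\<^sub>m s \<or> s \<subseteq>\<^sub>m v" unfolding cone_def by blast
        ultimately have "cone r' s \<in> U n (len s)" unfolding U_def using a(1) by blast
        then show ?thesis unfolding A_def
          using \<open>cone r' s \<subseteq> q\<close> ctree_node(2)[OF Pc[OF a(2)] sr] by blast
      qed
      then show ?thesis using a(2,3) by blast
    qed
    have empty: "\<exists>n. \<beta> \<notin> A n" if \<beta>: "\<beta> < lam" for \<beta>
    proof (rule ccontr)
      assume "\<not> ?thesis"
      then have all: "\<beta> \<in> A n" for n by blast
      \<comment> \<open>One level beyond \<open>\<beta>\<close>: the cone at \<open>t\<close> fixes
        both the node \<open>s\<close> at level \<open>\<beta>\<close> and the value taken there, as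
        \<open>wfd\<close> requires.\<close>
      obtain t where t: "t \<in> q" "len t = next_ord \<beta>"
        using ctree_has_len[OF Pc[OF q] next_ord_lam[OF \<beta>]] by blast
      note tn = ctree_node[OF Pc[OF q] t(1)]
      have lt: "\<beta> < len t" using t(2) lam_next[OF \<beta>] by simp
      define s where "s = t |` {..<\<beta>}"
      have s: "is_seq s" "len s = \<beta>" "s \<subseteq>\<^sub>m t" using seq_restrict[OF tn(1)] lt unfolding s_def by auto
      have c0: "cone q t \<in> P" "cone q t \<subseteq> q" using cone[OF q t(1)] cone_subset by auto
      have step: "\<exists>r'. r' \<in> U n \<beta> \<and> r' \<subseteq> r" if "r \<in> P" "r \<subseteq> cone q t" for n r
        using pos[OF all that(1)] that(2) c0 by blast
      have UP: "r \<in> P" if "r \<in> U n \<beta>" for n r using that unfolding U_def by blast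
      have "\<exists>R. R 0 \<in> U 0 \<beta> \<and> (\<forall>n. R n \<in> U n \<beta> \<and> R n \<subseteq> cone q t \<and> R (Suc n) \<subseteq> R n)"
      proof -
        obtain r0 where r0: "r0 \<in> U 0 \<beta>" "r0 \<subseteq> cone q t" using step[OF c0(1)] by blast
        define g where "g n r = (SOME r'. r' \<in> U n \<beta> \<and> r' \<subseteq> r)" for n r
        have g: "g n r \<in> U n \<beta> \<and> g n r \<subseteq> r" if "r \<in> P" "r \<subseteq> cone q t" for n r
          unfolding g_def using someI_ex[OF step[OF that]] .
        define R where "R = rec_nat r0 (\<lambda>n r. g (Suc n) r)"
        have R: "R 0 = r0" "R (Suc n) = g (Suc n) (R n)" for n unfolding R_def by simp_all
        have inv: "R n \<in> U n \<beta> \<and> R n \<subseteq> cone q t" for n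
        proof (induction n)
          case (Suc n)
          then show ?case using g[OF UP, of "R n" n "Suc n"] R(2)[of n] by auto
        qed (use R r0 in auto)
        moreover have "R (Suc n) \<subseteq> R n" for n
          using g[OF UP, of "R n" n "Suc n"] inv[of n] R(2)[of n] by simp
        ultimately show ?thesis by blast
      qed
      then obtain R where R: "\<And>n. R n \<in> U n \<beta>" "\<And>n. R n \<subseteq> cone q t" "\<And>n. R (Suc n) \<subseteq> R n"
        by blast
      have "\<exists>a. a \<in> \<A> n \<and> R n \<subseteq> a \<and> s \<in> Split a \<and> t \<in> a" for n
      proof -
        obtain a s' where a: "a \<in> \<A> n" "R n \<subseteq> a" "s' \<in> Split a" "len s' = \<beta>" "\<forall>v\<in>R n. v \<subseteq>\<^sub>m s' \<or> s' \<subseteq>\<^sub>m v"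
          using R(1)[of n] unfolding U_def by blast
        have tR: "t \<in> R n" using ctree_subset_cone[OF Pc[OF q] t(1) Pc[OF UP[OF R(1)]] R(2)] .
        have s': "is_seq s'" using a(3) ctree_node(1)[OF Pc[OF \<A>P[OF a(1)]]] unfolding Split_def by blast
        have "s' \<subseteq>\<^sub>m t"
        proof (rule ccontr)
          assume "\<not> ?thesis"
          then have "t \<subseteq>\<^sub>m s'" using a(5) tR by blast
          then have "len t \<le> \<beta>" using seq_le_iff[OF tn(1) s'] a(4) by blast
          then show False using lt by simp
        qed
        then have "s' = s" using seq_le_iff[OF s' tn(1)] a(4) unfolding s_def by simp
        then show ?thesis using a tR by blast
      qed
      then obtain a where a: "\<And>n. a n \<in> \<A> n" "\<And>n. R n \<subseteq> a n" "\<And>n. s \<in> Split (a n)" "\<And>n. t \<in> a n"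
        by metis
      \<comment> \<open>The condition \<open>R (Suc n)\<close> lies below \<open>a n\<close> and
        below the predecessor \<open>b\<close> of \<open>a (Suc n)\<close> in the n-th antichain, so
        the two coincide and the \<open>a n\<close> form a thread through the antichains.\<close>
      have "Dr (a n) (a (Suc n))" for n
      proof -
        obtain b where b: "b \<in> \<A> n" "a (Suc n) \<in> B b" using a(1)[of "Suc n"] unfolding \<A> by blast
        have "R (Suc n) \<subseteq> b" using a(2)[of "Suc n"] Bsub(2)[OF b(2)] by simp
        moreover have "R (Suc n) \<subseteq> a n" using a(2)[of n] R(3)[of n] by simp
        ultimately have "b = a n" using anti[OF b(1) a(1) UP[OF R(1)]] by blast
        then show ?thesis using Bsub(3)[OF b(2)] by simp
      qed
      moreover have "s \<noteq> t" using s(2) lt by auto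
      ultimately show False
        using wfd[of a s t] \<A>P[OF a(1)] a(3,4) s(3) by blast
    qed
    show False using fin[OF q empty dense] .
  qed
  show ?thesis
  proof (rule adds_new_functionI[of _ "\<lambda>x. U (fst (\<phi> x)) (snd (\<phi> x))"])
    fix q assume "q \<in> P"
    from undec[OF this] obtain n \<beta> where n: "\<beta> < lam"
      "(\<exists>r\<in>P. r \<subseteq> q \<and> (\<forall>r'\<in>P. r' \<subseteq> r \<longrightarrow> r' \<notin> U n \<beta>)) \<and> (\<exists>r\<in>U n \<beta>. r \<subseteq> q)"
      by (elim exE conjE) (rule that, simp_all)
    have "(n, \<beta>) \<in> \<phi> ` {..<lam}" using \<phi> n(1) unfolding bij_betw_def by simp
    then obtain x where "x \<in> {..<lam}" "\<phi> x = (n, \<beta>)" by (metis imageE)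
    then show "\<exists>x\<in>{..<lam}. (\<exists>r\<in>P. r \<subseteq> q \<and> (\<forall>r'\<in>P. r' \<subseteq> r \<longrightarrow> r' \<notin> U (fst (\<phi> x)) (snd (\<phi> x)))) \<and>
      (\<exists>r\<in>U (fst (\<phi> x)) (snd (\<phi> x)). r \<subseteq> q)"
      using n(2) by (intro bexI[of _ x]) simp_all
  next
    fix x u r assume "u \<in> U (fst (\<phi> x)) (snd (\<phi> x))" "r \<in> P" "r \<subseteq> u"
    then show "r \<in> U (fst (\<phi> x)) (snd (\<phi> x))" unfolding U_def by blast
  qed (auto simp: U_def)
qed

end

section \<open>Pruning\<close>

context cardinal_tower begin

lemma splitting_mono: "splitting k p \<alpha> s \<Longrightarrow> \<beta> \<le> \<alpha> \<Longrightarrow> \<alpha> < lam \<Longrightarrow> splitting k p \<beta> s"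
  unfolding splitting_def
  using card_of_mono1[of "{..<k \<beta>}" "{..<k \<alpha>}"] k_mono_le[of \<beta> \<alpha>] ordLeq_transitive
  by (metis lessThan_subset_iff)

lemma two_elements:
  assumes "|{..<k \<alpha>}| \<le>o |X|" "\<alpha> < lam" shows "\<exists>a\<in>X. \<exists>b\<in>X. a \<noteq> b" "infinite X"
proof -
  show inf: "infinite X"
    using card_of_ordLeq_infinite[OF assms(1) k_infinite[OF assms(2)]] .
  show "\<exists>a\<in>X. \<exists>b\<in>X. a \<noteq> b"
  proof (rule ccontr)
    assume "\<not> ?thesis"
    then have "X \<subseteq> {SOME x. x \<in> X}" by (metis insertI1 someI subsetI)
    then show False using inf finite_subset by blast
  qed
qed

end

text \<open>Setting for thinning out \<open>p\<close> to a tree that splits only at nodes of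
  \<open>K\<close>, with a prescribed choice of successors there.\<close>

locale pruning = cardinal_tower +
  fixes p K
  assumes p: "ctree p" and K_sub: "K \<subseteq> p"
    and K_dense: "\<And>t \<alpha>. t \<in> p \<Longrightarrow> \<alpha> < lam \<Longrightarrow> \<exists>s\<in>K. t \<subseteq>\<^sub>m s \<and> splitting k p \<alpha> s"
begin

text \<open>\<open>idx\<close> and \<open>Q\<close> depend on each other: whether \<open>u\<close>
  is counted depends on its own index. The recursion therefore carries membership in
  \<open>Q\<close> unfolded, applied to proper initial segments only.\<close>

definition idx_rec :: "('a node \<Rightarrow> 'a) \<Rightarrow> 'a node \<Rightarrow> 'a" where
  "idx_rec f s = (LEAST i. \<forall>u. (u, s) \<in> initial_rel \<and> u \<in> K \<and> splitting k p (f u) u \<longrightarrow> f u < i)"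

text \<open>\<open>idx s\<close> is the order type of the nodes of \<open>Q\<close> strictly below \<open>s\<close>; the \<open>i\<close>-th such node on
  a branch has at least \<open>k i\<close> successors.\<close>

definition idx :: "'a node \<Rightarrow> 'a" where
  "idx = (SOME f. \<forall>s. f s = idx_rec f s)"

definition Q :: "'a node set" where
  "Q = {s \<in> K. splitting k p (idx s) s}"

lemma idx: "idx s = (LEAST i. \<forall>u. (u, s) \<in> initial_rel \<and> u \<in> Q \<longrightarrow> idx u < i)"
proof -
  obtain f where f: "\<And>x. f x = idx_rec (cut f initial_rel x) x"
    using wf_recursion[OF wf_initial_rel, of idx_rec] by blast
  have "idx_rec (cut f initial_rel x) x = idx_rec f x" for x
    unfolding idx_rec_def by (rule arg_cong[of _ _ Least]) (auto simp: cut_def fun_eq_iff)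
  then have "\<forall>s. f s = idx_rec f s" using f by simp
  from someI[of "\<lambda>f. \<forall>s. f s = idx_rec f s", OF this] have "idx s = idx_rec idx s"
    unfolding idx_def by blast
  then show ?thesis unfolding idx_rec_def Q_def by simp
qed

lemma initialI:
  assumes "u \<in> p" "s \<in> p" "u \<subseteq>\<^sub>m s" "u \<noteq> s" shows "(u, s) \<in> initial_rel"
  unfolding initial_rel_def using ctree_node(1)[OF p] assms by blast

lemma initialD:
  assumes "(u, s) \<in> initial_rel" "s \<in> p" shows "u \<in> p" "u \<subseteq>\<^sub>m s" "u \<noteq> s" "len u < len s"
proof -
  show "u \<subseteq>\<^sub>m s" "u \<noteq> s" using assms(1) unfolding initial_rel_def by blast+
  then show "u \<in> p" using assms ctree_le[OF p] unfolding initial_rel_def by blast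
  show "len u < len s" using initial_rel_len[OF assms(1)] .
qed

lemma Q_sub: "Q \<subseteq> p"
  unfolding Q_def using K_sub by blast

lemma idx_le_len: "s \<in> p \<Longrightarrow> idx s \<le> len s"
proof (induction s rule: wf_induct_rule[OF wf_initial_rel])
  case (1 s)
  have "idx u < len s" if "(u, s) \<in> initial_rel" for u
    using 1 initialD[OF that 1(2)] that by (metis le_less_trans)
  then show ?case unfolding idx[of s] by (intro Least_le) blast
qed

lemma idx_lam: "s \<in> p \<Longrightarrow> idx s < lam"
  using idx_le_len ctree_node(2)[OF p] le_less_trans by blast

lemma idx_strict:
  assumes "u \<in> Q" "s \<in> p" "u \<subseteq>\<^sub>m s" "u \<noteq> s" shows "idx u < idx s"
proof -
  have "\<forall>u. (u, s) \<in> initial_rel \<and> u \<in> Q \<longrightarrow> idx u < len s"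
    using initialD[OF _ assms(2)] idx_le_len by (metis le_less_trans)
  from LeastI[of "\<lambda>i. \<forall>u. (u, s) \<in> initial_rel \<and> u \<in> Q \<longrightarrow> idx u < i", OF this]
  show ?thesis unfolding idx[of s] using initialI assms Q_sub by blast
qed

text \<open>An index is the least strict bound of the earlier ones, so some earlier node has index
  at least \<open>i\<close>; if it is larger, descend to that node.\<close>

lemma idx_surj:
  assumes s: "s \<in> p" and i: "i < idx s"
  shows "\<exists>u\<in>Q. u \<subseteq>\<^sub>m s \<and> u \<noteq> s \<and> idx u = i"
  using s i
proof (induction s rule: wf_induct_rule[OF wf_initial_rel])
  case (1 s)
  have "\<not> (\<forall>u. (u, s) \<in> initial_rel \<and> u \<in> Q \<longrightarrow> idx u < i)"
    using not_less_Least[of i "\<lambda>i. \<forall>u. (u, s) \<in> initial_rel \<and> u \<in> Q \<longrightarrow> idx u < i"] 1(3)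
    unfolding idx[of s] by blast
  then obtain u where u: "(u, s) \<in> initial_rel" "u \<in> Q" "i \<le> idx u" by (auto simp: not_less)
  note us = initialD[OF u(1) 1(2)]
  show ?case
  proof (cases "i = idx u")
    case True
    then show ?thesis using u us by blast
  next
    case False
    then have "i < idx u" using u(3) by simp
    then obtain v where v: "v \<in> Q" "v \<subseteq>\<^sub>m u" "v \<noteq> u" "idx v = i"
      using 1(1)[OF u(1) us(1)] by blast
    have "v \<noteq> s" using v(2,3) us(2) map_le_antisym by blast
    then show ?thesis using v us(2) map_le_trans[of v u s] by blast
  qed
qed

lemma Q_splitting: "s \<in> Q \<Longrightarrow> |{..<k (idx s)}| \<le>o |OSucc p s|"
  unfolding Q_def splitting_iff by blast

lemma Q_Split: "s \<in> Q \<Longrightarrow> s \<in> Split p"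
  using two_elements(1)[OF Q_splitting idx_lam] Q_sub unfolding Split_def by blast

lemma comparable:
  assumes "u \<in> p" "v \<in> p" "w \<in> p" "u \<subseteq>\<^sub>m w" "v \<subseteq>\<^sub>m w" shows "u \<subseteq>\<^sub>m v \<or> v \<subseteq>\<^sub>m u"
  using seq_le_comparable[of u v w] seq_le_comparable[of v u w] ctree_node(1)[OF p] assms by (meson linear)

text \<open>Take \<open>s\<close> in \<open>K\<close> above \<open>t\<close> that splits as much as
  the index of \<open>t\<close> asks. If no node above \<open>t\<close> were in \<open>Q\<close>,
  then \<open>s\<close> would have the same index as \<open>t\<close> and so belong to
  \<open>Q\<close> itself.\<close>

lemma Q_dense: assumes t: "t \<in> p" shows "\<exists>s\<in>Q. t \<subseteq>\<^sub>m s"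
proof (rule ccontr)
  assume no: "\<not> ?thesis"
  obtain s where s: "s \<in> K" "t \<subseteq>\<^sub>m s" "splitting k p (idx t) s" using K_dense[OF t idx_lam[OF t]] by blast
  have sp: "s \<in> p" using s K_sub by blast
  have "(u, s) \<in> initial_rel \<and> u \<in> Q \<longleftrightarrow> (u, t) \<in> initial_rel \<and> u \<in> Q" for u
  proof
    assume u: "(u, s) \<in> initial_rel \<and> u \<in> Q"
    then have "\<not> t \<subseteq>\<^sub>m u" using no by blast
    then have "u \<subseteq>\<^sub>m t" "u \<noteq> t" using comparable[OF _ t sp _ s(2)] initialD[of u s] u sp by auto
    then show "(u, t) \<in> initial_rel \<and> u \<in> Q" using u initialI[OF _ t] Q_sub by blast
  next
    assume u: "(u, t) \<in> initial_rel \<and> u \<in> Q"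
    then have "u \<subseteq>\<^sub>m t" "u \<noteq> t" "u \<in> p" using initialD[OF _ t] by blast+
    then have "u \<subseteq>\<^sub>m s" "u \<noteq> s" using s(2) map_le_trans map_le_antisym by blast+
    then show "(u, s) \<in> initial_rel \<and> u \<in> Q" using u initialI[OF \<open>u \<in> p\<close> sp] by blast
  qed
  then have "idx s = idx t" unfolding idx[of s] idx[of t] by simp
  then have "s \<in> Q" using s unfolding Q_def by simp
  then show False using no s(2) by blast
qed

section \<open>Walks towards targets and the pruned tree\<close>

definition W :: "('a node \<times> 'a node) set" where
  "W = (SOME r. well_order_on UNIV r)"

definition target :: "'a node \<Rightarrow> 'a node" where
  "target t = (SOME s. s \<in> Q \<and> t \<subseteq>\<^sub>m s \<and> (\<forall>s'\<in>Q. t \<subseteq>\<^sub>m s' \<longrightarrow> (s, s') \<in> W))"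

lemma W: "well_order_on UNIV W"
  unfolding W_def using well_order_on[of UNIV] by (rule someI_ex)

lemma target:
  assumes "t \<in> p"
  shows "target t \<in> Q" "t \<subseteq>\<^sub>m target t" "\<And>s'. s' \<in> Q \<Longrightarrow> t \<subseteq>\<^sub>m s' \<Longrightarrow> (target t, s') \<in> W"
proof -
  have wf: "wf (W - Id)" and tot: "total W" and refl: "refl W"
    using W unfolding well_order_on_def linear_order_on_def partial_order_on_def preorder_on_def by blast+
  have "{s \<in> Q. t \<subseteq>\<^sub>m s} \<noteq> {}" using Q_dense[OF assms] by blast
  from wfE_min'[OF wf this] obtain s where s: "s \<in> {s \<in> Q. t \<subseteq>\<^sub>m s}"
    "\<And>y. (y, s) \<in> W - Id \<Longrightarrow> y \<notin> {s \<in> Q. t \<subseteq>\<^sub>m s}" by blast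
  have "(s, s') \<in> W" if "s' \<in> Q" "t \<subseteq>\<^sub>m s'" for s'
    using s(2)[of s'] that tot refl unfolding total_on_def refl_on_def by (cases "s = s'") auto
  then have "\<exists>s. s \<in> Q \<and> t \<subseteq>\<^sub>m s \<and> (\<forall>s'\<in>Q. t \<subseteq>\<^sub>m s' \<longrightarrow> (s, s') \<in> W)" using s(1) by blast
  from someI_ex[OF this] show "target t \<in> Q" "t \<subseteq>\<^sub>m target t"
    "\<And>s'. s' \<in> Q \<Longrightarrow> t \<subseteq>\<^sub>m s' \<Longrightarrow> (target t, s') \<in> W"
    unfolding target_def by blast+
qed

text \<open>Minimality makes the targets coherent, so that moving towards the current target reaches it.\<close>

lemma target_coherent:
  assumes "t \<in> p" "u \<in> p" "t \<subseteq>\<^sub>m u" "u \<subseteq>\<^sub>m target t"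
  shows "target u = target t"
proof -
  have "antisym W" using W unfolding well_order_on_def linear_order_on_def partial_order_on_def by blast
  moreover have "(target u, target t) \<in> W" using target[OF assms(2)] target(1)[OF assms(1)] assms(4) by blast
  moreover have "(target t, target u) \<in> W"
    using target(3)[OF assms(1)] target(1,2)[OF assms(2)] assms(3) map_le_trans by blast
  ultimately show ?thesis unfolding antisym_def by blast
qed

definition dir :: "'a node \<Rightarrow> 'a" where
  "dir t = the (target t (len t))"

lemma dir_OSucc:
  assumes "t \<in> p" "t \<notin> Q" shows "dir t \<in> OSucc p t"
proof -
  have tt: "target t \<in> p" "t \<subseteq>\<^sub>m target t" "t \<noteq> target t" using target[OF assms(1)] Q_sub assms(2) by auto
  have "len t < len (target t)"
    using initialD(4)[OF initialI[OF assms(1) tt] tt(1)] .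
  then show ?thesis
    unfolding dir_def using OSuccI[OF p tt(1,2) ctree_node(1)[OF p assms(1)]] by blast
qed

definition allowed :: "('a node \<Rightarrow> 'a set) \<Rightarrow> 'a node \<Rightarrow> 'a set" where
  "allowed Y s = (if s \<in> Q then Y s else {dir s})"

text \<open>Membership is a condition on each value separately, given the initial segment before it;
  hence closure under initial segments and under limits comes directly.\<close>

definition prune :: "('a node \<Rightarrow> 'a set) \<Rightarrow> 'a node set" where
  "prune Y = {t \<in> p. \<forall>\<beta><len t. the (t \<beta>) \<in> allowed Y (t |` {..<\<beta>})}"

context
  fixes Y
  assumes Y: "\<And>s. s \<in> Q \<Longrightarrow> Y s \<noteq> {} \<and> Y s \<subseteq> OSucc p s"
begin

lemma prune_sub: "prune Y \<subseteq> p"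
  unfolding prune_def by blast

lemma prune_le:
  assumes t: "t \<in> prune Y" and s: "is_seq s" "s \<subseteq>\<^sub>m t" shows "s \<in> prune Y"
proof -
  have tp: "t \<in> p" using t prune_sub by blast
  note ts = ctree_node(1)[OF p tp]
  have sp: "s \<in> p" using ctree_le[OF p tp s] .
  have len: "len s \<le> len t" "t |` {..<len s} = s" using seq_le_iff[OF s(1) ts] s(2) by blast+
  have "s \<beta> = t \<beta>" "s |` {..<\<beta>} = t |` {..<\<beta>}" if "\<beta> < len s" for \<beta>
  proof -
    show "s \<beta> = t \<beta>" using seq_le_value[OF s(2,1) that] by simp
    have "(t |` {..<len s}) |` {..<\<beta>} = t |` {..<\<beta>}"
      using that by (auto simp: restrict_map_def fun_eq_iff)
    then show "s |` {..<\<beta>} = t |` {..<\<beta>}" unfolding len(2) .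
  qed
  moreover have "\<beta> < len t" if "\<beta> < len s" for \<beta> using that len(1) by simp
  ultimately show ?thesis using t sp unfolding prune_def by simp
qed

lemma OSucc_prune:
  assumes t: "t \<in> prune Y"
  shows "OSucc (prune Y) t = allowed Y t"
proof -
  have tp: "t \<in> p" using t prune_sub by blast
  note tn = ctree_node[OF p tp]
  have "t(len t \<mapsto> b) \<in> prune Y \<longleftrightarrow> b \<in> allowed Y t" for b
  proof -
    let ?u = "t(len t \<mapsto> b)"
    note a = seq_append[OF tn(1,2), of b]
    have "?u |` {..<\<beta>} = t |` {..<\<beta>}" "?u \<beta> = t \<beta>" if "\<beta> < len t" for \<beta>
      using that by (auto simp: restrict_map_def fun_eq_iff)
    moreover have "\<beta> < len ?u \<longleftrightarrow> \<beta> < len t \<or> \<beta> = len t" for \<beta>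
      unfolding a(2) using next_ord(3)[OF tn(2)] by (auto simp: le_less)
    ultimately have "(\<forall>\<beta><len ?u. the (?u \<beta>) \<in> allowed Y (?u |` {..<\<beta>}))
      \<longleftrightarrow> b \<in> allowed Y t"
      using t a(4) unfolding prune_def by auto
    moreover have "?u \<in> p" if "b \<in> allowed Y t"
      using that Y[of t] dir_OSucc[OF tp] unfolding OSucc_def allowed_def by (auto split: if_splits)
    ultimately show ?thesis unfolding prune_def by blast
  qed
  then show ?thesis unfolding OSucc_def by blast
qed

lemma OSucc_prune_nonempty: "t \<in> prune Y \<Longrightarrow> OSucc (prune Y) t \<noteq> {}"
  using OSucc_prune[of t] Y[of t] unfolding allowed_def by simp

lemma prune_limit:
  assumes f: "f \<in> p" "\<And>\<beta>. \<beta> < len f \<Longrightarrow> \<exists>\<gamma>. \<beta> < \<gamma> \<and> \<gamma> \<le> len f \<and> f |` {..<\<gamma>} \<in> prune Y"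
  shows "f \<in> prune Y"
proof -
  note fs = ctree_node(1)[OF p f(1)]
  have "the (f \<beta>) \<in> allowed Y (f |` {..<\<beta>})"
    if b: "\<beta> < len f" for \<beta>
  proof -
    obtain \<gamma> where g: "\<beta> < \<gamma>" "\<gamma> \<le> len f" "f |` {..<\<gamma>} \<in> prune Y" using f(2)[OF b] by blast
    have l: "len (f |` {..<\<gamma>}) = \<gamma>" using seq_restrict(2)[OF fs] g by blast
    have "(f |` {..<\<gamma>}) |` {..<\<beta>} = f |` {..<\<beta>}" "(f |` {..<\<gamma>}) \<beta> = f \<beta>"
      using g by (auto simp: restrict_map_def fun_eq_iff)
    then show ?thesis using g(1,3) l unfolding prune_def mem_Collect_eq by (metis (lifting))
  qed
  then show ?thesis using f(1) unfolding prune_def by blast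
qed

lemma prune_ctree: "ctree (prune Y)"
  unfolding ctree_def
proof
  obtain t where t: "t \<in> p" using ctree_nonempty[OF p] by blast
  obtain z :: 'a where z: "\<And>x. \<not> x < z" using least_ord by blast
  then have "z \<le> len t" by (simp add: not_less[symmetric])
  then have "t |` {..<z} \<in> p" "len (t |` {..<z}) = z"
    using ctree_restrict[OF p t] seq_restrict(2)[OF ctree_node(1)[OF p t]] by blast+
  then have "t |` {..<z} \<in> prune Y" unfolding prune_def using z by auto
  moreover have "prune Y \<subseteq> nodes lam k" using prune_sub p unfolding ctree_def is_tree_def by blast
  moreover have "is_seq s" if "s \<in> nodes lam k" for s using that unfolding nodes_def is_seq_def by blast
  ultimately show "is_tree lam k (prune Y)" unfolding is_tree_def using prune_le by blast
  have 1: "\<exists>u\<in>prune Y. t \<subseteq>\<^sub>m u \<and> t \<noteq> u" if t: "t \<in> prune Y" for t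
  proof -
    note tn = ctree_node[OF p subsetD[OF prune_sub t]]
    obtain b where "t(len t \<mapsto> b) \<in> prune Y" using OSucc_prune_nonempty[OF t] unfolding OSucc_def by blast
    moreover have "len (t(len t \<mapsto> b)) \<noteq> len t" using seq_append(2)[OF tn(1,2)] lam_next[OF tn(2)] by auto
    ultimately show ?thesis using seq_append(3)[OF tn(1,2), of b] by metis
  qed
  have 2: "f \<in> prune Y"
    if f: "\<delta> < lam" "is_limit \<delta>" "dom f = {..<\<delta>}" "\<forall>\<beta><\<delta>. f |` {..<\<beta>} \<in> prune Y" for \<delta> f
  proof (rule prune_limit)
    show "f \<in> p" using ctree_limit[OF p f(1,2,3)] f(4) prune_sub by blast
    show "\<exists>\<gamma>. \<beta> < \<gamma> \<and> \<gamma> \<le> len f \<and> f |` {..<\<gamma>} \<in> prune Y" if "\<beta> < len f" for \<beta>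
      using that f(2,4) len_eq[OF f(3)] unfolding is_limit_def by (metis less_imp_le)
  qed
  show "lt_closed lam (prune Y)" unfolding lt_closed_def using 1 2 by blast
qed

text \<open>Walk from \<open>t\<close> towards its target and stop at the first node of
  \<open>Q\<close>. By \<open>target_coherent\<close> every node passed has the same target, so the
  walk takes exactly the values that the pruned tree allows.\<close>

lemma next_Q:
  assumes t: "t \<in> prune Y"
  shows "\<exists>v\<in>Q \<inter> prune Y. t \<subseteq>\<^sub>m v \<and> (\<forall>u\<in>Q. t \<subseteq>\<^sub>m u \<and> u \<subseteq>\<^sub>m v \<longrightarrow> u = v)"
proof -
  have tp: "t \<in> p" using t prune_sub by blast
  note tn = ctree_node[OF p tp]
  define s where "s = target t"
  have s: "s \<in> Q" "t \<subseteq>\<^sub>m s" using target[OF tp] unfolding s_def by blast+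
  have sp: "s \<in> p" using s Q_sub by blast
  note sn = ctree_node[OF p sp]
  have st: "len t \<le> len s" "s |` {..<len t} = t" using seq_le_iff[OF tn(1) sn(1)] s(2) by blast+
  define \<gamma> where "\<gamma> = (LEAST g. len t \<le> g \<and> s |` {..<g} \<in> Q)"
  have "len t \<le> len s \<and> s |` {..<len s} \<in> Q"
    using st(1) s(1) seq_le_iff[OF sn(1) sn(1)] by simp
  then have g: "len t \<le> \<gamma>" "s |` {..<\<gamma>} \<in> Q" "\<gamma> \<le> len s"
    using LeastI[of "\<lambda>g. len t \<le> g \<and> s |` {..<g} \<in> Q"] Least_le[of "\<lambda>g. len t \<le> g \<and> s |` {..<g} \<in> Q"]
    unfolding \<gamma>_def by blast+
  have least: "s |` {..<x} \<notin> Q" if "len t \<le> x" "x < \<gamma>" for x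
    using not_less_Least[of x "\<lambda>g. len t \<le> g \<and> s |` {..<g} \<in> Q"] that unfolding \<gamma>_def by blast
  define v where "v = s |` {..<\<gamma>}"
  have v: "is_seq v" "len v = \<gamma>" "v \<subseteq>\<^sub>m s" "v \<in> Q" using seq_restrict[OF sn(1) g(3)] g(2) unfolding v_def by auto
  have vx: "v |` {..<x} = s |` {..<x}" "v x = s x" if "x < \<gamma>" for x
    unfolding v_def using that by (auto simp: restrict_map_def fun_eq_iff)
  have tv: "t \<subseteq>\<^sub>m v" using seq_le_comparable[OF tn(1) v(1) sn(1) s(2) v(3)] g(1) v(2) by simp
  have "v \<in> prune Y"
    unfolding prune_def
  proof (intro CollectI conjI allI impI)
    show "v \<in> p" using v Q_sub by blast
    fix x assume "x < len v"
    then have x: "x < \<gamma>" using v(2) by simp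
    show "the (v x) \<in> allowed Y (v |` {..<x})"
    proof (cases "x < len t")
      case True
      have "s |` {..<x} = t |` {..<x}"
        using True by (subst st(2)[symmetric]) (auto simp: restrict_map_def fun_eq_iff)
      moreover have "s x = t x" using seq_le_value[OF s(2) tn(1) True] .
      ultimately show ?thesis using t True vx[OF x] unfolding prune_def by auto
    next
      case False
      then have lx: "len t \<le> x" by simp
      have xs: "x \<le> len s" using x g(3) by simp
      have r: "is_seq (s |` {..<x})" "len (s |` {..<x}) = x" "s |` {..<x} \<subseteq>\<^sub>m s"
        using seq_restrict[OF sn(1) xs] by blast+
      have "t \<subseteq>\<^sub>m s |` {..<x}" using seq_le_comparable[OF tn(1) r(1) sn(1) s(2) r(3)] lx r(2) by simp
      then have "target (s |` {..<x}) = s"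
        using target_coherent[OF tp ctree_restrict[OF p sp]] r(3) unfolding s_def by blast
      then have "dir (s |` {..<x}) = the (s x)" unfolding dir_def r(2) by simp
      then show ?thesis using least[OF lx x] vx[OF x] unfolding allowed_def by simp
    qed
  qed
  moreover have "u = v" if u: "u \<in> Q" "t \<subseteq>\<^sub>m u" "u \<subseteq>\<^sub>m v" for u
  proof -
    have un: "is_seq u" using u Q_sub ctree_node(1)[OF p] by blast
    have "u \<subseteq>\<^sub>m s" using u(3) v(3) map_le_trans by blast
    then have us: "s |` {..<len u} = u" using seq_le_iff[OF un sn(1)] by blast
    have "len t \<le> len u" using seq_le_iff[OF tn(1) un] u(2) by blast
    then have "\<not> len u < \<gamma>" using least[of "len u"] us u(1) by auto
    then show ?thesis using seq_le_eq[OF un v(1) u(3)] v(2) by simp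
  qed
  ultimately show ?thesis using v(4) tv by blast
qed

text \<open>A branch avoiding \<open>Q\<close> from \<open>\<beta>\<close> on would always move in
  the direction of the target of its restriction to \<open>\<beta>\<close>, hence would reach this
  target, which is in \<open>Q\<close>.\<close>

lemma branch_Q:
  assumes b: "dom b = {..<lam}" "\<And>\<beta>. \<beta> < lam \<Longrightarrow> b |` {..<\<beta>} \<in> prune Y" and \<beta>: "\<beta> < lam"
  shows "\<exists>\<gamma><lam. \<beta> \<le> \<gamma> \<and> b |` {..<\<gamma>} \<in> Q"
proof (rule ccontr)
  assume no: "\<not> ?thesis"
  define t where "t = b |` {..<\<beta>}"
  have tp: "t \<in> p" using b(2)[OF \<beta>] prune_sub unfolding t_def by blast
  have tn: "is_seq t" "len t = \<beta>" using branch_restrict[OF b(1) \<beta>] unfolding t_def by blast+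
  define s where "s = target t"
  have s: "s \<in> Q" "t \<subseteq>\<^sub>m s" using target[OF tp] unfolding s_def by blast+
  have sp: "s \<in> p" using s Q_sub by blast
  note sn = ctree_node[OF p sp]
  have eq: "b x = s x" if "x < len s" for x
    using that
  proof (induction x rule: less_induct)
    case (less x)
    have xl: "x < lam" using less.prems sn(2) by simp
    show ?case
    proof (cases "x < \<beta>")
      case True
      then have "b x = t x" unfolding t_def by simp
      also have "\<dots> = s x" using seq_le_value[OF s(2) tn(1)] True tn(2) by simp
      finally show ?thesis .
    next
      case False
      have r: "b |` {..<x} = s |` {..<x}" using less by (auto simp: restrict_map_def fun_eq_iff)
      have rs: "is_seq (s |` {..<x})" "len (s |` {..<x}) = x" "s |` {..<x} \<subseteq>\<^sub>m s"
        using seq_restrict[OF sn(1)] less.prems by auto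
      have "t \<subseteq>\<^sub>m s |` {..<x}"
        using seq_le_comparable[OF tn(1) rs(1) sn(1) s(2) rs(3)] False tn(2) rs(2) by simp
      then have "target (s |` {..<x}) = s"
        using target_coherent[OF tp ctree_restrict[OF p sp]] rs(3) unfolding s_def by blast
      then have d: "dir (b |` {..<x}) = the (s x)" unfolding dir_def r rs(2) by simp
      have nQ: "b |` {..<x} \<notin> Q" using no xl False by (auto simp: not_less)
      have nx: "next_ord x < lam" "x < next_ord x" using next_ord_lam[OF xl] lam_next[OF xl] by blast+
      have "b |` {..<next_ord x} \<in> prune Y" using b(2)[OF nx(1)] .
      moreover have "len (b |` {..<next_ord x}) = next_ord x" using branch_restrict(2)[OF b(1) nx(1)] .
      moreover have "(b |` {..<next_ord x}) |` {..<x} = b |` {..<x}" "(b |` {..<next_ord x}) x = b x"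
        using nx(2) by (auto simp: restrict_map_def fun_eq_iff)
      ultimately have "the (b x) \<in> allowed Y (b |` {..<x})"
        using nx(2) unfolding prune_def mem_Collect_eq by (metis (lifting))
      then have "the (b x) = the (s x)" using d nQ unfolding allowed_def by simp
      moreover have "b x \<noteq> None" using b(1) xl by auto
      moreover have "s x \<noteq> None" using ctree_node(3)[OF p sp less.prems] by auto
      ultimately show ?thesis by (metis option.exhaust_sel)
    qed
  qed
  then have "b |` {..<len s} = s |` {..<len s}" by (auto simp: restrict_map_def fun_eq_iff)
  also have "\<dots> = s" using seq_le_iff[OF sn(1) sn(1)] by simp
  finally have "b |` {..<len s} \<in> Q" using s(1) by simp
  moreover have "\<beta> \<le> len s" using seq_le_iff[OF tn(1) sn(1)] s(2) tn(2) by simp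
  ultimately show False using no sn(2) by blast
qed

text \<open>Along a branch the index is strictly increasing on \<open>Q\<close>. If it stayed below
  some \<open>\<alpha>\<close>, its inverse would map \<open>{..<\<alpha>}\<close> onto an unbounded
  set of levels, against the regularity of \<open>lam\<close>.\<close>

lemma idx_unbounded:
  assumes t: "t \<in> prune Y" and \<alpha>: "\<alpha> < lam"
  shows "\<exists>s\<in>Q \<inter> prune Y. t \<subseteq>\<^sub>m s \<and> \<alpha> \<le> idx s"
proof (rule ccontr)
  assume no: "\<not> ?thesis"
  note pc = prune_ctree
  obtain b where b: "dom b = {..<lam}" "t \<subseteq>\<^sub>m b" "\<And>\<beta>. \<beta> < lam \<Longrightarrow> b |` {..<\<beta>} \<in> prune Y"
    using branch[OF pc t] by blast
  note tn = ctree_node[OF pc t]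
  define Z where "Z = {\<gamma>. \<gamma> < lam \<and> len t \<le> \<gamma> \<and> b |` {..<\<gamma>} \<in> Q}"
  have lt: "idx (b |` {..<\<gamma>}) < \<alpha>" if "\<gamma> \<in> Z" for \<gamma>
  proof -
    have "t \<subseteq>\<^sub>m b |` {..<\<gamma>}" using branch_le[OF b(1) _ tn(1) b(2)] that unfolding Z_def by blast
    then show ?thesis using no that b(3)[of \<gamma>] unfolding Z_def by (auto simp: not_le)
  qed
  have mono: "idx (b |` {..<\<gamma>}) < idx (b |` {..<\<gamma>'})" if "\<gamma> \<in> Z" "\<gamma>' \<in> Z" "\<gamma> < \<gamma>'" for \<gamma> \<gamma>'
  proof (rule idx_strict)
    show "b |` {..<\<gamma>} \<in> Q" "b |` {..<\<gamma>'} \<in> p" using that Q_sub unfolding Z_def by blast+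
    show "b |` {..<\<gamma>} \<subseteq>\<^sub>m b |` {..<\<gamma>'}" using that(3) by (auto simp: map_le_def restrict_map_def)
    show "b |` {..<\<gamma>} \<noteq> b |` {..<\<gamma>'}"
      using branch_restrict(2)[OF b(1)] that unfolding Z_def by (metis (lifting) less_irrefl mem_Collect_eq)
  qed
  \<comment> \<open>The inverse of the index along the branch; at indices not attained
    \<open>len t\<close> is just some ordinal below \<open>lam\<close>.\<close>
  define g where "g i = (if \<exists>\<gamma>\<in>Z. idx (b |` {..<\<gamma>}) = i then THE \<gamma>. \<gamma> \<in> Z \<and> idx (b |` {..<\<gamma>}) = i else len t)" for i
  have g: "g (idx (b |` {..<\<gamma>})) = \<gamma>" if "\<gamma> \<in> Z" for \<gamma>
  proof -
    have "(THE \<gamma>'. \<gamma>' \<in> Z \<and> idx (b |` {..<\<gamma>'}) = idx (b |` {..<\<gamma>})) = \<gamma>"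
      using that mono by (intro the_equality) (auto, metis less_irrefl neqE)
    then show ?thesis unfolding g_def using that by auto
  qed
  have "g i < lam" for i
  proof (cases "\<exists>\<gamma>\<in>Z. idx (b |` {..<\<gamma>}) = i")
    case True
    then obtain \<gamma> where "\<gamma> \<in> Z" "i = idx (b |` {..<\<gamma>})" by blast
    then show ?thesis using g unfolding Z_def by simp
  next
    case False
    then show ?thesis unfolding g_def using tn(2) by simp
  qed
  then have "g ` {..<\<alpha>} \<subseteq> {..<lam}" by auto
  from lam_regular[OF \<alpha> this] obtain z where z: "z < lam" "\<forall>y<\<alpha>. g y < z" by blast
  define z' where "z' = max z (len t)"
  have "z' < lam" using z tn(2) unfolding z'_def by simp
  from branch_Q[OF b(1,3) this] obtain \<gamma> where "\<gamma> < lam" "z' \<le> \<gamma>" "b |` {..<\<gamma>} \<in> Q" by blast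
  then have "\<gamma> \<in> Z" "z \<le> \<gamma>" unfolding Z_def z'_def by simp_all
  then show False using z(2) lt[of \<gamma>] g[of \<gamma>] by (metis leD)
qed

text \<open>The first node of \<open>Q\<close> beyond an immediate successor of \<open>u\<close> has
  index one more than \<open>u\<close>. These are the nodes with an immediate predecessor in
  \<open>Q\<close>, needed to lower the order type.\<close>

lemma idx_unbounded_successor:
  assumes t: "t \<in> prune Y" and \<alpha>: "\<alpha> < lam"
  shows "\<exists>s\<in>Q \<inter> prune Y. t \<subseteq>\<^sub>m s \<and> \<alpha> \<le> idx s \<and> (\<exists>u\<in>Q. u \<subseteq>\<^sub>m s \<and> u \<noteq> s \<and> idx s = next_ord (idx u))"
proof -
  obtain u where u: "u \<in> Q" "u \<in> prune Y" "t \<subseteq>\<^sub>m u" "\<alpha> \<le> idx u" using idx_unbounded[OF assms] by blast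
  have up: "u \<in> p" using u Q_sub by blast
  note un = ctree_node[OF p up]
  obtain b where b: "u(len u \<mapsto> b) \<in> prune Y" using OSucc_prune_nonempty[OF u(2)] unfolding OSucc_def by blast
  define w where "w = u(len u \<mapsto> b)"
  have w: "w \<in> prune Y" "is_seq w" "len w = next_ord (len u)" "u \<subseteq>\<^sub>m w"
    using b seq_append[OF un(1,2), of b] unfolding w_def by auto
  obtain v where v: "v \<in> Q" "v \<in> prune Y" "w \<subseteq>\<^sub>m v" "\<And>x. x \<in> Q \<Longrightarrow> w \<subseteq>\<^sub>m x \<Longrightarrow> x \<subseteq>\<^sub>m v \<Longrightarrow> x = v"
    using next_Q[OF w(1)] by blast
  have vp: "v \<in> p" and wp: "w \<in> p" using v w prune_sub by blast+
  note vn = ctree_node[OF p vp]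
  have uv: "u \<subseteq>\<^sub>m v" using w(4) v(3) map_le_trans by blast
  have lw: "len u < len w" using w(3) lam_next[OF un(2)] by simp
  then have "len u < len v" using seq_le_iff[OF w(2) vn(1)] v(3) less_le_trans by blast
  then have ne: "u \<noteq> v" by auto
  have "idx x < next_ord (idx u)" if x: "(x, v) \<in> initial_rel" "x \<in> Q" for x
  proof -
    note xv = initialD[OF x(1) vp]
    have "\<not> w \<subseteq>\<^sub>m x" using v(4)[OF x(2)] xv by blast
    then have xw: "x \<subseteq>\<^sub>m w" "x \<noteq> w" using comparable[OF xv(1) wp vp xv(2) v(3)] by auto
    then have "len x < len w" using initialD(4)[OF initialI[OF xv(1) wp]] wp by blast
    then have "len x \<le> len u" using w(3) next_ord(3)[OF un(2)] by simp
    then have "x \<subseteq>\<^sub>m u" using seq_le_comparable[OF ctree_node(1)[OF p xv(1)] un(1) w(2) xw(1) w(4)] by simp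
    then have "idx x \<le> idx u" using idx_strict[OF x(2) up] by (cases "x = u") (auto simp: less_imp_le)
    then show ?thesis using next_ord(3)[OF idx_lam[OF up]] by simp
  qed
  then have "idx v \<le> next_ord (idx u)" unfolding idx[of v] by (intro Least_le) blast
  moreover have "idx u < idx v" using idx_strict[OF u(1) vp uv ne] .
  moreover have "next_ord (idx u) \<le> idx v" using next_ord(2)[OF \<open>idx u < idx v\<close>] .
  ultimately have "idx v = next_ord (idx u)" "\<alpha> \<le> idx v" using u(4) by auto
  moreover have "t \<subseteq>\<^sub>m v" using u(3) uv map_le_trans by blast
  ultimately show ?thesis using v(1,2) u(1) uv ne by blast
qed

lemma Split_prune: "s \<in> Split (prune Y) \<Longrightarrow> s \<in> Q"
  using OSucc_prune[of s] unfolding Split_def allowed_def by (auto split: if_splits)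

end

text \<open>Here the splitting demanded at a node matches its index: the nodes of \<open>Q\<close>
  properly below \<open>u\<close>, listed by index as \<open>q i\<close>, increase and are
  \<open>k i\<close>-splitting. Their indices run through the limit ordinal \<open>idx u\<close> and
  their union is \<open>u\<close>, so splitting-closure makes \<open>u\<close> splitting to the
  degree \<open>k (idx u)\<close>.\<close>

lemma Q_closed:
  assumes scl: "splitting_closed lam (splitting k p) p" and "K = p"
    and u: "u \<in> p" and lim: "is_limit (len u)"
    and cof: "\<And>\<beta>. \<beta> < len u \<Longrightarrow> \<exists>v\<in>Q. v \<subseteq>\<^sub>m u \<and> v \<noteq> u \<and> \<beta> < len v"
  shows "u \<in> Q"
proof -
  note un = ctree_node[OF p u]
  have "\<exists>v. i < idx u \<longrightarrow> v \<in> Q \<and> v \<subseteq>\<^sub>m u \<and> v \<noteq> u \<and> idx v = i" for i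
    using idx_surj[OF u] by blast
  then obtain q where q: "\<And>i. i < idx u \<Longrightarrow> q i \<in> Q \<and> q i \<subseteq>\<^sub>m u \<and> q i \<noteq> u \<and> idx (q i) = i"
    by metis
  have inQ: "v = q (idx v)" if v: "v \<in> Q" "v \<subseteq>\<^sub>m u" "v \<noteq> u" for v
  proof -
    have i: "idx v < idx u" using idx_strict[OF v(1) u v(2,3)] .
    have c: "v \<subseteq>\<^sub>m q (idx v) \<or> q (idx v) \<subseteq>\<^sub>m v"
      using comparable[OF _ _ u v(2)] q[OF i] v(1) Q_sub by blast
    show ?thesis
      using c idx_strict[OF v(1), of "q (idx v)"] idx_strict[of "q (idx v)" v] q[OF i] v(1) Q_sub
      by (metis less_irrefl subsetD)
  qed
  have lim': "is_limit (idx u)"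
    unfolding is_limit_def
  proof (intro conjI allI impI)
    obtain x where "x < len u" using lim unfolding is_limit_def by blast
    then obtain v where "v \<in> Q" "v \<subseteq>\<^sub>m u" "v \<noteq> u" using cof by blast
    then show "\<exists>x. x < idx u" using idx_strict[OF _ u] by blast
    fix i assume i: "i < idx u"
    have qi: "q i \<in> p" using q[OF i] Q_sub by blast
    have "len (q i) < len u" using initialD(4)[OF initialI[OF qi u]] q[OF i] u by blast
    then obtain v where v: "v \<in> Q" "v \<subseteq>\<^sub>m u" "v \<noteq> u" "len (q i) < len v" using cof by blast
    have vp: "v \<in> p" using v Q_sub by blast
    have "q i \<subseteq>\<^sub>m v" using seq_le_comparable[OF ctree_node(1)[OF p qi] ctree_node(1)[OF p vp] un(1)] q[OF i] v by simp
    moreover have "q i \<noteq> v" using v(4) by auto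
    ultimately have "idx (q i) < idx v" using idx_strict[OF _ vp] q[OF i] by blast
    then show "\<exists>y<idx u. i < y" using q[OF i] idx_strict[OF v(1) u v(2,3)] by auto
  qed
  have spl: "q i \<in> p \<and> splitting k p i (q i)" if "i < idx u" for i
    using q[OF that] Q_sub unfolding Q_def by auto
  have inc: "q i \<subseteq>\<^sub>m q j \<and> q i \<noteq> q j" if "i < j" "j < idx u" for i j
  proof -
    have i: "i < idx u" using that by simp
    have c: "q i \<subseteq>\<^sub>m q j \<or> q j \<subseteq>\<^sub>m q i" using comparable[OF _ _ u] spl[OF i] spl[OF that(2)] q[OF i] q[OF that(2)] by blast
    have id: "idx (q i) = i" "idx (q j) = j" "q j \<in> Q" using q[OF i] q[OF that(2)] by blast+
    have ne: "q i \<noteq> q j"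
    proof
      assume "q i = q j"
      then have "idx (q i) = idx (q j)" by (rule arg_cong)
      then show False using that(1) unfolding id(1,2) by simp
    qed
    have "\<not> q j \<subseteq>\<^sub>m q i"
    proof
      assume "q j \<subseteq>\<^sub>m q i"
      from idx_strict[OF id(3) conjunct1[OF spl[OF i]] this ne[symmetric]]
      have "idx (q j) < idx (q i)" .
      then show False using that(1) unfolding id(1,2) by (rule less_asym)
    qed
    then show ?thesis using c ne by blast
  qed
  obtain u' where u': "u' \<in> p" "Map.graph u' = (\<Union>i\<in>{..<idx u}. Map.graph (q i))" "splitting k p (idx u) u'"
  proof -
    have "\<exists>u'\<in>p. Map.graph u' = (\<Union>i\<in>{..<idx u}. Map.graph (q i)) \<and> splitting k p (idx u) u'"
      using idx_lam[OF u] lim' spl inc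
      by (intro scl[unfolded splitting_closed_def, THEN spec, THEN spec, THEN mp]) simp
    then show ?thesis using that by blast
  qed
  have "Map.graph u = (\<Union>i\<in>{..<idx u}. Map.graph (q i))"
  proof (intro set_eqI iffI)
    fix e assume e: "e \<in> Map.graph u"
    obtain x y where xy: "e = (x, y)" "u x = Some y" using e by (metis in_graphD surj_pair)
    then have "x < len u" using dom_seq[OF un(1)] by blast
    then obtain v where v: "v \<in> Q" "v \<subseteq>\<^sub>m u" "v \<noteq> u" "x < len v" using cof by blast
    have "v x = Some y" using seq_le_value[OF v(2) ctree_node(1)[OF p subsetD[OF Q_sub v(1)]] v(4)] xy by simp
    then have "e \<in> Map.graph (q (idx v))" using xy inQ[OF v(1-3)] by (simp add: in_graphI)
    then show "e \<in> (\<Union>i\<in>{..<idx u}. Map.graph (q i))" using idx_strict[OF v(1) u v(2,3)] by blast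
  next
    fix e assume "e \<in> (\<Union>i\<in>{..<idx u}. Map.graph (q i))"
    then obtain i where i: "i < idx u" "e \<in> Map.graph (q i)" by blast
    obtain x y where xy: "e = (x, y)" "q i x = Some y" using i(2) by (metis in_graphD surj_pair)
    then have "u x = Some y" using q[OF i(1)] unfolding map_le_def by (metis domI)
    then show "e \<in> Map.graph u" using xy by (simp add: in_graphI)
  qed
  then have "Map.graph u' = Map.graph u" using u'(2) by simp
  then have "u' = u" unfolding Map.graph_def by (auto simp: fun_eq_iff set_eq_iff) (metis not_None_eq)
  moreover have "u \<in> K" using \<open>K = p\<close> u by blast
  ultimately show ?thesis using u'(3) unfolding Q_def by simp
qed

end

section \<open>Perfect tree forcings\<close>

lemma card_of_insert_infinite: "infinite A \<Longrightarrow> |insert a A| \<le>o |A|"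
  using infinite_imp_bij_betw2[of A a] card_of_ordIsoI[of _ "insert a A" A] bij_betw_inv ordIso_imp_ordLeq
  by (metis Un_insert_right sup_bot_right)

section \<open>Successor elements of a set of ordinals\<close>

definition succ_elems :: "'o::wellorder set \<Rightarrow> 'o set" where
  "succ_elems X = {b \<in> X. \<exists>a\<in>X. a < b \<and> (\<forall>c\<in>X. \<not> (a < c \<and> c < b))}"

text \<open>Sending each non-maximal element to the next one is injective, and at most one element
  is maximal.\<close>

lemma succ_elems_card:
  assumes "infinite X" shows "|X| \<le>o |succ_elems X|"
proof -
  define X0 where "X0 = {x \<in> X. \<exists>y\<in>X. x < y}"
  define g where "g x = (LEAST y. y \<in> X \<and> x < y)" for x
  have g: "g x \<in> X" "x < g x" "\<And>c. c \<in> X \<Longrightarrow> x < c \<Longrightarrow> g x \<le> c" if x: "x \<in> X0" for x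
  proof -
    obtain y where "y \<in> X \<and> x < y" using x unfolding X0_def by blast
    from LeastI[of "\<lambda>y. y \<in> X \<and> x < y", OF this] show "g x \<in> X" "x < g x" unfolding g_def by blast+
    show "\<And>c. c \<in> X \<Longrightarrow> x < c \<Longrightarrow> g x \<le> c" unfolding g_def by (rule Least_le) blast
  qed
  have "g ` X0 \<subseteq> succ_elems X"
  proof
    fix b assume "b \<in> g ` X0"
    then obtain x where x: "x \<in> X0" "b = g x" by blast
    have "x \<in> X" using x unfolding X0_def by blast
    moreover have "\<forall>c\<in>X. \<not> (x < c \<and> c < b)" using g(3)[OF x(1)] x(2) leD by blast
    ultimately show "b \<in> succ_elems X" unfolding succ_elems_def using g[OF x(1)] x(2) by blast
  qed
  moreover have "inj_on g X0"
  proof (rule inj_onI, rule ccontr)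
    fix x y assume xy: "x \<in> X0" "y \<in> X0" "g x = g y" "x \<noteq> y"
    have X: "x \<in> X" "y \<in> X" using xy unfolding X0_def by blast+
    from xy(4) consider "x < y" | "y < x" by (meson neqE)
    then show False
    proof cases
      case 1
      then have "g x \<le> y" using g(3)[OF xy(1) X(2)] by blast
      then show False using g(2)[OF xy(2)] xy(3) by simp
    next
      case 2
      then have "g y \<le> x" using g(3)[OF xy(2) X(1)] by blast
      then show False using g(2)[OF xy(1)] xy(3) by simp
    qed
  qed
  ultimately have le: "|X0| \<le>o |succ_elems X|" using card_of_ordLeq by blast
  \<comment> \<open>The maximum of \<open>X\<close> if there is one; otherwise an arbitrary value,
    and the inclusion below still holds.\<close>
  define m where "m = (SOME m. m \<in> X - X0)"
  have "X \<subseteq> insert m X0"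
  proof
    fix x assume x: "x \<in> X"
    show "x \<in> insert m X0"
    proof (cases "x \<in> X0")
      case False
      then have "m \<in> X - X0" unfolding m_def using x by (metis Diff_iff someI)
      then have "\<not> m < x" "\<not> x < m" using x False unfolding X0_def by blast+
      then show ?thesis by (simp add: not_less_iff_gr_or_eq)
    qed simp
  qed
  moreover from this have "infinite X0" using assms finite_subset by (metis finite_insert)
  ultimately have "|X| \<le>o |X0|"
    using card_of_insert_infinite[of X0 m] card_of_mono1[of X "insert m X0"] ordLeq_transitive by blast
  then show ?thesis using le by (rule ordLeq_transitive)
qed

lemma graph_subset_iff: "Map.graph s \<subseteq> Map.graph t \<longleftrightarrow> s \<subseteq>\<^sub>m t"
proof
  assume l: "Map.graph s \<subseteq> Map.graph t"
  show "s \<subseteq>\<^sub>m t" unfolding map_le_def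
  proof
    fix x assume "x \<in> dom s"
    then obtain y where "s x = Some y" by blast
    moreover from this have "t x = Some y" using l by (meson in_graphD in_graphI subsetD)
    ultimately show "s x = t x" by simp
  qed
next
  assume l: "s \<subseteq>\<^sub>m t"
  show "Map.graph s \<subseteq> Map.graph t"
  proof
    fix e assume "e \<in> Map.graph s"
    then obtain x y where "e = (x, y)" "s x = Some y" by (metis in_graphD surj_pair)
    moreover from this have "t x = Some y" using l unfolding map_le_def by (metis domI)
    ultimately show "e \<in> Map.graph t" by (simp add: in_graphI)
  qed
qed

lemma increasing_union:
  fixes w :: "'i::linorder \<Rightarrow> 'o::wellorder node"
  assumes seq: "\<And>i. i \<in> J \<Longrightarrow> is_seq (w i)" and d: "\<And>i. i \<in> J \<Longrightarrow> len (w i) < d"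
    and mono: "\<And>i j. i \<in> J \<Longrightarrow> j \<in> J \<Longrightarrow> i < j \<Longrightarrow> w i \<subseteq>\<^sub>m w j"
    and cof: "\<And>x. x < d \<Longrightarrow> \<exists>i\<in>J. x < len (w i)"
  obtains u where "dom u = {..<d}" "\<And>i x. i \<in> J \<Longrightarrow> x < len (w i) \<Longrightarrow> u x = w i x"
proof -
  have agree: "w i x = w j x" if "i \<in> J" "j \<in> J" "x < len (w i)" "x < len (w j)" for i j x
  proof (cases i j rule: linorder_cases)
    case less
    then show ?thesis using seq_le_value[OF mono[OF that(1,2)] seq[OF that(1)] that(3)] by simp
  next
    case greater
    then show ?thesis using seq_le_value[OF mono[OF that(2,1)] seq[OF that(2)] that(4)] by simp
  qed simp
  define u where "u x = (if x < d then w (SOME i. i \<in> J \<and> x < len (w i)) x else None)" for x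
  have u: "u x = w i x" if i: "i \<in> J" "x < len (w i)" for i x
  proof -
    define j where "j = (SOME i. i \<in> J \<and> x < len (w i))"
    have j: "j \<in> J" "x < len (w j)"
      unfolding j_def using someI[of "\<lambda>i. i \<in> J \<and> x < len (w i)" i] i by blast+
    moreover have "x < d" using i(2) d[OF i(1)] by (rule less_trans)
    ultimately show ?thesis using agree[OF i(1) j(1) i(2) j(2)] unfolding u_def j_def by simp
  qed
  have "u x \<noteq> None \<longleftrightarrow> x < d" for x
  proof
    assume "x < d"
    then obtain i where i: "i \<in> J" "x < len (w i)" using cof by blast
    then have "x \<in> dom (w i)" using dom_seq[OF seq] by simp
    then show "u x \<noteq> None" using u[OF i] by auto
  qed (auto simp: u_def split: if_splits)
  then have "dom u = {..<d}" by (auto simp: dom_def)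
  then show ?thesis using u by (rule that)
qed

lemma increasing_seq_sup:
  fixes g :: "nat \<Rightarrow> 'o::wellorder"
  assumes z: "\<forall>n. g n < z" and inc: "\<And>n. g n < g (Suc n)"
  defines "d \<equiv> LEAST z. \<forall>n. g n < z"
  shows "d \<le> z" "\<And>n. g n < d" "is_limit d" "\<And>x. x < d \<Longrightarrow> \<exists>n. x < g n"
proof -
  show "d \<le> z" unfolding d_def using z by (rule Least_le)
  from LeastI[of "\<lambda>z. \<forall>n. g n < z", OF z] show gd: "g n < d" for n unfolding d_def by blast
  show ex: "\<exists>n. x < g n" if "x < d" for x
  proof -
    have "\<not> (\<forall>n. g n < x)" using not_less_Least[of x "\<lambda>z. \<forall>n. g n < z"] that unfolding d_def by blast
    then obtain n where "x \<le> g n" by (auto simp: not_less)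
    then show ?thesis using inc[of n] le_less_trans by blast
  qed
  show "is_limit d" unfolding is_limit_def using gd ex by blast
qed

context cardinal_tower begin

lemma increasing_chain_sup:
  assumes "\<And>n::nat. g n < lam" "\<And>n. g n < g (Suc n)"
  defines "d \<equiv> LEAST z. \<forall>n. g n < z"
  shows "d < lam" "\<And>n. g n < d" "is_limit d" "\<And>x. x < d \<Longrightarrow> \<exists>n. x < g n"
proof -
  obtain z where z: "z < lam" "\<forall>n. g n < z" using lam_countable[of g, OF assms(1)] by blast
  note sup = increasing_seq_sup[of g, OF z(2) assms(2), folded d_def]
  show "d < lam" using sup(1) z(1) by (rule le_less_trans)
  show "\<And>n. g n < d" "is_limit d" "\<And>x. x < d \<Longrightarrow> \<exists>n. x < g n" using sup(2-4) by blast+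
qed

lemma ctree_chain:
  assumes q: "ctree q" and T: "\<And>n::nat. T n \<in> q" "\<And>n. T n \<subseteq>\<^sub>m T (Suc n)" "\<And>n. T n \<noteq> T (Suc n)"
  shows "\<exists>u\<in>q. (\<forall>n. T n \<subseteq>\<^sub>m u) \<and> len u = (LEAST z. \<forall>n. len (T n) < z)"
proof -
  note Tn = ctree_node[OF q T(1)]
  have lt: "len (T n) < len (T (Suc n))" for n
    using initial_rel_len[of "T n" "T (Suc n)"] Tn(1) T(2,3) unfolding initial_rel_def by blast
  define d where "d = (LEAST z. \<forall>n. len (T n) < z)"
  note sup = increasing_chain_sup[of "\<lambda>n. len (T n)", OF Tn(2) lt, folded d_def]
  have mono: "T m \<subseteq>\<^sub>m T n" if "m \<le> n" for m n
    using that by (induction n rule: dec_induct) (use T(2) map_le_trans in auto)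
  obtain f where dom: "dom f = {..<d}" and f: "\<And>n x. n \<in> UNIV \<Longrightarrow> x < len (T n) \<Longrightarrow> f x = T n x"
  proof (rule increasing_union[of UNIV T d])
    show "\<exists>n\<in>UNIV. x < len (T n)" if "x < d" for x using sup(4)[OF that] by blast
  qed (use Tn(1) sup(2) mono less_imp_le that in auto)
  have "f |` {..<\<beta>} \<in> q" if bd: "\<beta> < d" for \<beta>
  proof -
    obtain n where n: "\<beta> < len (T n)" using sup(4)[OF bd] by blast
    have "f |` {..<\<beta>} = T n |` {..<\<beta>}"
      using f n by (auto simp: restrict_map_def fun_eq_iff dest: less_trans)
    then show ?thesis using ctree_restrict[OF q T(1)] by simp
  qed
  then have "f \<in> q" using ctree_limit[OF q sup(1,3) dom] by blast
  moreover have "T n \<subseteq>\<^sub>m f" for n unfolding map_le_def using f dom_seq[OF Tn(1)] by auto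
  ultimately show ?thesis using len_eq[OF dom] unfolding d_def by blast
qed

lemma clubs_intersect:
  assumes C: "\<And>n::nat. club_in (C n) lam" shows "\<exists>\<beta><lam. \<forall>n. \<beta> \<in> C n"
proof -
  have ex: "\<exists>y\<in>C n. x < y" if "x < lam" for x n
    using C[of n] next_ord_lam[OF that] lam_next[OF that] unfolding club_in_def by (meson less_le_trans)
  define h where "h n x = (SOME y. y \<in> C n \<and> x < y)" for n x
  have h: "h n x \<in> C n \<and> x < h n x" if "x < lam" for n x
    unfolding h_def using someI_ex[of "\<lambda>y. y \<in> C n \<and> x < y"] ex[OF that] by blast
  have Cl: "y < lam" if "y \<in> C n" for y n using C[of n] that unfolding club_in_def by blast
  \<comment> \<open>\<open>prod_decode\<close> makes every \<open>n\<close> recur beyond any stage,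
    so the supremum is a limit of points of each \<open>C n\<close>. The start \<open>omega\<close>
    is just some ordinal below \<open>lam\<close>.\<close>
  define g where "g = rec_nat omega (\<lambda>m x. h (fst (prod_decode m)) x)"
  have g: "g 0 = omega" "g (Suc m) = h (fst (prod_decode m)) (g m)" for m unfolding g_def by simp_all
  have gl: "g m < lam" for m
  proof (induction m)
    case (Suc m)
    then show ?case using h Cl unfolding g by blast
  qed (use omega_lam g in simp)
  have inc: "g m < g (Suc m)" for m using h[OF gl] unfolding g by blast
  define d where "d = (LEAST z. \<forall>n. g n < z)"
  note sup = increasing_chain_sup[of g, OF gl inc, folded d_def]
  have mono: "g m \<le> g n" if "m \<le> n" for m n
    using that by (induction n rule: dec_induct) (use inc less_imp_le order_trans in blast)+
  have "d \<in> C n" for n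
  proof -
    have "\<exists>y\<in>C n. x < y \<and> y < d" if x: "x < d" for x
    proof -
      obtain m where m: "x < g m" using sup(4)[OF x] by blast
      define i where "i = prod_encode (n, m)"
      have "m \<le> i" unfolding i_def by (rule le_prod_encode_2)
      then have "x < g (Suc i)" using m mono[of m i] inc[of i] by (meson less_le_trans less_trans)
      moreover have "g (Suc i) \<in> C n" using h[OF gl[of i], of n] unfolding g i_def by simp
      ultimately show ?thesis using sup(2) by blast
    qed
    then show ?thesis using C[of n] sup(1,3) unfolding club_in_def by blast
  qed
  then show ?thesis using sup(1) by blast
qed

text \<open>\<open>\<Theta>\<close> is the demand on successor sets: trivial, stationary or
  containing a club. It is imposed at the same nodes as the cardinality demand, so that pruning
  treats all variants alike; \<open>perfect_kind_eq\<close> recovers the original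
  definitions.\<close>

definition perfect_kind :: "('o \<Rightarrow> 'o set \<Rightarrow> bool) \<Rightarrow> 'o node set set" where
  "perfect_kind \<Theta> = {p. ctree p \<and>
     (\<forall>t\<in>p. \<forall>\<alpha><lam. \<exists>s\<in>p. t \<subseteq>\<^sub>m s \<and> \<Theta> (len s) (OSucc p s) \<and> splitting k p \<alpha> s)}"

definition scl_kind :: "('o \<Rightarrow> 'o set \<Rightarrow> bool) \<Rightarrow> 'o node set set" where
  "scl_kind \<Theta> = {p \<in> perfect_kind \<Theta>.
     splitting_closed lam (\<lambda>\<alpha> t. splitting k p \<alpha> t \<and> \<Theta> (len t) (OSucc p t)) p}"

lemma splitting_Split: "s \<in> p \<Longrightarrow> splitting k p \<alpha> s \<Longrightarrow> \<alpha> < lam \<Longrightarrow> s \<in> Split p"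
  unfolding splitting_iff Split_def using two_elements(1) by blast

lemma cone_perfect_kind:
  assumes p: "p \<in> perfect_kind \<Theta>" and t: "t \<in> p" shows "cone p t \<in> perfect_kind \<Theta>"
proof -
  have pc: "ctree p" using p unfolding perfect_kind_def by blast
  have "\<exists>s\<in>cone p t. u \<subseteq>\<^sub>m s \<and> \<Theta> (len s) (OSucc (cone p t) s) \<and> splitting k (cone p t) \<alpha> s"
    if u: "u \<in> cone p t" "\<alpha> < lam" for u \<alpha>
  proof -
    obtain u' where u': "u' \<in> p" "t \<subseteq>\<^sub>m u'" "u \<subseteq>\<^sub>m u'" using u(1) t unfolding cone_def by auto
    obtain s where s: "s \<in> p" "u' \<subseteq>\<^sub>m s" "\<Theta> (len s) (OSucc p s)" "splitting k p \<alpha> s"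
      using p u'(1) u(2) unfolding perfect_kind_def by blast
    have ts: "t \<subseteq>\<^sub>m s" using map_le_trans[OF u'(2) s(2)] .
    have "s \<in> cone p t" using s(1) ts unfolding cone_def by blast
    moreover have "u \<subseteq>\<^sub>m s" using map_le_trans[OF u'(3) s(2)] .
    ultimately show ?thesis using s(3,4) OSucc_cone[OF pc s(1) ts] unfolding splitting_iff by (intro bexI[of _ s]) simp_all
  qed
  then show ?thesis using ctree_cone[OF pc t] unfolding perfect_kind_def by blast
qed

lemma cone_closed_perfect_kind: "cone_closed (perfect_kind \<Theta>)"
  unfolding cone_closed_def using cone_perfect_kind perfect_kind_def by blast

text \<open>Nodes that split in the cone extend \<open>t\<close> by \<open>Split_cone\<close>, and
  above \<open>t\<close> the successor sets of the cone are those of \<open>p\<close>; so closure is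
  inherited.\<close>

lemma cone_scl_kind:
  assumes p: "p \<in> scl_kind \<Theta>" and t: "t \<in> p" shows "cone p t \<in> scl_kind \<Theta>"
proof -
  have pk: "p \<in> perfect_kind \<Theta>" and scl: "splitting_closed lam (\<lambda>\<alpha> t. splitting k p \<alpha> t \<and> \<Theta> (len t) (OSucc p t)) p"
    using p unfolding scl_kind_def by blast+
  have pc: "ctree p" using pk unfolding perfect_kind_def by blast
  have "\<exists>u\<in>cone p t. Map.graph u = (\<Union>\<alpha>\<in>{..<\<delta>}. Map.graph (w \<alpha>)) \<and>
     splitting k (cone p t) \<delta> u \<and> \<Theta> (len u) (OSucc (cone p t) u)"
    if \<delta>: "\<delta> < lam" "is_limit \<delta>"
      and w: "\<forall>\<alpha><\<delta>. w \<alpha> \<in> cone p t \<and> splitting k (cone p t) \<alpha> (w \<alpha>) \<and> \<Theta> (len (w \<alpha>)) (OSucc (cone p t) (w \<alpha>))"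
      and inc: "\<forall>\<alpha> \<beta>. \<alpha> < \<beta> \<and> \<beta> < \<delta> \<longrightarrow> w \<alpha> \<subseteq>\<^sub>m w \<beta> \<and> w \<alpha> \<noteq> w \<beta>" for \<delta> w
  proof -
    have wp: "w \<alpha> \<in> p" "t \<subseteq>\<^sub>m w \<alpha>" "splitting k p \<alpha> (w \<alpha>)" "\<Theta> (len (w \<alpha>)) (OSucc p (w \<alpha>))" if a: "\<alpha> < \<delta>" for \<alpha>
    proof -
      have al: "\<alpha> < lam" using a \<delta>(1) by simp
      have wc: "w \<alpha> \<in> cone p t" "splitting k (cone p t) \<alpha> (w \<alpha>)" "\<Theta> (len (w \<alpha>)) (OSucc (cone p t) (w \<alpha>))"
        using w a by blast+
      show 1: "w \<alpha> \<in> p" using wc(1) cone_subset by blast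
      show 2: "t \<subseteq>\<^sub>m w \<alpha>" using Split_cone[OF pc t splitting_Split[OF wc(1,2) al]] .
      show "splitting k p \<alpha> (w \<alpha>)" "\<Theta> (len (w \<alpha>)) (OSucc p (w \<alpha>))"
        using wc(2,3) OSucc_cone[OF pc 1 2] unfolding splitting_iff by simp_all
    qed
    have "\<exists>u\<in>p. Map.graph u = (\<Union>\<alpha>\<in>{..<\<delta>}. Map.graph (w \<alpha>)) \<and> splitting k p \<delta> u \<and> \<Theta> (len u) (OSucc p u)"
      using \<delta> wp inc
      by (intro scl[unfolded splitting_closed_def, THEN spec, THEN spec, THEN mp]) simp
    then obtain u where u: "u \<in> p" "Map.graph u = (\<Union>\<alpha>\<in>{..<\<delta>}. Map.graph (w \<alpha>))"
      "splitting k p \<delta> u" "\<Theta> (len u) (OSucc p u)" by blast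
    obtain \<alpha> where a: "\<alpha> < \<delta>" using \<delta>(2) unfolding is_limit_def by blast
    have "Map.graph (w \<alpha>) \<subseteq> Map.graph u" using a u(2) by blast
    then have "w \<alpha> \<subseteq>\<^sub>m u" unfolding graph_subset_iff .
    then have tu: "t \<subseteq>\<^sub>m u" using wp(2)[OF a] map_le_trans by blast
    have "u \<in> cone p t" using u(1) tu unfolding cone_def by blast
    then show ?thesis using u(2-4) OSucc_cone[OF pc u(1) tu] unfolding splitting_iff by (intro bexI[of _ u]) simp_all
  qed
  then show ?thesis using cone_perfect_kind[OF pk t] unfolding scl_kind_def splitting_closed_def by blast
qed

lemma cone_closed_scl_kind: "cone_closed (scl_kind \<Theta>)"
  unfolding cone_closed_def using cone_scl_kind scl_kind_def perfect_kind_def by blast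

text \<open>\<open>Y\<close> has to keep the full size and kind only on a set of nodes that is dense
  with unbounded index; at other nodes of \<open>Q\<close> it may be a single point.\<close>

lemma prune_perfect_kind:
  assumes "pruning lam k p K"
    and Y: "\<And>s. s \<in> pruning.Q k p K \<Longrightarrow> Y s \<noteq> {} \<and> Y s \<subseteq> OSucc p s"
    and big: "\<And>t \<alpha>. t \<in> pruning.prune k p K Y \<Longrightarrow> \<alpha> < lam \<Longrightarrow>
      \<exists>s\<in>pruning.Q k p K \<inter> pruning.prune k p K Y. t \<subseteq>\<^sub>m s \<and> \<alpha> \<le> pruning.idx k p K s \<and>
        \<Theta> (len s) (Y s) \<and> |OSucc p s| \<le>o |Y s|"
  shows "pruning.prune k p K Y \<in> perfect_kind \<Theta>"
proof -
  interpret pruning lam k p K by fact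
  have "\<exists>s\<in>prune Y. t \<subseteq>\<^sub>m s \<and> \<Theta> (len s) (OSucc (prune Y) s) \<and> splitting k (prune Y) \<alpha> s"
    if t: "t \<in> prune Y" "\<alpha> < lam" for t \<alpha>
  proof -
    obtain s where s: "s \<in> Q" "s \<in> prune Y" "t \<subseteq>\<^sub>m s" "\<alpha> \<le> idx s" "\<Theta> (len s) (Y s)" "|OSucc p s| \<le>o |Y s|"
      using big[OF t] by blast
    have O: "OSucc (prune Y) s = Y s" using OSucc_prune[OF Y s(2)] s(1) unfolding allowed_def by simp
    have "s \<in> p" using s(1) Q_sub by blast
    then have "splitting k p \<alpha> s" using splitting_mono[OF _ s(4) idx_lam] s(1) unfolding Q_def by blast
    then have "splitting k (prune Y) \<alpha> s" unfolding splitting_iff O using s(6) ordLeq_transitive by blast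
    then show ?thesis using s(2,3,5) O by (intro bexI[of _ s]) simp_all
  qed
  then show ?thesis using prune_ctree[OF Y] unfolding perfect_kind_def by blast
qed

lemma pruning_perfect_kind:
  assumes "p \<in> perfect_kind \<Theta>"
  shows "pruning lam k p {s \<in> p. \<Theta> (len s) (OSucc p s)}"
proof -
  have "ctree p" using assms unfolding perfect_kind_def by blast
  moreover have "\<exists>s\<in>{s \<in> p. \<Theta> (len s) (OSucc p s)}. t \<subseteq>\<^sub>m s \<and> splitting k p \<alpha> s" if "t \<in> p" "\<alpha> < lam" for t \<alpha>
    using assms that unfolding perfect_kind_def by blast
  ultimately show ?thesis by unfold_locales auto
qed

section \<open>Perfect trees: lowering the order type of the splitting nodes\<close>

text \<open>The order-preserving map \<open>e\<close> embeds the splitting nodes of \<open>r\<close>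
  up to \<open>s\<close> into splitting nodes of \<open>p\<close> properly below \<open>s\<close>.
  So the order type of the splitting nodes below \<open>s\<close> is smaller in \<open>r\<close>
  than in \<open>p\<close>.\<close>

definition split_drop :: "'o node set \<Rightarrow> 'o node set \<Rightarrow> bool" where
  "split_drop p r \<longleftrightarrow> (\<exists>e. \<forall>s\<in>Split r. e s \<in> Split p \<and> (e s, s) \<in> initial_rel \<and>
     (\<forall>s'\<in>Split r. (s', s) \<in> initial_rel \<longrightarrow> (e s', e s) \<in> initial_rel))"

text \<open>Let the tree split only at nodes of \<open>Q\<close> with successor index, and let
  \<open>e\<close> move to the preceding node of \<open>Q\<close>. If \<open>s'\<close> is properly
  below \<open>s\<close>, then the index of \<open>e s'\<close> is less than that of
  \<open>s'\<close>, which is at most that of \<open>e s\<close>; so \<open>e\<close> preserves the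
  order.\<close>

lemma split_drop_dense:
  assumes r: "r \<in> perfect_kind \<Theta>" and rp: "r \<subseteq> p"
  shows "\<exists>r'\<in>perfect_kind \<Theta>. r' \<subseteq> r \<and> split_drop p r'"
proof -
  interpret pruning lam k r "{s \<in> r. \<Theta> (len s) (OSucc r s)}" by (rule pruning_perfect_kind[OF r])
  note rc = p
  define E where "E s u \<longleftrightarrow> u \<in> Q \<and> u \<subseteq>\<^sub>m s \<and> u \<noteq> s \<and> idx s = next_ord (idx u)" for s u
  define e where "e s = (SOME u. E s u)" for s
  \<comment> \<open>Nodes whose index is 0 or a limit keep one successor and stop splitting.\<close>
  define Y where "Y s = (if \<exists>u. E s u then OSucc r s else {SOME b. b \<in> OSucc r s})" for s
  have Y: "Y s \<noteq> {} \<and> Y s \<subseteq> OSucc r s" if "s \<in> Q" for s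
  proof -
    have "OSucc r s \<noteq> {}" using OSucc_nonempty[OF rc] that Q_sub by blast
    then have "(SOME b. b \<in> OSucc r s) \<in> OSucc r s" by (simp add: some_in_eq)
    then show ?thesis using \<open>OSucc r s \<noteq> {}\<close> unfolding Y_def by simp
  qed
  have "prune Y \<in> perfect_kind \<Theta>"
  proof (rule prune_perfect_kind[OF pruning_axioms Y])
    fix t \<alpha> assume t: "t \<in> prune Y" "\<alpha> < lam"
    then obtain s where s: "s \<in> Q \<inter> prune Y" "t \<subseteq>\<^sub>m s" "\<alpha> \<le> idx s" "\<exists>u. E s u"
      using idx_unbounded_successor[OF Y t] unfolding E_def by blast
    have "Y s = OSucc r s" using s(4) unfolding Y_def by simp
    moreover have "\<Theta> (len s) (OSucc r s)" using s(1) unfolding Q_def by simp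
    ultimately show "\<exists>s\<in>Q \<inter> prune Y. t \<subseteq>\<^sub>m s \<and> \<alpha> \<le> idx s \<and> \<Theta> (len s) (Y s) \<and> |OSucc r s| \<le>o |Y s|"
      using s(1-3) by (intro bexI[of _ s]) (simp_all add: card_of_mono1)
  qed
  moreover have "split_drop p (prune Y)"
    unfolding split_drop_def
  proof (intro exI[of _ e] ballI conjI impI)
    have Es: "E s (e s)" "s \<in> Q" if s: "s \<in> Split (prune Y)" for s
    proof -
      show sQ: "s \<in> Q" using Split_prune[OF Y s] .
      have "s \<in> prune Y" using s unfolding Split_def by blast
      then have "OSucc (prune Y) s = Y s" using OSucc_prune[OF Y] sQ unfolding allowed_def by simp
      then have "\<exists>u. E s u" using s unfolding Split_def Y_def by (auto split: if_splits)
      then show "E s (e s)" unfolding e_def by (rule someI_ex)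
    qed
    fix s assume s: "s \<in> Split (prune Y)"
    have sr: "s \<in> r" "e s \<in> r" "e s \<in> Q" using Es[OF s] Q_sub unfolding E_def by blast+
    show "e s \<in> Split p" using Q_Split[OF sr(3)] Split_mono[OF rp] by blast
    show "(e s, s) \<in> initial_rel" using initialI[OF sr(2,1)] Es[OF s] unfolding E_def by blast
    fix s' assume s': "s' \<in> Split (prune Y)" "(s', s) \<in> initial_rel"
    have sr': "s' \<in> r" "e s' \<in> r" "e s' \<in> Q" using Es[OF s'(1)] Q_sub unfolding E_def by blast+
    have ss: "s' \<subseteq>\<^sub>m s" "s' \<noteq> s" using s'(2) unfolding initial_rel_def by blast+
    have "idx s' < idx s" using idx_strict[OF Es(2)[OF s'(1)] sr(1) ss] .
    then have "idx s' \<le> idx (e s)"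
      using Es(1)[OF s] next_ord(3)[OF idx_lam[OF sr(2)]] unfolding E_def by simp
    moreover have "idx (e s') < idx s'" using idx_strict[OF sr'(3,1)] Es(1)[OF s'(1)] unfolding E_def by blast
    ultimately have lt: "idx (e s') < idx (e s)" by simp
    have es: "e s' \<subseteq>\<^sub>m s'" "e s \<subseteq>\<^sub>m s" using Es(1)[OF s] Es(1)[OF s'(1)] unfolding E_def by blast+
    have "e s' \<subseteq>\<^sub>m s" using map_le_trans[OF es(1) ss(1)] .
    then have c: "e s' \<subseteq>\<^sub>m e s \<or> e s \<subseteq>\<^sub>m e s'" using comparable[OF sr'(2) sr(2) sr(1) _ es(2)] by blast
    have ne: "e s' \<noteq> e s" using lt by auto
    have "\<not> e s \<subseteq>\<^sub>m e s'"
    proof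
      assume "e s \<subseteq>\<^sub>m e s'"
      from idx_strict[OF sr(3) sr'(2) this ne[symmetric]] show False using lt by (rule less_asym)
    qed
    then show "(e s', e s) \<in> initial_rel" using c initialI[OF sr'(2) sr(2)] ne by blast
  qed
  ultimately show ?thesis using prune_sub[OF Y] by blast
qed

lemma split_drop_chain:
  assumes "\<And>n::nat. split_drop (a n) (a (Suc n))" shows "\<exists>n. s \<notin> Split (a n)"
proof -
  have "\<exists>e. \<forall>n. \<forall>s\<in>Split (a (Suc n)). e n s \<in> Split (a n) \<and> (e n s, s) \<in> initial_rel \<and>
     (\<forall>s'\<in>Split (a (Suc n)). (s', s) \<in> initial_rel \<longrightarrow> (e n s', e n s) \<in> initial_rel)"
    using assms unfolding split_drop_def by (rule choice[OF allI])
  then obtain e where e: "\<And>n s. s \<in> Split (a (Suc n)) \<Longrightarrow> e n s \<in> Split (a n) \<and> (e n s, s) \<in> initial_rel \<and>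
     (\<forall>s'\<in>Split (a (Suc n)). (s', s) \<in> initial_rel \<longrightarrow> (e n s', e n s) \<in> initial_rel)" by blast
  show ?thesis
    by (rule no_regressive_chain[OF wf_initial_rel, of "\<lambda>n. Split (a n)" e]) (use e in blast)+
qed

theorem perfect_kind_adds:
  "adds_new_function (perfect_kind \<Theta>) (\<subseteq>) {..<lam} {0, 1 :: nat}"
proof (rule antichain_matrix[OF cone_closed_perfect_kind, of _ split_drop])
  fix p r assume "r \<in> perfect_kind \<Theta>" "r \<subseteq> p"
  then show "\<exists>r'\<in>perfect_kind \<Theta>. r' \<subseteq> r \<and> split_drop p r'" by (rule split_drop_dense)
next
  fix a :: "nat \<Rightarrow> _" and s :: "'o node"
  assume "\<And>n. split_drop (a n) (a (Suc n))" "\<And>n. s \<in> Split (a n)"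
  then show False using split_drop_chain[of a s] by blast
next
  fix q and A :: "nat \<Rightarrow> 'o set"
  assume q: "q \<in> perfect_kind \<Theta>" and empty: "\<And>\<beta>. \<beta> < lam \<Longrightarrow> \<exists>n. \<beta> \<notin> A n"
    and dense: "\<And>n r. r \<in> perfect_kind \<Theta> \<Longrightarrow> r \<subseteq> q \<Longrightarrow>
      \<exists>r'\<in>perfect_kind \<Theta>. r' \<subseteq> r \<and> (\<forall>s\<in>Split r'. len s \<in> A n)"
  have qc: "ctree q" using q unfolding perfect_kind_def by blast
  \<comment> \<open>Good splitting of every degree \<open>\<alpha>\<close> is still available above
    \<open>t\<close> at levels outside \<open>A n\<close>.\<close>
  define G where "G n \<alpha> t \<longleftrightarrow> (\<exists>s\<in>q. t \<subseteq>\<^sub>m s \<and> \<Theta> (len s) (OSucc q s) \<and> splitting k q \<alpha> s \<and> len s \<notin> A n)" for n \<alpha> t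
  \<comment> \<open>Otherwise build a chain \<open>T\<close> of length omega such that beyond
    \<open>T (Suc n)\<close> splitting of some degree, depending on \<open>n\<close>, occurs only at
    levels in \<open>A n\<close>. The chain has an upper bound in \<open>q\<close>, and a node above
    it splitting to a degree beyond all these has its level in every \<open>A n\<close>, which
    \<open>empty\<close> forbids.\<close>
  have "\<exists>n. \<exists>t\<in>q. \<forall>t'\<in>q. t \<subseteq>\<^sub>m t' \<longrightarrow> (\<forall>\<alpha><lam. G n \<alpha> t')"
  proof (rule ccontr)
    assume no: "\<not> ?thesis"
    have step: "\<exists>t' \<alpha>. t' \<in> q \<and> t \<subseteq>\<^sub>m t' \<and> t \<noteq> t' \<and> \<alpha> < lam \<and> \<not> G n \<alpha> t'" if t: "t \<in> q" for n t
    proof -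
      obtain t1 where t1: "t1 \<in> q" "t \<subseteq>\<^sub>m t1" "t \<noteq> t1" using ctree_proper_extension[OF qc t] by blast
      obtain t2 \<alpha> where t2: "t2 \<in> q" "t1 \<subseteq>\<^sub>m t2" "\<alpha> < lam" "\<not> G n \<alpha> t2" using no t1(1) by blast
      have "t \<subseteq>\<^sub>m t2" using map_le_trans[OF t1(2) t2(2)] .
      moreover have "t \<noteq> t2" using t1(2,3) t2(2) map_le_antisym by blast
      ultimately show ?thesis using t2 by blast
    qed
    define F where "F n t = (SOME x. fst x \<in> q \<and> t \<subseteq>\<^sub>m fst x \<and> t \<noteq> fst x \<and> snd x < lam \<and> \<not> G n (snd x) (fst x))" for n t
    have F: "fst (F n t) \<in> q \<and> t \<subseteq>\<^sub>m fst (F n t) \<and> t \<noteq> fst (F n t) \<and> snd (F n t) < lam \<and> \<not> G n (snd (F n t)) (fst (F n t))"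
      if t: "t \<in> q" for n t
    proof -
      have "\<exists>x. fst x \<in> q \<and> t \<subseteq>\<^sub>m fst x \<and> t \<noteq> fst x \<and> snd x < lam \<and> \<not> G n (snd x) (fst x)"
        using step[OF t] by simp
      from someI_ex[OF this] show ?thesis unfolding F_def .
    qed
    obtain t0 where t0: "t0 \<in> q" using ctree_nonempty[OF qc] by blast
    define T where "T = rec_nat t0 (\<lambda>n t. fst (F n t))"
    have T: "T 0 = t0" "T (Suc n) = fst (F n (T n))" for n unfolding T_def by simp_all
    have Tq: "T n \<in> q" for n
    proof (induction n)
      case (Suc n)
      then show ?case using F[OF Suc] unfolding T by blast
    qed (use T t0 in simp)
    have Ti: "T n \<subseteq>\<^sub>m T (Suc n)" "T n \<noteq> T (Suc n)" for n using F[OF Tq, of n n] unfolding T by blast+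
    obtain u where u: "u \<in> q" "\<And>n. T n \<subseteq>\<^sub>m u" using ctree_chain[of q T, OF qc Tq Ti] by blast
    \<comment> \<open>Uncountable cofinality of \<open>lam\<close>: one degree exceeds the countably
      many that failed.\<close>
    obtain \<alpha> where \<alpha>: "\<alpha> < lam" "\<And>n. snd (F n (T n)) < \<alpha>"
      using lam_countable[of "\<lambda>n. snd (F n (T n))"] F[OF Tq] by blast
    obtain s where s: "s \<in> q" "u \<subseteq>\<^sub>m s" "\<Theta> (len s) (OSucc q s)" "splitting k q \<alpha> s"
      using q u(1) \<alpha>(1) unfolding perfect_kind_def by blast
    obtain n where n: "len s \<notin> A n" using empty ctree_node(2)[OF qc s(1)] by blast
    have "splitting k q (snd (F n (T n))) s" using splitting_mono[OF s(4) _ \<alpha>(1)] \<alpha>(2)[of n] less_imp_le by blast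
    moreover have "T (Suc n) \<subseteq>\<^sub>m s" using map_le_trans[OF u(2) s(2)] .
    ultimately have "G n (snd (F n (T n))) (T (Suc n))" unfolding G_def using s(1,3) n by blast
    then show False using F[OF Tq, of n n] unfolding T by blast
  qed
  then obtain n t where t: "t \<in> q" "\<And>t' \<alpha>. t' \<in> q \<Longrightarrow> t \<subseteq>\<^sub>m t' \<Longrightarrow> \<alpha> < lam \<Longrightarrow> G n \<alpha> t'" by blast
  define r where "r = cone q t"
  have rc: "ctree r" and rk: "r \<in> perfect_kind \<Theta>" and rq: "r \<subseteq> q"
    unfolding r_def using ctree_cone[OF qc t(1)] cone_perfect_kind[OF q t(1)] cone_subset by blast+
  \<comment> \<open>Pruning to \<open>K\<close> gives a condition that splits only at levels outside
    \<open>A n\<close>, while \<open>dense\<close> provides an extension of it that splits only at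
    levels inside.\<close>
  define K where "K = {s \<in> r. \<Theta> (len s) (OSucc r s) \<and> len s \<notin> A n}"
  have "\<exists>s\<in>K. t' \<subseteq>\<^sub>m s \<and> splitting k r \<alpha> s" if t': "t' \<in> r" "\<alpha> < lam" for t' \<alpha>
  proof -
    obtain v where v: "v \<in> q" "t \<subseteq>\<^sub>m v" "t' \<subseteq>\<^sub>m v" using t'(1) t(1) unfolding r_def cone_def by auto
    obtain s where s: "s \<in> q" "v \<subseteq>\<^sub>m s" "\<Theta> (len s) (OSucc q s)" "splitting k q \<alpha> s" "len s \<notin> A n"
      using t(2)[OF v(1,2) t'(2)] unfolding G_def by blast
    have ts: "t \<subseteq>\<^sub>m s" using map_le_trans[OF v(2) s(2)] .
    have O: "OSucc r s = OSucc q s" unfolding r_def using OSucc_cone[OF qc s(1) ts] .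
    have "s \<in> r" using s(1) ts unfolding r_def cone_def by blast
    then have "s \<in> K" unfolding K_def using s(3,5) O by simp
    moreover have "t' \<subseteq>\<^sub>m s" using map_le_trans[OF v(3) s(2)] .
    ultimately show ?thesis using s(4) O unfolding splitting_iff by (intro bexI[of _ s]) simp_all
  qed
  then interpret pruning lam k r K using rc unfolding K_def by unfold_locales auto
  have Y: "OSucc r s \<noteq> {} \<and> OSucc r s \<subseteq> OSucc r s" if "s \<in> Q" for s
    using OSucc_nonempty[OF rc] that Q_sub by blast
  have pk: "prune (OSucc r) \<in> perfect_kind \<Theta>"
  proof (rule prune_perfect_kind[OF pruning_axioms Y])
    fix t \<alpha> assume t: "t \<in> prune (OSucc r)" "\<alpha> < lam"
    then obtain s where s: "s \<in> Q \<inter> prune (OSucc r)" "t \<subseteq>\<^sub>m s" "\<alpha> \<le> idx s"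
      using idx_unbounded[OF Y t] by blast
    moreover have "s \<in> K" using s(1) unfolding Q_def by simp
    then have "\<Theta> (len s) (OSucc r s)" unfolding K_def by simp
    ultimately show "\<exists>s\<in>Q \<inter> prune (OSucc r). t \<subseteq>\<^sub>m s \<and> \<alpha> \<le> idx s \<and> \<Theta> (len s) (OSucc r s) \<and> |OSucc r s| \<le>o |OSucc r s|"
      by (intro bexI[of _ s]) (simp_all add: card_of_mono1)
  qed
  have psub: "prune (OSucc r) \<subseteq> r" using prune_sub[OF Y] .
  obtain r' where r': "r' \<in> perfect_kind \<Theta>" "r' \<subseteq> prune (OSucc r)" "\<forall>s\<in>Split r'. len s \<in> A n"
    using dense[OF pk] psub rq by (meson subset_trans)
  obtain s0 where "s0 \<in> r'" using r'(1) ctree_nonempty unfolding perfect_kind_def by blast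
  then obtain s where "s \<in> r'" "splitting k r' omega s"
    using r'(1) omega_lam unfolding perfect_kind_def by blast
  then have s: "s \<in> Split r'" using splitting_Split omega_lam by blast
  then have "s \<in> Q" using Split_prune[OF Y] Split_mono[OF r'(2)] by blast
  then have "s \<in> K" unfolding Q_def by simp
  then have "len s \<notin> A n" unfolding K_def by simp
  then show False using r'(3) s by blast
qed

section \<open>Splitting-closed trees: lowering positions among siblings\<close>

text \<open>A splitting-closed tree cannot give up splitting at limits of its splitting nodes, so
  the order type of these nodes cannot be lowered as before. Instead each splitting node keeps as
  many successors, but every remaining one has a smaller position among its siblings.\<close>

definition succ_drop :: "'o node set \<Rightarrow> 'o node set \<Rightarrow> bool" where
  "succ_drop p r \<longleftrightarrow> (\<forall>s\<in>Split r. \<exists>e. \<forall>b\<in>OSucc r s. e b \<in> OSucc p s \<and> e b < b \<and>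
     (\<forall>b'\<in>OSucc r s. b' < b \<longrightarrow> e b' < e b))"

lemma pruning_scl_kind:
  assumes "r \<in> scl_kind (\<lambda>_ _. True)"
  shows "pruning lam k r r" "splitting_closed lam (splitting k r) r"
  using assms pruning_perfect_kind[of r "\<lambda>_ _. True"] unfolding scl_kind_def by simp_all

text \<open>Keep at each node of \<open>Q\<close> the successor elements of its successor set and
  let \<open>e\<close> be the immediate predecessor in that set. The cardinality is unchanged, so
  the splitting demanded at limits survives.\<close>

lemma succ_drop_dense:
  assumes r: "r \<in> scl_kind (\<lambda>_ _. True)" and rp: "r \<subseteq> p"
  shows "\<exists>r'\<in>scl_kind (\<lambda>_ _. True). r' \<subseteq> r \<and> succ_drop p r'"
proof -
  interpret pruning lam k r r by (rule pruning_scl_kind(1)[OF r])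
  note rc = p and scl = pruning_scl_kind(2)[OF r]
  define Y where "Y s = succ_elems (OSucc r s)" for s
  have Yc: "|OSucc r s| \<le>o |Y s|" if "s \<in> Q" for s
    unfolding Y_def using succ_elems_card two_elements(2)[OF Q_splitting[OF that] idx_lam] that Q_sub by blast
  have Y: "Y s \<noteq> {} \<and> Y s \<subseteq> OSucc r s" if "s \<in> Q" for s
  proof -
    have "infinite (OSucc r s)" using two_elements(2)[OF Q_splitting[OF that] idx_lam] that Q_sub by blast
    then have "infinite (Y s)" using card_of_ordLeq_infinite[OF Yc[OF that]] by blast
    moreover have "Y s \<subseteq> OSucc r s" unfolding Y_def succ_elems_def by blast
    ultimately show ?thesis by auto
  qed
  have pk: "prune Y \<in> perfect_kind (\<lambda>_ _. True)"
  proof (rule prune_perfect_kind[OF pruning_axioms Y])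
    fix t \<alpha> assume t: "t \<in> prune Y" "\<alpha> < lam"
    then show "\<exists>s\<in>Q \<inter> prune Y. t \<subseteq>\<^sub>m s \<and> \<alpha> \<le> idx s \<and> True \<and> |OSucc r s| \<le>o |Y s|"
      using idx_unbounded[OF Y t] Yc by blast
  qed
  have ps: "prune Y \<subseteq> r" using prune_sub[OF Y] .
  have "\<exists>u\<in>prune Y. Map.graph u = (\<Union>\<alpha>\<in>{..<\<delta>}. Map.graph (w \<alpha>)) \<and> splitting k (prune Y) \<delta> u"
    if \<delta>: "\<delta> < lam" "is_limit \<delta>" and w: "\<forall>\<alpha><\<delta>. w \<alpha> \<in> prune Y \<and> splitting k (prune Y) \<alpha> (w \<alpha>)"
      and inc: "\<forall>\<alpha> \<beta>. \<alpha> < \<beta> \<and> \<beta> < \<delta> \<longrightarrow> w \<alpha> \<subseteq>\<^sub>m w \<beta> \<and> w \<alpha> \<noteq> w \<beta>" for \<delta> w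
  proof -
    have wQ: "w \<alpha> \<in> Q" "w \<alpha> \<in> r" "splitting k r \<alpha> (w \<alpha>)" "w \<alpha> \<in> prune Y" if a: "\<alpha> < \<delta>" for \<alpha>
    proof -
      have al: "\<alpha> < lam" using a \<delta>(1) by simp
      show wa: "w \<alpha> \<in> prune Y" using w a by blast
      have sp: "splitting k (prune Y) \<alpha> (w \<alpha>)" using w a by blast
      show "w \<alpha> \<in> Q" using Split_prune[OF Y splitting_Split[OF wa sp al]] .
      then show "w \<alpha> \<in> r" using Q_sub by blast
      show "splitting k r \<alpha> (w \<alpha>)" using sp card_of_mono1[OF OSucc_mono[OF ps]] ordLeq_transitive
        unfolding splitting_iff by blast
    qed
    have "\<exists>u\<in>r. Map.graph u = (\<Union>\<alpha>\<in>{..<\<delta>}. Map.graph (w \<alpha>)) \<and> splitting k r \<delta> u"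
      using \<delta> wQ(2,3) inc
      by (intro scl[unfolded splitting_closed_def, THEN spec, THEN spec, THEN mp]) simp
    then obtain u where u: "u \<in> r" "Map.graph u = (\<Union>\<alpha>\<in>{..<\<delta>}. Map.graph (w \<alpha>))" "splitting k r \<delta> u"
      by blast
    note un = ctree_node[OF rc u(1)]
    have wu: "w \<alpha> \<subseteq>\<^sub>m u" if "\<alpha> < \<delta>" for \<alpha>
      using u(2) that unfolding graph_subset_iff[symmetric] by blast
    have wn: "w \<alpha> \<noteq> u" if a: "\<alpha> < \<delta>" for \<alpha>
    proof
      assume eq: "w \<alpha> = u"
      obtain \<beta> where b: "\<alpha> < \<beta>" "\<beta> < \<delta>" using a \<delta>(2) unfolding is_limit_def by blast
      have "w \<beta> \<subseteq>\<^sub>m w \<alpha>" using wu[OF b(2)] eq by simp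
      then show False using inc b map_le_antisym by blast
    qed
    have wl: "len (w \<alpha>) < len u" if a: "\<alpha> < \<delta>" for \<alpha>
      using initialD(4)[OF initialI[OF wQ(2)[OF a] u(1) wu[OF a] wn[OF a]] u(1)] .
    have cof: "\<exists>\<alpha><\<delta>. x < len (w \<alpha>)" if x: "x < len u" for x
    proof -
      obtain y where "u x = Some y" using un(3)[OF x] by blast
      then have "(x, y) \<in> (\<Union>\<alpha>\<in>{..<\<delta>}. Map.graph (w \<alpha>))" using u(2) in_graphI by metis
      then obtain \<alpha> where a: "\<alpha> < \<delta>" "w \<alpha> x = Some y" using in_graphD by fastforce
      then have "x < len (w \<alpha>)" using dom_seq[OF ctree_node(1)[OF rc wQ(2)[OF a(1)]]] by blast
      then show ?thesis using a(1) by blast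
    qed
    have lim: "is_limit (len u)"
      unfolding is_limit_def
    proof (intro conjI allI impI)
      obtain \<alpha> where "\<alpha> < \<delta>" using \<delta>(2) unfolding is_limit_def by blast
      then show "\<exists>x. x < len u" using wl by blast
      fix x assume "x < len u"
      then show "\<exists>y<len u. x < y" using cof wl by blast
    qed
    \<comment> \<open>Nodes that split in the pruned tree are in \<open>Q\<close>, so their limit
      \<open>u\<close> is in \<open>Q\<close> as well and the pruned tree keeps all of
      \<open>Y u\<close> there.\<close>
    have uQ: "u \<in> Q"
    proof (rule Q_closed[OF scl refl u(1) lim])
      fix x assume "x < len u"
      then obtain \<alpha> where "\<alpha> < \<delta>" "x < len (w \<alpha>)" using cof by blast
      then show "\<exists>v\<in>Q. v \<subseteq>\<^sub>m u \<and> v \<noteq> u \<and> x < len v" using wQ(1) wu wn by blast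
    qed
    have up: "u \<in> prune Y"
    proof (rule prune_limit[OF Y u(1)])
      fix x assume "x < len u"
      then obtain \<alpha> where a: "\<alpha> < \<delta>" "x < len (w \<alpha>)" using cof by blast
      have "u |` {..<len (w \<alpha>)} = w \<alpha>"
        using seq_le_iff[OF ctree_node(1)[OF rc wQ(2)[OF a(1)]] un(1)] wu[OF a(1)] by blast
      then show "\<exists>\<gamma>. x < \<gamma> \<and> \<gamma> \<le> len u \<and> u |` {..<\<gamma>} \<in> prune Y"
        using a(2) wl[OF a(1)] wQ(4)[OF a(1)] by (intro exI[of _ "len (w \<alpha>)"]) simp
    qed
    have "OSucc (prune Y) u = Y u" using OSucc_prune[OF Y up] uQ unfolding allowed_def by simp
    then have "splitting k (prune Y) \<delta> u"
      using u(3) Yc[OF uQ] ordLeq_transitive unfolding splitting_iff by metis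
    then show ?thesis using up u(2) by blast
  qed
  then have "prune Y \<in> scl_kind (\<lambda>_ _. True)"
    using pk unfolding scl_kind_def splitting_closed_def by simp
  moreover have "succ_drop p (prune Y)"
    unfolding succ_drop_def
  proof
    fix s assume s: "s \<in> Split (prune Y)"
    have sQ: "s \<in> Q" using Split_prune[OF Y s] .
    have "s \<in> prune Y" using s unfolding Split_def by blast
    then have O: "OSucc (prune Y) s = Y s" using OSucc_prune[OF Y] sQ unfolding allowed_def by simp
    define E where "E b a \<longleftrightarrow> a \<in> OSucc r s \<and> a < b \<and> (\<forall>c\<in>OSucc r s. \<not> (a < c \<and> c < b))" for b a
    define e where "e b = (SOME a. E b a)" for b
    have e: "E b (e b)" if "b \<in> Y s" for b
      using that someI_ex[of "E b"] unfolding Y_def succ_elems_def e_def E_def by blast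
    have "e b' < e b" if "b \<in> Y s" "b' \<in> Y s" "b' < b" for b b'
    proof -
      have "b' \<in> OSucc r s" using that(2) unfolding Y_def succ_elems_def by blast
      then have "\<not> e b < b'" using e[OF that(1)] that(3) unfolding E_def by blast
      then show ?thesis using e[OF that(2)] unfolding E_def by (meson leI less_le_trans)
    qed
    moreover have "e b \<in> OSucc p s" "e b < b" if "b \<in> Y s" for b
      using e[OF that] OSucc_mono[OF rp] unfolding E_def by blast+
    ultimately show "\<exists>e. \<forall>b\<in>OSucc (prune Y) s. e b \<in> OSucc p s \<and> e b < b \<and>
        (\<forall>b'\<in>OSucc (prune Y) s. b' < b \<longrightarrow> e b' < e b)"
      unfolding O by (intro exI[of _ e]) blast
  qed
  ultimately show ?thesis using ps by blast
qed

lemma succ_drop_chain: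
  assumes a: "\<And>n::nat. succ_drop (a n) (a (Suc n))" "\<And>n. s \<in> Split (a n)"
  shows "\<exists>n. b \<notin> OSucc (a n) s"
proof -
  have "\<exists>e. \<forall>b\<in>OSucc (a (Suc n)) s. e b \<in> OSucc (a n) s \<and> e b < b \<and>
     (\<forall>b'\<in>OSucc (a (Suc n)) s. b' < b \<longrightarrow> e b' < e b)" for n
    using a(1)[of n] a(2)[of "Suc n"] unfolding succ_drop_def by blast
  then have "\<exists>e. \<forall>n. \<forall>b\<in>OSucc (a (Suc n)) s. e n b \<in> OSucc (a n) s \<and> e n b < b \<and>
     (\<forall>b'\<in>OSucc (a (Suc n)) s. b' < b \<longrightarrow> e n b' < e n b)"
    by (rule choice[OF allI])
  then obtain e where e: "\<And>n b. b \<in> OSucc (a (Suc n)) s \<Longrightarrow> e n b \<in> OSucc (a n) s \<and> e n b < b \<and>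
     (\<forall>b'\<in>OSucc (a (Suc n)) s. b' < b \<longrightarrow> e n b' < e n b)" by blast
  have "wf {(x::'o, y). x < y}" by (rule wf)
  then show ?thesis
    by (rule no_regressive_chain[of _ "\<lambda>n. OSucc (a n) s" e]) (use e in blast)+
qed

text \<open>Along a branch of the pruned tree the levels of nodes in \<open>Q\<close> are unbounded
  by \<open>branch_Q\<close> and closed by \<open>Q_closed\<close>.\<close>

lemma scl_kind_club:
  assumes r: "r \<in> scl_kind (\<lambda>_ _. True)"
  shows "\<exists>C. club_in C lam \<and> C \<subseteq> len ` Split r"
proof -
  interpret pruning lam k r r by (rule pruning_scl_kind(1)[OF r])
  note rc = p and scl = pruning_scl_kind(2)[OF r]
  have Y: "OSucc r s \<noteq> {} \<and> OSucc r s \<subseteq> OSucc r s" if "s \<in> Q" for s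
    using OSucc_nonempty[OF rc] that Q_sub by blast
  have pc: "ctree (prune (OSucc r))" by (rule prune_ctree[OF Y])
  obtain t where t: "t \<in> prune (OSucc r)" using ctree_nonempty[OF pc] by blast
  obtain b where b: "dom b = {..<lam}" "\<And>\<beta>. \<beta> < lam \<Longrightarrow> b |` {..<\<beta>} \<in> prune (OSucc r)"
    by (rule branch[OF pc t]) (rule that)
  define C where "C = {\<beta>. \<beta> < lam \<and> b |` {..<\<beta>} \<in> Q}"
  have "d \<in> C" if d: "d < lam" "is_limit d" "\<forall>x<d. \<exists>y\<in>C. x < y \<and> y < d" for d
  proof -
    have l: "len (b |` {..<d}) = d" using branch_restrict(2)[OF b(1) d(1)] .
    have "b |` {..<d} \<in> Q"
    proof (rule Q_closed[OF scl refl])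
      show "b |` {..<d} \<in> r" using b(2)[OF d(1)] prune_sub[OF Y] by blast
      show "is_limit (len (b |` {..<d}))" using d(2) l by simp
      fix x assume "x < len (b |` {..<d})"
      then obtain y where y: "y \<in> C" "x < y" "y < d" using d(3) l by auto
      have ly: "len (b |` {..<y}) = y" "b |` {..<y} \<in> Q" using y(1) branch_restrict(2)[OF b(1)] unfolding C_def by blast+
      have "b |` {..<y} \<subseteq>\<^sub>m b |` {..<d}" using y(3) by (auto simp: map_le_def restrict_map_def)
      moreover have "b |` {..<y} \<noteq> b |` {..<d}" using ly(1) l y(3) by (metis less_irrefl)
      ultimately show "\<exists>v\<in>Q. v \<subseteq>\<^sub>m b |` {..<d} \<and> v \<noteq> b |` {..<d} \<and> x < len v"
        using ly y(2) by (intro bexI[of _ "b |` {..<y}"]) simp_all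
    qed
    then show ?thesis using d(1) unfolding C_def by blast
  qed
  moreover have "\<exists>y\<in>C. x \<le> y" if "x < lam" for x
    using branch_Q[OF Y b(1,2) that] unfolding C_def by blast
  ultimately have "club_in C lam" unfolding club_in_def C_def by auto
  moreover have "C \<subseteq> len ` Split r"
  proof
    fix \<beta> assume "\<beta> \<in> C"
    then have "\<beta> = len (b |` {..<\<beta>})" "b |` {..<\<beta>} \<in> Split r"
      using branch_restrict(2)[OF b(1)] Q_Split unfolding C_def by simp_all
    then show "\<beta> \<in> len ` Split r" by (rule image_eqI)
  qed
  ultimately show ?thesis by blast
qed

theorem scl_kind_adds:
  "adds_new_function (scl_kind (\<lambda>_ _. True)) (\<subseteq>) {..<lam} {0, 1 :: nat}"
proof (rule antichain_matrix[OF cone_closed_scl_kind, of _ succ_drop])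
  fix p r assume "r \<in> scl_kind (\<lambda>_ _. True)" "r \<subseteq> p"
  then show "\<exists>r'\<in>scl_kind (\<lambda>_ _. True). r' \<subseteq> r \<and> succ_drop p r'" by (rule succ_drop_dense)
next
  fix a :: "nat \<Rightarrow> _" and s t :: "'o node"
  assume a: "\<And>n. a n \<in> scl_kind (\<lambda>_ _. True)" "\<And>n. succ_drop (a n) (a (Suc n))" "\<And>n. s \<in> Split (a n)" "\<And>n. t \<in> a n"
    and st: "s \<subseteq>\<^sub>m t" "s \<noteq> t"
  have ac: "ctree (a n)" for n using a(1) unfolding scl_kind_def perfect_kind_def by blast
  have sa: "s \<in> a n" for n using a(3) unfolding Split_def by blast
  have "len s < len t"
    using initial_rel_len[of s t] ctree_node(1)[OF ac a(4)] ctree_node(1)[OF ac sa] st unfolding initial_rel_def by blast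
  \<comment> \<open>The value of \<open>t\<close> at \<open>s\<close> is a sibling present in every
    \<open>a n\<close>; its position cannot drop forever.\<close>
  then have "the (t (len s)) \<in> OSucc (a n) s" for n
    using OSuccI[OF ac a(4) st(1) ctree_node(1)[OF ac sa]] by blast
  then show False using succ_drop_chain[of a s, OF a(2,3)] by blast
next
  fix q and A :: "nat \<Rightarrow> 'o set"
  assume q: "q \<in> scl_kind (\<lambda>_ _. True)" and empty: "\<And>\<beta>. \<beta> < lam \<Longrightarrow> \<exists>n. \<beta> \<notin> A n"
    and dense: "\<And>n r. r \<in> scl_kind (\<lambda>_ _. True) \<Longrightarrow> r \<subseteq> q \<Longrightarrow>
      \<exists>r'\<in>scl_kind (\<lambda>_ _. True). r' \<subseteq> r \<and> (\<forall>s\<in>Split r'. len s \<in> A n)"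
  have "\<exists>C. club_in C lam \<and> C \<subseteq> A n" for n
  proof -
    obtain r' where r': "r' \<in> scl_kind (\<lambda>_ _. True)" "\<forall>s\<in>Split r'. len s \<in> A n" using dense[OF q] by blast
    obtain C where "club_in C lam" "C \<subseteq> len ` Split r'" using scl_kind_club[OF r'(1)] by blast
    then show ?thesis using r'(2) by blast
  qed
  then obtain C where C: "\<And>n. club_in (C n) lam" "\<And>n. C n \<subseteq> A n" by metis
  obtain \<beta> where "\<beta> < lam" "\<forall>n. \<beta> \<in> C n" using clubs_intersect[of C, OF C(1)] by blast
  then show False using empty C(2) by blast
qed

end

section \<open>A scale on a subsequence\<close>

text \<open>Replaces a family by one indexed by the values of \<open>V\<close>. In the applications
  these are sets of naturals, so that the new family has size at most the continuum and can be
  bounded.\<close>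

lemma representatives:
  assumes "x0 \<in> X"
  obtains r where "\<And>S. r S \<in> X" "\<And>x. x \<in> X \<Longrightarrow> V (r (V x)) = V x"
proof -
  have "\<exists>y. y \<in> X \<and> (\<forall>x\<in>X. V x = S \<longrightarrow> V y = S)" for S using assms by blast
  then obtain r where "\<And>S. r S \<in> X \<and> (\<forall>x\<in>X. V x = S \<longrightarrow> V (r S) = S)" by metis
  then show ?thesis using that[of r] by blast
qed

text \<open>A maximal chain of functions modulo finite is unbounded. Families of size continuum are
  bounded, so the chain has larger cofinality and the sets on which it exceeds a given function
  stabilise modulo finite. Among the limit sets there is a least one: on it the chain is a scale.\<close>

lemma scale_on_subsequence:
  fixes K :: "nat \<Rightarrow> 'o::wellorder"
  assumes reg: "\<And>n. regular_infinite_cardinal (K n)"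
    and big: "\<And>n. |UNIV :: nat set set| <o |{..<K n}|"
  obtains B F where "infinite B" "\<And>f n. f \<in> F \<Longrightarrow> f n < K n"
    "\<And>f g. f \<in> F \<Longrightarrow> g \<in> F \<Longrightarrow> finite {n. g n < f n} \<or> finite {n. f n < g n}"
    "\<And>g. \<forall>n. g n < K n \<Longrightarrow> \<exists>f\<in>F. finite {n \<in> B. f n \<le> g n}"
proof -
  define Fn where "Fn = {f. \<forall>n. f n < K n}"
  have bounded: "\<exists>h\<in>Fn. \<forall>S. \<forall>n. r S n < h n" if r: "\<And>S :: nat set. r S \<in> Fn" for r
  proof -
    have "\<exists>z<K n. \<forall>x\<in>range (\<lambda>S. r S n). x < z" for n
    proof (rule regular_bounded[OF reg])
      show "range (\<lambda>S. r S n) \<subseteq> {..<K n}" using r unfolding Fn_def by auto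
      show "|range (\<lambda>S. r S n)| <o |{..<K n}|" using ordLeq_ordLess_trans[OF card_of_image big] .
    qed
    then obtain h where "\<And>n. h n < K n \<and> (\<forall>x\<in>range (\<lambda>S. r S n). x < h n)" by metis
    then show ?thesis unfolding Fn_def by (intro bexI[of _ h]) auto
  qed
  define le where "le f g \<longleftrightarrow> finite {n. g n < f n}" for f g :: "nat \<Rightarrow> 'o"
  define \<C> where "\<C> = {F. F \<subseteq> Fn \<and> (\<forall>f\<in>F. \<forall>g\<in>F. le f g \<or> le g f)}"
  have "\<Union>C \<in> \<C>" if C: "subset.chain \<C> C" for C
  proof -
    have sub: "C \<subseteq> \<C>" and lin: "\<And>X Y. X \<in> C \<Longrightarrow> Y \<in> C \<Longrightarrow> X \<subseteq> Y \<or> Y \<subseteq> X"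
      using C unfolding subset.chain_def by blast+
    have "le f g \<or> le g f" if fg: "f \<in> \<Union>C" "g \<in> \<Union>C" for f g
    proof -
      obtain X Y where XY: "X \<in> C" "Y \<in> C" "f \<in> X" "g \<in> Y" using fg by blast
      then obtain Z where "Z \<in> C" "f \<in> Z" "g \<in> Z" using lin[of X Y] by blast
      then show ?thesis using sub unfolding \<C>_def by blast
    qed
    moreover have "\<Union>C \<subseteq> Fn" using sub unfolding \<C>_def by blast
    ultimately show ?thesis unfolding \<C>_def by blast
  qed
  from subset_Zorn'[of \<C>, OF this] obtain F
    where F: "F \<in> \<C>" and Fmax: "\<And>X. X \<in> \<C> \<Longrightarrow> F \<subseteq> X \<Longrightarrow> X = F" by blast
  have FFn: "F \<subseteq> Fn" and chain: "\<And>f g. f \<in> F \<Longrightarrow> g \<in> F \<Longrightarrow> le f g \<or> le g f"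
    using F unfolding \<C>_def by blast+
  have refl: "le f f" for f unfolding le_def by simp
  have unbounded: "\<exists>f\<in>F. \<not> le f h" if h: "h \<in> Fn" for h
  proof (rule ccontr)
    assume "\<not> ?thesis"
    then have hF: "le f h" if "f \<in> F" for f using that by blast
    \<comment> \<open>Raise \<open>h\<close> strictly everywhere: the result still extends the
      chain, so by maximality it belongs to \<open>F\<close>, yet it exceeds \<open>h\<close> at
      every argument.\<close>
    have "\<exists>y<K n. h n < y" for n using regular_limit[OF reg] h unfolding Fn_def by blast
    then obtain h' where h': "\<And>n. h' n < K n" "\<And>n. h n < h' n" by metis
    have lh: "le f h'" if "f \<in> F" for f
    proof -
      have "{n. h' n < f n} \<subseteq> {n. h n < f n}" using h'(2) less_trans by blast
      then show ?thesis using hF[OF that] finite_subset unfolding le_def by blast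
    qed
    have "insert h' F \<in> \<C>"
      unfolding \<C>_def
    proof (intro CollectI conjI ballI)
      show "insert h' F \<subseteq> Fn" using FFn h'(1) unfolding Fn_def by blast
      fix f g assume "f \<in> insert h' F" "g \<in> insert h' F"
      then show "le f g \<or> le g f" using lh refl chain by blast
    qed
    then have "h' \<in> F" using Fmax by blast
    then have "finite {n. h n < h' n}" using hF unfolding le_def by blast
    then show False using h'(2) by simp
  qed
  define U where "U f g = {n. g n < f n}" for f g :: "nat \<Rightarrow> 'o"
  have Umono: "finite (U f g - U f' g)" if "le f f'" for f f' g
  proof -
    have "U f g - U f' g \<subseteq> {n. f' n < f n}" unfolding U_def by force
    then show ?thesis using that finite_subset unfolding le_def by blast
  qed
  have Fne: "\<exists>f. f \<in> F"
  proof -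
    have "\<exists>x. x < K n" for n using infinite_imp_nonempty[OF regular_infinite[OF reg, of n]] by blast
    then obtain z where "\<And>n. z n < K n" by metis
    then have "z \<in> Fn" unfolding Fn_def by blast
    then show ?thesis using unbounded by blast
  qed
  have "\<exists>f0\<in>F. \<forall>f\<in>F. finite (U f g - U f0 g)" if g: "g \<in> Fn" for g
  proof -
    obtain f1 where f1: "f1 \<in> F" using Fne by blast
    obtain r where r: "\<And>S. r S \<in> F" "\<And>f. f \<in> F \<Longrightarrow> U (r (U f g)) g = U f g"
      by (rule representatives[OF f1, of "\<lambda>f. U f g"]) (rule that)
    obtain h where h: "h \<in> Fn" "\<And>S n. r S n < h n" using bounded[of r] r(1) FFn by blast
    \<comment> \<open>\<open>f0\<close> is not below \<open>h\<close> modulo finite, hence not below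
      any representative; as the chain is linear, it lies above all of them.\<close>
    obtain f0 where f0: "f0 \<in> F" "\<not> le f0 h" using unbounded[OF h(1)] by blast
    have "finite (U f g - U f0 g)" if f: "f \<in> F" for f
    proof -
      define f' where "f' = r (U f g)"
      have "\<not> le f0 f'"
      proof
        assume l: "le f0 f'"
        have "{n. h n < f0 n} \<subseteq> {n. f' n < f0 n}" using h(2) less_trans unfolding f'_def by blast
        then show False using f0(2) l finite_subset unfolding le_def by blast
      qed
      then have "le f' f0" using chain[OF f0(1), of f'] r(1) unfolding f'_def by blast
      then have "finite (U f' g - U f0 g)" by (rule Umono)
      then show ?thesis using r(2)[OF f] unfolding f'_def by simp
    qed
    then show ?thesis using f0(1) by blast
  qed
  then have "\<exists>f0. g \<in> Fn \<longrightarrow> f0 \<in> F \<and> (\<forall>f\<in>F. finite (U f g - U f0 g))" for g by blast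
  then obtain top where top: "\<And>g. g \<in> Fn \<Longrightarrow> top g \<in> F"
    "\<And>g f. g \<in> Fn \<Longrightarrow> f \<in> F \<Longrightarrow> finite (U f g - U (top g) g)" by metis
  \<comment> \<open>The stable set, modulo finite, on which the chain exceeds \<open>g\<close>. It
    shrinks modulo finite when \<open>g\<close> grows.\<close>
  define V where "V g = U (top g) g" for g
  have Vinf: "infinite (V g)" if g: "g \<in> Fn" for g
  proof
    assume "finite (V g)"
    then have "finite (U f g)" if "f \<in> F" for f using top(2)[OF g that] unfolding V_def by (metis finite_Diff2)
    then show False using unbounded[OF g] unfolding le_def U_def by blast
  qed
  obtain f1 where f1: "f1 \<in> F" using Fne by blast
  then have "f1 \<in> Fn" using FFn by blast
  then obtain r where r: "\<And>S. r S \<in> Fn" "\<And>g. g \<in> Fn \<Longrightarrow> V (r (V g)) = V g"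
    by (rule representatives[of _ _ V]) (rule that)
  obtain g0 where g0: "g0 \<in> Fn" "\<And>S n. r S n < g0 n" using bounded[of r] r(1) by blast
  have dom: "\<exists>f\<in>F. finite {n \<in> V g0. f n \<le> g n}" if "\<forall>n. g n < K n" for g
  proof -
    have g: "g \<in> Fn" using that unfolding Fn_def by blast
    define g' where "g' = r (V g)"
    have g': "g' \<in> Fn" "V g' = V g" unfolding g'_def using r g by blast+
    \<comment> \<open>\<open>g0\<close> exceeds every representative, so where \<open>top g0\<close>
      exceeds \<open>g0\<close> it also exceeds \<open>g'\<close>. Hence \<open>V g0\<close> is
      almost contained in \<open>V g'\<close>, which equals \<open>V g\<close>: this makes
      \<open>V g0\<close> the least stable set.\<close>
    have "V g0 \<subseteq> U (top g0) g'" unfolding V_def U_def g'_def using g0(2) less_trans by blast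
    then have "V g0 - V g' \<subseteq> U (top g0) g' - U (top g') g'" unfolding V_def by blast
    then have "finite (V g0 - V g)"
      using top(2)[OF g'(1) top(1)[OF g0(1)]] finite_subset g'(2) by metis
    moreover have "{n \<in> V g0. top g n \<le> g n} \<subseteq> V g0 - V g" unfolding V_def[of g] U_def by auto
    ultimately show ?thesis using top(1)[OF g] finite_subset by blast
  qed
  show ?thesis
    using that[of "V g0" F, OF Vinf[OF g0(1)]] FFn chain dom unfolding Fn_def le_def by blast
qed

lemma infinite_split:
  assumes "infinite (B :: nat set)"
  obtains A where "A \<subseteq> B" "infinite A" "infinite (B - A)"
proof -
  obtain e :: "nat \<Rightarrow> nat" where inj: "inj e" and rng: "range e \<subseteq> B"
    using infinite_countable_subset[OF assms] by blast
  then have eB: "e n \<in> B" for n by blast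
  have inf: "infinite (range (\<lambda>n. e (h n)))" if "inj h" for h :: "nat \<Rightarrow> nat"
  proof
    assume "finite (range (\<lambda>n. e (h n)))"
    moreover have "inj (\<lambda>n. e (h n))" using inj that unfolding inj_def by blast
    ultimately show False using finite_imageD by blast
  qed
  define A where "A = range (\<lambda>n. e (2 * n))"
  have "infinite A" unfolding A_def by (rule inf) (simp add: inj_def)
  moreover have "range (\<lambda>n. e (2 * n + 1)) \<subseteq> B - A"
  proof
    fix x assume "x \<in> range (\<lambda>n. e (2 * n + 1))"
    then obtain n where n: "x = e (2 * n + 1)" by blast
    have "x \<notin> A"
    proof
      assume "x \<in> A"
      then obtain m where "e (2 * n + 1) = e (2 * m)" unfolding A_def n by blast
      then have "2 * n + 1 = 2 * m" using inj unfolding inj_def by blast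
      then show False by presburger
    qed
    then show "x \<in> B - A" using n eB by blast
  qed
  moreover have "infinite (range (\<lambda>n. e (2 * n + 1)))" by (rule inf) (simp add: inj_def)
  ultimately have "infinite (B - A)" using finite_subset by blast
  then show ?thesis using that[of A] \<open>infinite A\<close> eB unfolding A_def by blast
qed

section \<open>Laver tree forcings\<close>

context cardinal_tower begin

definition laver_kind :: "('o \<Rightarrow> 'o set \<Rightarrow> bool) \<Rightarrow> 'o node set set" where
  "laver_kind \<Theta> = {p. ctree p \<and>
     (\<exists>s. laver_stem lam k p s \<and> (\<forall>t\<in>p. s \<subseteq>\<^sub>m t \<longrightarrow> \<Theta> (len t) (OSucc p t)))}"

lemma cone_closed_laver_kind: "cone_closed (laver_kind \<Theta>)"
  unfolding cone_closed_def
proof (intro ballI conjI)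
  fix p assume p: "p \<in> laver_kind \<Theta>"
  show pc: "ctree p" using p unfolding laver_kind_def by blast
  fix t assume t: "t \<in> p"
  obtain s where s: "s \<in> p" "\<And>u. u \<in> p \<Longrightarrow> s \<subseteq>\<^sub>m u \<or> u \<subseteq>\<^sub>m s"
    "\<And>u. u \<in> p \<Longrightarrow> s \<subseteq>\<^sub>m u \<Longrightarrow> |Succ p u| =o |{..<k (len u)}|"
    "\<And>u. u \<in> p \<Longrightarrow> s \<subseteq>\<^sub>m u \<Longrightarrow> \<Theta> (len u) (OSucc p u)"
    using p unfolding laver_kind_def laver_stem_def by blast
  show "cone p t \<in> laver_kind \<Theta>"
  proof (cases "s \<subseteq>\<^sub>m t")
    case True
    have O: "OSucc (cone p t) u = OSucc p u" "u \<in> p" "s \<subseteq>\<^sub>m u" if u: "u \<in> cone p t" "t \<subseteq>\<^sub>m u" for u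
    proof -
      show up: "u \<in> p" using u(1) cone_subset by blast
      show "OSucc (cone p t) u = OSucc p u" using OSucc_cone[OF pc up u(2)] .
      show "s \<subseteq>\<^sub>m u" using map_le_trans[OF True u(2)] .
    qed
    have "laver_stem lam k (cone p t) t"
      unfolding laver_stem_def
    proof (intro conjI ballI impI)
      show "t \<in> cone p t" using t unfolding cone_def by simp
      show "t \<subseteq>\<^sub>m u \<or> u \<subseteq>\<^sub>m t" if "u \<in> cone p t" for u using that unfolding cone_def by blast
      show "|Succ (cone p t) u| =o |{..<k (len u)}|" if u: "u \<in> cone p t" "t \<subseteq>\<^sub>m u" for u
        using s(3)[OF O(2,3)[OF u]] O(1)[OF u] unfolding Succ_eq by simp
    qed
    moreover have "\<Theta> (len u) (OSucc (cone p t) u)" if u: "u \<in> cone p t" "t \<subseteq>\<^sub>m u" for u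
      using s(4)[OF O(2,3)[OF u]] O(1)[OF u] by simp
    ultimately show ?thesis using ctree_cone[OF pc t] unfolding laver_kind_def by blast
  next
    case False
    then have ts: "t \<subseteq>\<^sub>m s" using s(2)[OF t] by blast
    have "u \<subseteq>\<^sub>m t \<or> t \<subseteq>\<^sub>m u" if u: "u \<in> p" for u
    proof (cases "s \<subseteq>\<^sub>m u")
      case True
      then show ?thesis using map_le_trans[OF ts] by blast
    next
      case False
      then have us: "u \<subseteq>\<^sub>m s" using s(2)[OF u] by blast
      note n = ctree_node(1)[OF pc]
      show ?thesis
        using seq_le_comparable[OF n[OF u] n[OF t] n[OF s(1)] us ts]
          seq_le_comparable[OF n[OF t] n[OF u] n[OF s(1)] ts us] linear by blast
    qed
    then have "cone p t = p" unfolding cone_def by blast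
    then show ?thesis using p by simp
  qed
qed

text \<open>The ordinal \<gamma> + n; \<open>limit_after\<close> is then \<gamma> +
  \<omega>.\<close>

definition nth_next :: "'o \<Rightarrow> nat \<Rightarrow> 'o" where
  "nth_next \<gamma> n = (next_ord ^^ n) \<gamma>"

definition limit_after :: "'o \<Rightarrow> 'o" where
  "limit_after \<gamma> = (LEAST z. \<forall>n. nth_next \<gamma> n < z)"

lemma nth_next_Suc: "nth_next \<gamma> (Suc n) = next_ord (nth_next \<gamma> n)"
  unfolding nth_next_def by simp

lemma nth_next_lam: "\<gamma> < lam \<Longrightarrow> nth_next \<gamma> n < lam"
  by (induction n) (auto simp: nth_next_def next_ord_lam)

lemma nth_next_ge: "\<gamma> < lam \<Longrightarrow> \<gamma> \<le> nth_next \<gamma> n"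
proof (induction n)
  case (Suc n)
  then show ?case using lam_next[OF nth_next_lam[OF Suc.prems]] unfolding nth_next_Suc
    by (meson le_less_trans less_imp_le)
qed (simp add: nth_next_def)

definition large :: "'o \<Rightarrow> bool" where
  "large \<gamma> \<longleftrightarrow> \<gamma> < lam \<and> |UNIV :: nat set set| <o |{..<k \<gamma>}|"

lemma large_mono: "large \<gamma> \<Longrightarrow> \<gamma> \<le> \<gamma>' \<Longrightarrow> \<gamma>' < lam \<Longrightarrow> large \<gamma>'"
  unfolding large_def
  using ordLess_ordLeq_trans[OF _ card_of_mono1[of "{..<k \<gamma>}" "{..<k \<gamma>'}"]] k_mono_le[of \<gamma> \<gamma>'] by auto

text \<open>\<open>F\<close> is linearly ordered modulo finite on all of the naturals but dominates
  on \<open>B\<close> only; \<open>A\<close> and \<open>B - A\<close> are the two patterns to be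
  told apart.\<close>

definition is_scale :: "'o \<Rightarrow> nat set \<Rightarrow> nat set \<Rightarrow> (nat \<Rightarrow> 'o) set \<Rightarrow> bool" where
  "is_scale \<gamma> B A F \<longleftrightarrow> A \<subseteq> B \<and> infinite A \<and> infinite (B - A) \<and> (\<forall>f\<in>F. \<forall>n. f n < k (nth_next \<gamma> n)) \<and>
     (\<forall>f\<in>F. \<forall>g\<in>F. finite {n. g n < f n} \<or> finite {n. f n < g n}) \<and>
     (\<forall>g. (\<forall>n. g n < k (nth_next \<gamma> n)) \<longrightarrow> (\<exists>f\<in>F. finite {n \<in> B. f n \<le> g n}))"

lemma is_scale_exists:
  assumes "large \<gamma>" shows "\<exists>B A F. is_scale \<gamma> B A F"
proof -
  have l: "\<gamma> < lam" using assms unfolding large_def by blast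
  have n: "nth_next \<gamma> n < lam" "large (nth_next \<gamma> n)" for n
    using nth_next_lam[OF l] large_mono[OF assms nth_next_ge[OF l]] by blast+
  have n2: "|UNIV :: nat set set| <o |{..<k (nth_next \<gamma> n)}|" for n using n(2)[of n] unfolding large_def by blast
  obtain B F where BF: "infinite B" "\<And>f n. f \<in> F \<Longrightarrow> f n < k (nth_next \<gamma> n)"
    "\<And>f g. f \<in> F \<Longrightarrow> g \<in> F \<Longrightarrow> finite {n. g n < f n} \<or> finite {n. f n < g n}"
    "\<And>g. \<forall>n. g n < k (nth_next \<gamma> n) \<Longrightarrow> \<exists>f\<in>F. finite {n \<in> B. f n \<le> g n}"
    by (rule scale_on_subsequence[of "\<lambda>n. k (nth_next \<gamma> n)", OF k_regular[OF n(1)] n2]) (rule that)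
  obtain A where "A \<subseteq> B" "infinite A" "infinite (B - A)" using infinite_split[OF BF(1)] by blast
  then have "is_scale \<gamma> B A F" unfolding is_scale_def using BF(2-4) by simp
  then show ?thesis by blast
qed

definition above :: "'o \<Rightarrow> nat set \<Rightarrow> (nat \<Rightarrow> 'o) \<Rightarrow> 'o node \<Rightarrow> nat set" where
  "above \<gamma> B f x = {n \<in> B. f n \<le> the (x (nth_next \<gamma> n))}"

text \<open>Each step multiplies by at most \<open>k (nth_next \<gamma> n)\<close>, which stays
  below the next cardinal. Therefore one bound can serve for a successor of every node of the
  level.\<close>

lemma laver_level_card:
  assumes p: "ctree p" and s: "s \<in> p" "len s = \<gamma>"
  shows "|{t \<in> p. s \<subseteq>\<^sub>m t \<and> len t = nth_next \<gamma> n}| <o |{..<k (nth_next \<gamma> n)}|"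
proof -
  have \<gamma>: "\<gamma> < lam" using ctree_node(2)[OF p s(1)] s(2) by simp
  note nl = nth_next_lam[OF \<gamma>]
  show ?thesis
  proof (induction n)
    case 0
    have "{t \<in> p. s \<subseteq>\<^sub>m t \<and> len t = nth_next \<gamma> 0} \<subseteq> {s}"
    proof
      fix t assume t: "t \<in> {t \<in> p. s \<subseteq>\<^sub>m t \<and> len t = nth_next \<gamma> 0}"
      then have "len t \<le> len s" "t \<in> p" "s \<subseteq>\<^sub>m t" using s(2) unfolding nth_next_def by auto
      then show "t \<in> {s}" using seq_le_eq[OF ctree_node(1)[OF p s(1)] ctree_node(1)[OF p]] by blast
    qed
    then have "finite {t \<in> p. s \<subseteq>\<^sub>m t \<and> len t = nth_next \<gamma> 0}" using finite_subset by blast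
    then show ?case using card_of_finite_less k_infinite[OF nl] by blast
  next
    case (Suc n)
    let ?L = "\<lambda>n. {t \<in> p. s \<subseteq>\<^sub>m t \<and> len t = nth_next \<gamma> n}"
    let ?f = "\<lambda>(t, b). t(nth_next \<gamma> n \<mapsto> b)"
    have "?L (Suc n) \<subseteq> ?f ` (?L n \<times> {..<k (nth_next \<gamma> n)})"
    proof
      fix t assume "t \<in> ?L (Suc n)"
      then have t: "t \<in> p" "s \<subseteq>\<^sub>m t" "len t = nth_next \<gamma> (Suc n)" by blast+
      note tn = ctree_node[OF p t(1)]
      define u where "u = t |` {..<nth_next \<gamma> n}"
      have lt: "nth_next \<gamma> n < len t" using t(3) lam_next[OF nl] unfolding nth_next_Suc by simp
      have u: "is_seq u" "len u = nth_next \<gamma> n" "u \<subseteq>\<^sub>m t" "u \<in> p"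
        using seq_restrict[OF tn(1) less_imp_le[OF lt]] ctree_restrict[OF p t(1)] unfolding u_def by blast+
      have "s \<subseteq>\<^sub>m u" using seq_le_comparable[OF ctree_node(1)[OF p s(1)] u(1) tn(1) t(2) u(3)] nth_next_ge[OF \<gamma>] s(2) u(2) by simp
      then have uL: "u \<in> ?L n" using u by blast
      obtain b where b: "b < k (nth_next \<gamma> n)" "t (nth_next \<gamma> n) = Some b" using tn(3)[OF lt] by blast
      have ul: "len u < lam" using u(2) nl by simp
      have ap: "is_seq (u(len u \<mapsto> b))" "len (u(len u \<mapsto> b)) = len t"
        using seq_append[OF u(1) ul] t(3) u(2) nth_next_Suc by simp_all
      have "u(len u \<mapsto> b) \<subseteq>\<^sub>m t" using seq_append_le[OF u(1) tn(1) u(3)] lt b(2) u(2) by simp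
      then have "u(len u \<mapsto> b) = t" using seq_le_eq[OF ap(1) tn(1)] ap(2) by simp
      then have "t = ?f (u, b)" using u(2) by simp
      then show "t \<in> ?f ` (?L n \<times> {..<k (nth_next \<gamma> n)})" using uL b(1) by blast
    qed
    then have 1: "|?L (Suc n)| \<le>o |?L n \<times> {..<k (nth_next \<gamma> n)}|"
      using card_of_mono1 card_of_image ordLeq_transitive by blast
    have "|?L n \<times> {..<k (nth_next \<gamma> n)}| \<le>o |{..<k (nth_next \<gamma> n)}|"
    proof (rule card_of_Times_ordLeq_infinite_Field)
      show "infinite (Field |{..<k (nth_next \<gamma> n)}| )" using k_infinite[OF nl] unfolding Field_card_of .
      show "|?L n| \<le>o |{..<k (nth_next \<gamma> n)}|" by (rule ordLess_imp_ordLeq[OF Suc])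
      show "|{..<k (nth_next \<gamma> n)}| \<le>o |{..<k (nth_next \<gamma> n)}|" by (rule card_of_mono1) simp
      show "Card_order |{..<k (nth_next \<gamma> n)}|" by (rule card_of_Card_order)
    qed
    moreover have "|{..<k (nth_next \<gamma> n)}| <o |{..<k (nth_next \<gamma> (Suc n))}|"
    proof (rule card_lessThan_less)
      show "Card_order (ord_rel (k (nth_next \<gamma> (Suc n))))"
        using k_regular[OF nl] unfolding regular_infinite_cardinal_def by blast
      show "k (nth_next \<gamma> n) < k (nth_next \<gamma> (Suc n))" unfolding nth_next_Suc
        using k_mono[OF lam_next[OF nl] next_ord_lam[OF nl]] .
    qed
    ultimately show ?case using 1 ordLeq_transitive ordLeq_ordLess_trans by blast
  qed
qed

text \<open>Any pattern \<open>A\<close> can be realised against \<open>f\<close>: large successor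
  sets are unbounded and so reach \<open>f n\<close> where this is wanted, while elsewhere a value
  below \<open>g n\<close> can be chosen, which is below \<open>f n\<close> for all but finitely
  many n in \<open>B\<close>.\<close>

lemma laver_branch:
  assumes p: "ctree p" and s: "s \<in> p" "len s = \<gamma>"
    and full: "\<And>t. t \<in> p \<Longrightarrow> s \<subseteq>\<^sub>m t \<Longrightarrow> |{..<k (len t)}| \<le>o |OSucc p t|"
    and f: "\<And>n. f n < k (nth_next \<gamma> n)"
    and g: "\<And>n t. t \<in> p \<Longrightarrow> s \<subseteq>\<^sub>m t \<Longrightarrow> len t = nth_next \<gamma> n \<Longrightarrow> \<exists>b\<in>OSucc p t. b < g n"
    and fg: "finite {n \<in> B. f n \<le> g n}" and A: "A \<subseteq> B"
  shows "\<exists>u\<in>p. len u = limit_after \<gamma> \<and> A \<subseteq> above \<gamma> B f u \<and> finite (above \<gamma> B f u - A)"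
proof -
  have \<gamma>: "\<gamma> < lam" using ctree_node(2)[OF p s(1)] s(2) by simp
  note nl = nth_next_lam[OF \<gamma>]
  \<comment> \<open>The last clause is conditional because at the finitely many n with
    \<open>f n \<le> g n\<close> nothing is promised; these are the only errors.\<close>
  define ok where "ok n t b \<longleftrightarrow> b \<in> OSucc p t \<and> (n \<in> A \<longrightarrow> f n \<le> b) \<and> (n \<in> B - A \<and> g n < f n \<longrightarrow> b < f n)" for n t b
  have ex: "\<exists>b. ok n t b" if t: "t \<in> p" "s \<subseteq>\<^sub>m t" "len t = nth_next \<gamma> n" for n t
  proof (cases "n \<in> A")
    case True
    have "OSucc p t \<subseteq> {..<k (len t)}" using OSucc_less[OF p t(1)] by blast
    then obtain b where "b \<in> OSucc p t" "f n \<le> b"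
      using regular_card_unbounded[OF k_regular _ full[OF t(1,2)]] ctree_node(2)[OF p t(1)] f[of n] t(3) by metis
    then show ?thesis using True unfolding ok_def by blast
  next
    case False
    obtain b where "b \<in> OSucc p t" "b < g n" using g[OF t] by blast
    then show ?thesis using False less_trans unfolding ok_def by blast
  qed
  define T where "T = rec_nat s (\<lambda>n t. t(nth_next \<gamma> n \<mapsto> (SOME b. ok n t b)))"
  have T: "T 0 = s" "T (Suc n) = (T n)(nth_next \<gamma> n \<mapsto> (SOME b. ok n (T n) b))" for n unfolding T_def by simp_all
  have inv: "T n \<in> p \<and> s \<subseteq>\<^sub>m T n \<and> len (T n) = nth_next \<gamma> n" for n
  proof (induction n)
    case 0
    then show ?case using s T by (simp add: nth_next_def)
  next
    case (Suc n)
    then have t: "T n \<in> p" "s \<subseteq>\<^sub>m T n" "len (T n) = nth_next \<gamma> n" by blast+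
    note ap = seq_append[OF ctree_node(1,2)[OF p t(1)], of "SOME b. ok n (T n) b"]
    have "ok n (T n) (SOME b. ok n (T n) b)" using someI_ex[OF ex[OF t]] .
    then have "T (Suc n) \<in> p" unfolding T(2) ok_def OSucc_def t(3) by blast
    moreover have "s \<subseteq>\<^sub>m T (Suc n)" using map_le_trans[OF t(2) ap(3)] unfolding T(2) t(3) .
    moreover have "len (T (Suc n)) = nth_next \<gamma> (Suc n)" using ap(2) unfolding T(2) t(3) nth_next_Suc .
    ultimately show ?case by blast
  qed
  have Tp: "T n \<in> p" and Tl: "len (T n) = nth_next \<gamma> n" for n using inv by blast+
  have okT: "ok n (T n) (the (T (Suc n) (nth_next \<gamma> n)))" for n
    using someI_ex[OF ex] inv[of n] unfolding T(2) by simp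
  have lt: "nth_next \<gamma> n < nth_next \<gamma> (Suc n)" for n unfolding nth_next_Suc using lam_next[OF nl] .
  have Ti: "T n \<subseteq>\<^sub>m T (Suc n)" for n
    using seq_append(3)[OF ctree_node(1,2)[OF p Tp]] unfolding T(2) Tl .
  have Tn: "T n \<noteq> T (Suc n)" for n using lt[of n] Tl by (metis less_irrefl)
  obtain u where u: "u \<in> p" "\<And>n. T n \<subseteq>\<^sub>m u" "len u = limit_after \<gamma>"
    using ctree_chain[of p T, OF p Tp Ti Tn] unfolding Tl limit_after_def by blast
  have ok: "ok n (T n) (the (u (nth_next \<gamma> n)))" for n
    using okT[of n] seq_le_value[OF u(2) ctree_node(1)[OF p Tp], of "nth_next \<gamma> n" "Suc n"] lt[of n] Tl[of "Suc n"] by simp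
  have "A \<subseteq> above \<gamma> B f u" using ok A unfolding above_def ok_def by blast
  moreover have "above \<gamma> B f u - A \<subseteq> {n \<in> B. f n \<le> g n}"
  proof
    fix n assume n: "n \<in> above \<gamma> B f u - A"
    then have "n \<in> B - A" "f n \<le> the (u (nth_next \<gamma> n))" unfolding above_def by blast+
    then have "\<not> g n < f n" using ok[of n] leD unfolding ok_def by blast
    then show "n \<in> {n \<in> B. f n \<le> g n}" using \<open>n \<in> B - A\<close> by (simp add: not_less)
  qed
  then have "finite (above \<gamma> B f u - A)" using fg finite_subset by blast
  ultimately show ?thesis using u(1,3) by blast
qed

theorem laver_kind_adds:
  "adds_new_function (laver_kind \<Theta>) (\<subseteq>) {..<lam} {0, 1 :: nat}"
proof -
  \<comment> \<open>Fixed once for each \<open>\<gamma>\<close>, before any condition is given; only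
    the member \<open>f\<close> of the scale depends on the condition.\<close>
  obtain B A F where BAF: "\<And>\<gamma>. large \<gamma> \<Longrightarrow> is_scale \<gamma> (B \<gamma>) (A \<gamma>) (F \<gamma>)"
    using is_scale_exists by metis
  define c where "c \<gamma> x \<longleftrightarrow> (\<exists>f\<in>F \<gamma>. finite (above \<gamma> (B \<gamma>) f x - A \<gamma>) \<and> finite (A \<gamma> - above \<gamma> (B \<gamma>) f x))" for \<gamma> x
  show ?thesis
  proof (rule level_colouring[OF cone_closed_laver_kind, of _ limit_after c])
    fix p assume p: "p \<in> laver_kind \<Theta>"
    have pc: "ctree p" using p unfolding laver_kind_def by blast
    obtain s0 where s0: "s0 \<in> p" "\<And>u. u \<in> p \<Longrightarrow> s0 \<subseteq>\<^sub>m u \<Longrightarrow> |Succ p u| =o |{..<k (len u)}|"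
      using p unfolding laver_kind_def laver_stem_def by blast
    obtain \<gamma>0 where \<gamma>0: "large \<gamma>0" using continuum_less_k unfolding large_def by blast
    \<comment> \<open>Beyond the stem, so that all nodes split fully, and beyond the point where the
      cardinals exceed the continuum.\<close>
    define \<gamma> where "\<gamma> = max (len s0) \<gamma>0"
    have \<gamma>: "\<gamma> < lam" "len s0 \<le> \<gamma>" using ctree_node(2)[OF pc s0(1)] \<gamma>0 unfolding \<gamma>_def large_def by simp_all
    have L: "large \<gamma>" using large_mono[OF \<gamma>0 _ \<gamma>(1)] unfolding \<gamma>_def by simp
    obtain s where s: "s \<in> p" "s0 \<subseteq>\<^sub>m s" "len s = \<gamma>" using extend_len[OF pc s0(1) \<gamma>] by blast
    have full: "|{..<k (len t)}| \<le>o |OSucc p t|" if t: "t \<in> p" "s \<subseteq>\<^sub>m t" for t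
    proof -
      have "|Succ p t| =o |{..<k (len t)}|" using s0(2)[OF t(1) map_le_trans[OF s(2) t(2)]] .
      then have "|{..<k (len t)}| =o |OSucc p t|" using card_Succ[of p t] ordIso_symmetric ordIso_transitive by blast
      then show ?thesis by (rule ordIso_imp_ordLeq)
    qed
    \<comment> \<open>The level has fewer nodes than the regular cardinal
      \<open>k (nth_next \<gamma> n)\<close>, so one \<open>z\<close> bounds a chosen successor of
      each of them.\<close>
    have "\<exists>z<k (nth_next \<gamma> n). \<forall>t\<in>{t \<in> p. s \<subseteq>\<^sub>m t \<and> len t = nth_next \<gamma> n}. \<exists>b\<in>OSucc p t. b < z" for n
    proof -
      let ?L = "{t \<in> p. s \<subseteq>\<^sub>m t \<and> len t = nth_next \<gamma> n}"
      define m where "m t = (SOME b. b \<in> OSucc p t)" for t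
      have m: "m t \<in> OSucc p t" if "t \<in> p" for t unfolding m_def using OSucc_nonempty[OF pc that] some_in_eq by blast
      have "m ` ?L \<subseteq> {..<k (nth_next \<gamma> n)}"
      proof (rule image_subsetI)
        fix t assume t: "t \<in> ?L"
        then have "m t < k (len t)" using OSucc_less[OF pc _ m] by blast
        then show "m t \<in> {..<k (nth_next \<gamma> n)}" using t by simp
      qed
      moreover have "|m ` ?L| <o |{..<k (nth_next \<gamma> n)}|"
        using ordLeq_ordLess_trans[OF card_of_image laver_level_card[OF pc s(1,3)]] .
      ultimately obtain z where "z < k (nth_next \<gamma> n)" "\<forall>x\<in>m ` ?L. x < z"
        using regular_bounded[OF k_regular[OF nth_next_lam[OF \<gamma>(1)]]] by blast
      then show ?thesis using m by blast
    qed
    then obtain g where g: "\<And>n. g n < k (nth_next \<gamma> n)"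
      "\<And>n t. t \<in> p \<Longrightarrow> s \<subseteq>\<^sub>m t \<Longrightarrow> len t = nth_next \<gamma> n \<Longrightarrow> \<exists>b\<in>OSucc p t. b < g n" by (metis (lifting) mem_Collect_eq)
    note S = BAF[OF L, unfolded is_scale_def]
    have AB: "A \<gamma> \<subseteq> B \<gamma>" "infinite (A \<gamma>)" "infinite (B \<gamma> - A \<gamma>)" using S by blast+
    have chain: "finite {n. f' n < f n} \<or> finite {n. f n < f' n}" if "f \<in> F \<gamma>" "f' \<in> F \<gamma>" for f f' using S that by blast
    obtain f where f: "f \<in> F \<gamma>" "finite {n \<in> B \<gamma>. f n \<le> g n}" using S g(1) by blast
    have fk: "f n < k (nth_next \<gamma> n)" for n using S f(1) by blast
    have br: "\<exists>u\<in>p. len u = limit_after \<gamma> \<and> X \<subseteq> above \<gamma> (B \<gamma>) f u \<and> finite (above \<gamma> (B \<gamma>) f u - X)"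
      if "X \<subseteq> B \<gamma>" for X
      by (rule laver_branch[OF pc s(1,3) full fk g(2) f(2) that])
    obtain u where u: "u \<in> p" "len u = limit_after \<gamma>" "A \<gamma> \<subseteq> above \<gamma> (B \<gamma>) f u" "finite (above \<gamma> (B \<gamma>) f u - A \<gamma>)"
      using br[OF AB(1)] by blast
    obtain v where v: "v \<in> p" "len v = limit_after \<gamma>" "B \<gamma> - A \<gamma> \<subseteq> above \<gamma> (B \<gamma>) f v"
      "finite (above \<gamma> (B \<gamma>) f v - (B \<gamma> - A \<gamma>))"
      using br[of "B \<gamma> - A \<gamma>"] by blast
    have "finite (A \<gamma> - above \<gamma> (B \<gamma>) f u)" using u(3) by (metis Diff_eq_empty_iff finite.emptyI)
    then have "c \<gamma> u" unfolding c_def using f(1) u(4) by blast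
    moreover have "\<not> c \<gamma> v"
    proof
      assume "c \<gamma> v"
      then obtain f' where f': "f' \<in> F \<gamma>" "finite (above \<gamma> (B \<gamma>) f' v - A \<gamma>)" "finite (A \<gamma> - above \<gamma> (B \<gamma>) f' v)"
        unfolding c_def by blast
      \<comment> \<open>If \<open>f\<close> is below \<open>f'\<close> modulo finite, then
        \<open>f'\<close> cuts out of \<open>v\<close> almost a subset of \<open>B - A\<close> and
        so misses almost all of \<open>A\<close>. If \<open>f'\<close> is below \<open>f\<close>, it
        cuts out almost all of \<open>B - A\<close>. Neither agrees with \<open>A\<close> modulo
        finite.\<close>
      from chain[OF f(1) f'(1)] show False
      proof
        assume fin: "finite {n. f' n < f n}"
        have "A \<gamma> \<subseteq> (A \<gamma> - above \<gamma> (B \<gamma>) f' v) \<union> {n. f' n < f n} \<union> (above \<gamma> (B \<gamma>) f v - (B \<gamma> - A \<gamma>))"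
          unfolding above_def by force
        then show False using AB(2) fin f'(3) v(4) finite_subset by (metis finite_Un)
      next
        assume fin: "finite {n. f n < f' n}"
        have "B \<gamma> - A \<gamma> \<subseteq> (above \<gamma> (B \<gamma>) f' v - A \<gamma>) \<union> {n. f n < f' n}"
          using v(3) unfolding above_def by force
        then show False using AB(3) fin f'(2) finite_subset by (metis finite_Un)
      qed
    qed
    ultimately show "\<exists>\<gamma><lam. \<exists>t\<in>p. \<exists>u\<in>p. len t = limit_after \<gamma> \<and> len u = limit_after \<gamma> \<and> c \<gamma> t \<and> \<not> c \<gamma> u"
      using \<gamma>(1) u(1,2) v(1,2) by blast
  qed
qed

end

section \<open>Clubs and cofinalities\<close>

lemma stationary_unbounded:
  assumes S: "stationary_in S m" and x: "x < m" shows "\<exists>y\<in>S. x \<le> y"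
proof -
  have "club_in {y. x \<le> y \<and> y < m} m"
    unfolding club_in_def
  proof (intro conjI allI impI)
    show "\<exists>y\<in>{y. x \<le> y \<and> y < m}. z \<le> y" if "z < m" for z
      using that x by (intro bexI[of _ "max x z"]) auto
    fix d assume d: "d < m" "is_limit d \<and> (\<forall>z<d. \<exists>y\<in>{y. x \<le> y \<and> y < m}. z < y \<and> y < d)"
    then obtain y where "x \<le> y" "y < d" unfolding is_limit_def by blast
    then show "d \<in> {y. x \<le> y \<and> y < m}" using d(1) by auto
  qed auto
  then show ?thesis using S unfolding stationary_in_def by blast
qed

context cardinal_tower begin

lemma finite_below_omega: "c < omega \<Longrightarrow> finite {..<c::'o}"
  using not_less_Least[of c "\<lambda>b. infinite {..<b}"] unfolding omega_def by blast

lemma nat_inj_omega: obtains i :: "nat \<Rightarrow> 'o" where "inj i" "\<And>n. i n < omega"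
  using infinite_omega infinite_countable_subset[of "{..<omega::'o}"] that by blast

lemma cf_omegaI:
  fixes b :: 'o
  assumes lim: "is_limit b" and g: "\<And>n::nat. g n < b" "\<And>x. x < b \<Longrightarrow> \<exists>n. x < g n"
  shows "cf b = omega"
  unfolding cf_def
proof (rule Least_equality)
  obtain i :: "nat \<Rightarrow> 'o" where i: "inj i" "\<And>n. i n < omega" using nat_inj_omega by blast
  have "\<exists>y. y < omega \<and> x \<le> g (inv i y)" if x: "x < b" for x
  proof -
    obtain n where "x < g n" using g(2)[OF x] by blast
    then show ?thesis using i inv_f_f[OF i(1), of n] by (intro exI[of _ "i n"]) (simp add: less_imp_le)
  qed
  then show "\<exists>f. f ` {..<omega::'o} \<subseteq> {..<b} \<and> (\<forall>x<b. \<exists>y. y < omega \<and> x \<le> f y)"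
    using g(1) by (intro exI[of _ "\<lambda>y. g (inv i y)"]) auto
next
  fix c :: 'o assume "\<exists>f. f ` {..<c} \<subseteq> {..<b} \<and> (\<forall>x<b. \<exists>y<c. x \<le> f y)"
  then obtain f where f: "f ` {..<c} \<subseteq> {..<b}" "\<And>x. x < b \<Longrightarrow> \<exists>y<c. x \<le> f y" by blast
  show "omega \<le> c"
  proof (rule ccontr)
    assume "\<not> omega \<le> c"
    then have fin: "finite (f ` {..<c})" using finite_below_omega by simp
    obtain x where "x < b" using lim unfolding is_limit_def by blast
    then have ne: "f ` {..<c} \<noteq> {}" using f(2) by fastforce
    have "Max (f ` {..<c}) < b" using Max_in[OF fin ne] f(1) by blast
    then obtain y where y: "y < b" "Max (f ` {..<c}) < y" using lim unfolding is_limit_def by blast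
    then obtain z where "z < c" "y \<le> f z" using f(2) by blast
    then show False using Max_ge[OF fin, of "f z"] y(2) by (meson imageI lessThan_iff leD less_le_trans)
  qed
qed

lemma omega_less_card:
  assumes "regular_infinite_cardinal m" "omega < m" shows "|UNIV :: nat set| <o |{..<m::'o}|"
proof -
  have "|UNIV :: nat set| \<le>o |{..<omega::'o}|" using infinite_omega infinite_iff_card_of_nat by blast
  moreover have "|{..<omega::'o}| <o |{..<m}|"
    using card_lessThan_less assms unfolding regular_infinite_cardinal_def by blast
  ultimately show ?thesis by (rule ordLeq_ordLess_trans)
qed

lemma club_cf_omega:
  fixes m :: 'o
  assumes m: "regular_infinite_cardinal m" "omega < m" and C: "club_in C m"
  shows "\<exists>b\<in>C. cf b = omega"
proof -
  have Cm: "C \<subseteq> {..<m}" using C unfolding club_in_def by blast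
  have ex: "\<exists>y\<in>C. x < y" if "x < m" for x
    using regular_limit[OF m(1) that] C unfolding club_in_def by (meson less_le_trans)
  define h where "h x = (SOME y. y \<in> C \<and> x < y)" for x
  have h: "h x \<in> C \<and> x < h x" if "x < m" for x
    unfolding h_def using someI_ex[of "\<lambda>y. y \<in> C \<and> x < y"] ex[OF that] by blast
  define g where "g = rec_nat (h omega) (\<lambda>_ x. h x)"
  have g: "g 0 = h omega" "g (Suc n) = h (g n)" for n unfolding g_def by simp_all
  have gC: "g n \<in> C" for n
  proof (induction n)
    case (Suc n)
    then show ?case using h Cm unfolding g by blast
  qed (use g h m in simp)
  have gm: "g n < m" for n using gC Cm by blast
  have inc: "g n < g (Suc n)" for n using h[OF gm] unfolding g by blast
  have "|range g| <o |{..<m}|" using ordLeq_ordLess_trans[OF card_of_image omega_less_card[OF m]] .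
  then obtain z where z: "z < m" "\<forall>n. g n < z" using regular_bounded[OF m(1), of "range g"] gm by auto
  define d where "d = (LEAST z. \<forall>n. g n < z)"
  note sup = increasing_seq_sup[of g, OF z(2) inc, folded d_def]
  have "d < m" using sup(1) z(1) by (rule le_less_trans)
  moreover have "\<exists>y\<in>C. x < y \<and> y < d" if "x < d" for x using sup(4)[OF that] sup(2) gC by blast
  ultimately have "d \<in> C" using C sup(3) unfolding club_in_def by blast
  then show ?thesis using cf_omegaI[OF sup(3), of g] sup(2,4) by blast
qed

text \<open>The supremum of a strictly increasing sequence of length \<open>lam\<close> in the club
  has cofinality \<open>lam\<close>: a cofinal map from \<open>omega\<close> would give a countable
  unbounded subset of \<open>lam\<close>.\<close>

lemma club_cf_not_omega:
  fixes m :: 'o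
  assumes m: "regular_infinite_cardinal m" "lam < m" and C: "club_in C m"
  shows "\<exists>b\<in>C. cf b \<noteq> omega"
proof -
  have Cm: "C \<subseteq> {..<m}" using C unfolding club_in_def by blast
  have Co: "Card_order (ord_rel m)" using m(1) unfolding regular_infinite_cardinal_def by blast
  \<comment> \<open>The least point of the club beyond all earlier choices; regularity of
    \<open>m\<close> above \<open>lam\<close> keeps the recursion going for \<open>lam\<close>
    steps.\<close>
  define H where "H c i = (LEAST x. x \<in> C \<and> (\<forall>j<i. c j < x))" for c :: "'o \<Rightarrow> 'o" and i :: 'o
  have "wf {(x::'o, y). x < y}" by (rule wf)
  from wf_recursion[OF this, of H] obtain c where c0: "\<And>i. c i = H (cut c {(x, y). x < y} i) i" by blast
  have c: "c i = (LEAST x. x \<in> C \<and> (\<forall>j<i. c j < x))" for i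
  proof -
    have "H (cut c {(x, y). x < y} i) i = H c i" unfolding H_def by (rule arg_cong[of _ _ Least]) (auto simp: cut_def)
    then show ?thesis using c0[of i] unfolding H_def by simp
  qed
  have bound: "\<exists>z<m. \<forall>j<i. c j < z" if i: "i \<le> lam" and C: "\<And>j. j < i \<Longrightarrow> c j \<in> C" for i
  proof -
    have "|c ` {..<i}| <o |{..<m}|"
      using ordLeq_ordLess_trans[OF card_of_image card_lessThan_less[OF Co le_less_trans[OF i m(2)]]] .
    moreover have "c ` {..<i} \<subseteq> {..<m}" using C Cm by blast
    ultimately show ?thesis using regular_bounded[OF m(1), of "c ` {..<i}"] by auto
  qed
  have cC: "c i \<in> C \<and> (\<forall>j<i. c j < c i)" if "i < lam" for i
    using that
  proof (induction i rule: less_induct)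
    case (less i)
    then have "c j \<in> C" if "j < i" for j using that less_trans by blast
    then obtain z where z: "z < m" "\<forall>j<i. c j < z" using bound[of i] less.prems less_imp_le by blast
    then obtain x where "x \<in> C" "z \<le> x" using C unfolding club_in_def by blast
    then have "x \<in> C \<and> (\<forall>j<i. c j < x)" using z(2) less_le_trans by blast
    from LeastI[of "\<lambda>x. x \<in> C \<and> (\<forall>j<i. c j < x)", OF this] show ?case unfolding c[of i] by blast
  qed
  obtain z where z: "z < m" "\<forall>j<lam. c j < z" using bound[of lam] cC by blast
  define d where "d = (LEAST z. \<forall>j<lam. c j < z)"
  have "d \<le> z" unfolding d_def using z(2) by (rule Least_le)
  then have dm: "d < m" using z(1) by (rule le_less_trans)
  have cd: "c j < d" if "j < lam" for j
    using LeastI[of "\<lambda>z. \<forall>j<lam. c j < z", OF z(2)] that unfolding d_def by blast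
  have ex: "\<exists>j<lam. x \<le> c j" if "x < d" for x
    using not_less_Least[of x "\<lambda>z. \<forall>j<lam. c j < z"] that unfolding d_def by (auto simp: not_less)
  have ex': "\<exists>y\<in>C. x < y \<and> y < d" if x: "x < d" for x
  proof -
    obtain j where j: "j < lam" "x \<le> c j" using ex[OF x] by blast
    have n: "next_ord j < lam" "j < next_ord j" using next_ord_lam[OF j(1)] lam_next[OF j(1)] by blast+
    have "c j < c (next_ord j)" using cC[OF n(1)] n(2) by blast
    then show ?thesis using j(2) cC[OF n(1)] cd[OF n(1)] le_less_trans by blast
  qed
  have lim: "is_limit d" unfolding is_limit_def using ex' cd omega_lam by blast
  have dC: "d \<in> C" using C dm lim ex' unfolding club_in_def by blast
  have "cf d \<noteq> omega"
  proof
    assume "cf d = omega"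
    moreover have "\<exists>f. f ` {..<cf d} \<subseteq> {..<d} \<and> (\<forall>x<d. \<exists>y<cf d. x \<le> f y)"
      unfolding cf_def
      by (rule LeastI[of "\<lambda>b. \<exists>f. f ` {..<b} \<subseteq> {..<d} \<and> (\<forall>x<d. \<exists>y<b. x \<le> f y)" d])
        (intro exI[of _ id], auto)
    ultimately have "\<exists>f::'o \<Rightarrow> 'o. f ` {..<omega} \<subseteq> {..<d} \<and> (\<forall>x<d. \<exists>y. y < omega \<and> x \<le> f y)" by simp
    then obtain f :: "'o \<Rightarrow> 'o" where f: "f ` {..<omega} \<subseteq> {..<d}" "\<And>x. x < d \<Longrightarrow> \<exists>y. y < omega \<and> x \<le> f y"
      by blast
    have "\<exists>j. j < lam \<and> (y < omega \<longrightarrow> f y \<le> c j)" for y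
      using ex[of "f y"] f(1) omega_lam by (cases "y < omega") auto
    then obtain h where h: "\<And>y. h y < lam" "\<And>y. y < omega \<Longrightarrow> f y \<le> c (h y)" by metis
    have "h ` {..<omega} \<subseteq> {..<lam}" using h(1) by blast
    from lam_regular[OF omega_lam this] obtain z1 where z1: "z1 < lam" "\<forall>y. y < omega \<longrightarrow> h y < z1" by blast
    obtain y where y: "y < omega" "c z1 \<le> f y" using f(2)[OF cd[OF z1(1)]] by blast
    have "c (h y) < c z1" using cC[OF z1(1)] z1(2) y(1) by blast
    then show False using h(2)[OF y(1)] y(2) by (meson leD order_trans)
  qed
  then show ?thesis using dC by blast
qed

definition stat_kind :: "'o \<Rightarrow> 'o set \<Rightarrow> bool" where
  "stat_kind l X \<longleftrightarrow> X \<subseteq> {\<beta>. \<beta> < k l \<and> cf \<beta> = omega} \<and> stationary_in X (k l)"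

definition club_kind :: "'o \<Rightarrow> 'o set \<Rightarrow> bool" where
  "club_kind l X \<longleftrightarrow> (\<exists>C. club_in C (k l) \<and> C \<subseteq> X)"

text \<open>The successor elements of a set containing a club need not contain one, so the sibling
  argument breaks down. But a club successor set at a level with \<open>lam < k \<beta>\<close>
  leaves the cofinality of the next value open; level \<open>next_ord \<gamma>\<close> is where the
  value at \<open>\<gamma>\<close> becomes visible.\<close>

theorem scl_club_kind_adds:
  "adds_new_function (scl_kind club_kind) (\<subseteq>) {..<lam} {0, 1 :: nat}"
proof (rule level_colouring[OF cone_closed_scl_kind, of _ next_ord "\<lambda>\<gamma> t. cf (the (t \<gamma>)) = omega"])
  fix q assume q: "q \<in> scl_kind club_kind"
  then have qc: "ctree q" and qk: "q \<in> perfect_kind club_kind" unfolding scl_kind_def perfect_kind_def by blast+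
  obtain \<beta> where \<beta>: "\<beta> < lam" "lam < k \<beta>" using lam_less_k by blast
  obtain u where u: "u \<in> q" "len u = \<beta>" using ctree_has_len[OF qc \<beta>(1)] by blast
  obtain s where s: "s \<in> q" "u \<subseteq>\<^sub>m s" "club_kind (len s) (OSucc q s)"
    using qk u(1) omega_lam unfolding perfect_kind_def by blast
  note sn = ctree_node[OF qc s(1)]
  have "\<beta> \<le> len s" using seq_le_iff[OF ctree_node(1)[OF qc u(1)] sn(1)] s(2) u(2) by blast
  then have lk: "lam < k (len s)" using k_mono_le[OF _ sn(2)] \<beta>(2) less_le_trans by blast
  note kr = k_regular[OF sn(2)]
  obtain C where C: "club_in C (k (len s))" "C \<subseteq> OSucc q s" using s(3) unfolding club_kind_def by blast
  obtain b where b: "b \<in> C" "cf b = omega" using club_cf_omega[OF kr less_trans[OF omega_lam lk] C(1)] by blast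
  obtain b' where b': "b' \<in> C" "cf b' \<noteq> omega" using club_cf_not_omega[OF kr lk C(1)] by blast
  have "s(len s \<mapsto> b) \<in> q" "s(len s \<mapsto> b') \<in> q" using b(1) b'(1) C(2) unfolding OSucc_def by blast+
  then show "\<exists>\<gamma><lam. \<exists>t\<in>q. \<exists>u\<in>q. len t = next_ord \<gamma> \<and> len u = next_ord \<gamma> \<and>
      cf (the (t \<gamma>)) = omega \<and> cf (the (u \<gamma>)) \<noteq> omega"
    using sn(2) seq_append(2)[OF sn(1,2)] b(2) b'(2)
    by (intro exI[of _ "len s"] conjI bexI[of _ "s(len s \<mapsto> b)"] bexI[of _ "s(len s \<mapsto> b')"]) simp_all
qed

section \<open>The forcings of the theorem\<close>

lemma stat_kind_card: "l < lam \<Longrightarrow> stat_kind l X \<Longrightarrow> |{..<k l}| \<le>o |X|"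
  using regular_unbounded_card[OF k_regular, of l X] stationary_unbounded[of X "k l"]
    ordIso_imp_ordLeq[OF ordIso_symmetric] unfolding stat_kind_def by blast

lemma club_kind_card:
  assumes l: "l < lam" and X: "club_kind l X" shows "|{..<k l}| \<le>o |X|"
proof -
  obtain C where C: "club_in C (k l)" "C \<subseteq> X" using X unfolding club_kind_def by blast
  have "|C| =o |{..<k l}|"
    using regular_unbounded_card[OF k_regular[OF l], of C] C(1) unfolding club_in_def by blast
  then have "|{..<k l}| \<le>o |C|" by (rule ordIso_imp_ordLeq[OF ordIso_symmetric])
  then show ?thesis using card_of_mono1[OF C(2)] by (rule ordLeq_transitive)
qed

text \<open>To find a node of kind \<open>\<Theta>\<close> with splitting of degree
  \<open>\<alpha>\<close>, first extend to length at least \<open>\<alpha>\<close>: at length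
  \<open>l\<close> a set of kind \<open>\<Theta>\<close> has size at least
  \<open>k l\<close>.\<close>

lemma perfect_kind_eq:
  assumes card: "\<And>l X. l < lam \<Longrightarrow> \<Theta> l X \<Longrightarrow> |{..<k l}| \<le>o |X|"
  shows "{p. perfect_tree lam k p \<and> (\<forall>s\<in>p. \<exists>t\<in>p. s \<subseteq>\<^sub>m t \<and> \<Theta> (len t) (OSucc p t))} = perfect_kind \<Theta>"
proof (intro set_eqI iffI)
  fix p assume "p \<in> {p. perfect_tree lam k p \<and> (\<forall>s\<in>p. \<exists>t\<in>p. s \<subseteq>\<^sub>m t \<and> \<Theta> (len t) (OSucc p t))}"
  then have pc: "ctree p" and ex: "\<And>s. s \<in> p \<Longrightarrow> \<exists>t\<in>p. s \<subseteq>\<^sub>m t \<and> \<Theta> (len t) (OSucc p t)"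
    unfolding perfect_tree_def ctree_def by blast+
  have "\<exists>s\<in>p. t \<subseteq>\<^sub>m s \<and> \<Theta> (len s) (OSucc p s) \<and> splitting k p \<alpha> s" if t: "t \<in> p" "\<alpha> < lam" for t \<alpha>
  proof -
    have "max \<alpha> (len t) < lam" "len t \<le> max \<alpha> (len t)" using t(2) ctree_node(2)[OF pc t(1)] by simp_all
    then obtain u where u: "u \<in> p" "t \<subseteq>\<^sub>m u" "len u = max \<alpha> (len t)" using extend_len[OF pc t(1)] by blast
    obtain s where s: "s \<in> p" "u \<subseteq>\<^sub>m s" "\<Theta> (len s) (OSucc p s)" using ex[OF u(1)] by blast
    note sn = ctree_node[OF pc s(1)]
    have "len u \<le> len s" using seq_le_iff[OF ctree_node(1)[OF pc u(1)] sn(1)] s(2) by blast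
    then have "\<alpha> \<le> len s" using u(3) by simp
    moreover have "splitting k p (len s) s" unfolding splitting_iff using card[OF sn(2) s(3)] .
    ultimately have "splitting k p \<alpha> s" using splitting_mono sn(2) by blast
    then show ?thesis using s(1,3) map_le_trans[OF u(2) s(2)] by blast
  qed
  then show "p \<in> perfect_kind \<Theta>" using pc unfolding perfect_kind_def by blast
next
  fix p assume p: "p \<in> perfect_kind \<Theta>"
  then have "perfect_tree lam k p"
    unfolding perfect_kind_def perfect_tree_def ctree_def ever_branching_def by blast
  moreover have "\<exists>t\<in>p. s \<subseteq>\<^sub>m t \<and> \<Theta> (len t) (OSucc p t)" if "s \<in> p" for s
    using p that omega_lam unfolding perfect_kind_def by blast
  ultimately show "p \<in> {p. perfect_tree lam k p \<and> (\<forall>s\<in>p. \<exists>t\<in>p. s \<subseteq>\<^sub>m t \<and> \<Theta> (len t) (OSucc p t))}" by blast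
qed

lemma MM_eq: "MM lam k = perfect_kind (\<lambda>_ _. True)"
  unfolding MM_def perfect_kind_def perfect_tree_def ctree_def ever_branching_def by auto

lemma MM_stat_eq: "MM_stat lam k = perfect_kind stat_kind"
  using perfect_kind_eq[of stat_kind, OF stat_kind_card]
  unfolding MM_stat_def stat_branching_def stat_kind_def by simp

lemma MM_club_eq: "MM_club lam k = perfect_kind club_kind"
  using perfect_kind_eq[of club_kind, OF club_kind_card]
  unfolding MM_club_def club_branching_def club_kind_def by simp

lemma scl_MM_eq: "scl_MM lam k = scl_kind (\<lambda>_ _. True)"
  unfolding scl_MM_def scl_kind_def MM_eq by simp

lemma scl_MM_club_eq: "scl_MM_club lam k = scl_kind club_kind"
  unfolding scl_MM_club_def scl_kind_def MM_club_eq club_branching_def club_kind_def by simp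

lemma LL_eq: "LL lam k = laver_kind (\<lambda>_ _. True)"
  unfolding LL_def laver_kind_def ctree_def by simp

lemma LL_stat_eq: "LL_stat lam k = laver_kind stat_kind"
  unfolding LL_stat_def laver_kind_def ctree_def stat_branching_def stat_kind_def by simp

lemma LL_club_eq: "LL_club lam k = laver_kind club_kind"
  unfolding LL_club_def laver_kind_def ctree_def club_branching_def club_kind_def by simp

section \<open>Non-emptiness of the forcings\<close>

definition product_tree :: "('o \<Rightarrow> 'o set) \<Rightarrow> 'o node set" where
  "product_tree S = {t. is_seq t \<and> len t < lam \<and> (\<forall>\<beta><len t. the (t \<beta>) \<in> S \<beta>)}"

context
  fixes S :: "'o \<Rightarrow> 'o set"
  assumes S: "\<And>\<beta>. \<beta> < lam \<Longrightarrow> S \<beta> \<noteq> {} \<and> S \<beta> \<subseteq> {..<k \<beta>}"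
begin

lemma OSucc_product_tree:
  assumes "t \<in> product_tree S" shows "OSucc (product_tree S) t = S (len t)"
proof -
  have t: "is_seq t" "len t < lam" "\<And>\<beta>. \<beta> < len t \<Longrightarrow> the (t \<beta>) \<in> S \<beta>"
    using assms unfolding product_tree_def by blast+
  have "t(len t \<mapsto> b) \<in> product_tree S \<longleftrightarrow> b \<in> S (len t)" for b
  proof -
    note a = seq_append[OF t(1,2), of b]
    have "\<beta> < len (t(len t \<mapsto> b)) \<longleftrightarrow> \<beta> < len t \<or> \<beta> = len t" for \<beta>
      unfolding a(2) using next_ord(3)[OF t(2)] by (auto simp: le_less)
    moreover have "len (t(len t \<mapsto> b)) < lam" unfolding a(2) using next_ord_lam[OF t(2)] .
    ultimately show ?thesis using a(1) t(3) unfolding product_tree_def by auto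
  qed
  then show ?thesis unfolding OSucc_def by blast
qed

lemma product_tree_ctree: "ctree (product_tree S)"
  unfolding ctree_def
proof
  obtain z :: 'o where z: "\<And>x. \<not> x < z" using least_ord by blast
  then have d: "dom (Map.empty :: 'o node) = {..<z}" by auto
  have "z < lam" using z omega_lam by (meson leI le_less_trans)
  then have "Map.empty \<in> product_tree S" using is_seqI[OF d] len_eq[OF d] z unfolding product_tree_def by auto
  moreover have "product_tree S \<subseteq> nodes lam k"
  proof
    fix t assume "t \<in> product_tree S"
    then have t: "is_seq t" "len t < lam" "\<And>\<beta>. \<beta> < len t \<Longrightarrow> the (t \<beta>) \<in> S \<beta>" unfolding product_tree_def by blast+
    have "the (t \<beta>) < k \<beta>" if b: "\<beta> < len t" for \<beta>
    proof -
      have "\<beta> < lam" using b t(2) by (rule less_trans)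
      then show ?thesis using t(3)[OF b] S by blast
    qed
    then show "t \<in> nodes lam k" unfolding nodes_def using t(2) dom_seq[OF t(1)] by blast
  qed
  moreover have "s \<in> product_tree S" if t: "t \<in> product_tree S" and s: "s \<in> nodes lam k" "s \<subseteq>\<^sub>m t" for s t
  proof -
    have ss: "is_seq s" "len s < lam" using s(1) is_seqI len_eq unfolding nodes_def by blast+
    have "len s \<le> len t" using seq_le_iff[OF ss(1)] t s(2) unfolding product_tree_def by blast
    moreover have "the (s \<beta>) = the (t \<beta>)" if "\<beta> < len s" for \<beta> using seq_le_value[OF s(2) ss(1) that] by simp
    ultimately show ?thesis using t ss less_le_trans unfolding product_tree_def by auto
  qed
  ultimately show "is_tree lam k (product_tree S)" unfolding is_tree_def by blast
  have 1: "\<exists>u\<in>product_tree S. t \<subseteq>\<^sub>m u \<and> t \<noteq> u" if t: "t \<in> product_tree S" for t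
  proof -
    have tn: "is_seq t" "len t < lam" using t unfolding product_tree_def by blast+
    obtain b where "b \<in> S (len t)" using S[OF tn(2)] by blast
    then have "t(len t \<mapsto> b) \<in> product_tree S" using OSucc_product_tree[OF t] unfolding OSucc_def by blast
    moreover have "len (t(len t \<mapsto> b)) \<noteq> len t" using seq_append(2)[OF tn] lam_next[OF tn(2)] by auto
    ultimately show ?thesis using seq_append(3)[OF tn, of b] by metis
  qed
  have 2: "f \<in> product_tree S"
    if f: "\<delta> < lam" "is_limit \<delta>" "dom f = {..<\<delta>}" "\<forall>\<beta><\<delta>. f |` {..<\<beta>} \<in> product_tree S" for \<delta> f
  proof -
    note fs = is_seqI[OF f(3)] len_eq[OF f(3)]
    have "the (f \<beta>) \<in> S \<beta>" if b: "\<beta> < \<delta>" for \<beta>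
    proof -
      obtain \<gamma> where g: "\<beta> < \<gamma>" "\<gamma> < \<delta>" using f(2) b unfolding is_limit_def by blast
      have "len (f |` {..<\<gamma>}) = \<gamma>" using seq_restrict(2)[OF fs(1)] fs(2) g(2) by simp
      then have "the ((f |` {..<\<gamma>}) \<beta>) \<in> S \<beta>" using f(4) g unfolding product_tree_def by auto
      then show ?thesis using g(1) by simp
    qed
    then show ?thesis using f(1) fs unfolding product_tree_def by simp
  qed
  show "lt_closed lam (product_tree S)" unfolding lt_closed_def using 1 2 by blast
qed

text \<open>One-point factors below \<open>\<gamma>\<close> leave a single node of length
  \<open>\<gamma>\<close>, which serves as the stem of the Laver tree.\<close>

lemma product_tree_kinds:
  assumes \<gamma>: "\<gamma> < lam" and small: "\<And>\<beta>. \<beta> < \<gamma> \<Longrightarrow> \<exists>b. S \<beta> = {b}"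
    and full: "\<And>\<beta>. \<gamma> \<le> \<beta> \<Longrightarrow> \<beta> < lam \<Longrightarrow> \<Theta> \<beta> (S \<beta>) \<and> |{..<k \<beta>}| \<le>o |S \<beta>|"
  shows "product_tree S \<in> perfect_kind \<Theta>" "product_tree S \<in> laver_kind \<Theta>"
proof -
  let ?T = "product_tree S"
  note Tc = product_tree_ctree and O = OSucc_product_tree
  have "\<exists>s\<in>?T. t \<subseteq>\<^sub>m s \<and> \<Theta> (len s) (OSucc ?T s) \<and> splitting k ?T \<alpha> s" if t: "t \<in> ?T" "\<alpha> < lam" for t \<alpha>
  proof -
    define l where "l = max (max \<alpha> \<gamma>) (len t)"
    have l: "l < lam" "len t \<le> l" "\<gamma> \<le> l" "\<alpha> \<le> l" using t(2) \<gamma> ctree_node(2)[OF Tc t(1)] unfolding l_def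
      by (simp_all add: le_max_iff_disj)
    obtain s where s: "s \<in> ?T" "t \<subseteq>\<^sub>m s" "len s = l" using extend_len[OF Tc t(1) l(1,2)] by blast
    have "splitting k ?T l s" unfolding splitting_iff O[OF s(1)] s(3) using full[OF l(3,1)] by blast
    then have "splitting k ?T \<alpha> s" using splitting_mono[OF _ l(4,1)] by blast
    then show ?thesis using s full[OF l(3,1)] O[OF s(1)] by auto
  qed
  then show "?T \<in> perfect_kind \<Theta>" using Tc unfolding perfect_kind_def by blast
  obtain s where s: "s \<in> ?T" "len s = \<gamma>" using ctree_has_len[OF Tc \<gamma>] by blast
  note sn = ctree_node[OF Tc s(1)]
  have eq: "t \<beta> = u \<beta>" if tu: "t \<in> ?T" "u \<in> ?T" "\<beta> < len t" "\<beta> < len u" "\<beta> < \<gamma>" for t u \<beta>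
  proof -
    obtain b where b: "S \<beta> = {b}" using small[OF tu(5)] by blast
    have "the (t \<beta>) = b" "the (u \<beta>) = b" using tu(1-4) b unfolding product_tree_def by auto
    then show ?thesis using ctree_node(3)[OF Tc tu(1,3)] ctree_node(3)[OF Tc tu(2,4)] by auto
  qed
  have comp: "s \<subseteq>\<^sub>m t \<or> t \<subseteq>\<^sub>m s" if t: "t \<in> ?T" for t
  proof (cases "\<gamma> \<le> len t")
    case True
    have "s \<subseteq>\<^sub>m t" unfolding map_le_def
    proof
      fix x assume "x \<in> dom s"
      then have "x < len s" using dom_seq[OF sn(1)] by simp
      then show "s x = t x" using eq[OF s(1) t] s(2) True less_le_trans by blast
    qed
    then show ?thesis by blast
  next
    case False
    have "t \<subseteq>\<^sub>m s" unfolding map_le_def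
    proof
      fix x assume "x \<in> dom t"
      then have x: "x < len t" using dom_seq[OF ctree_node(1)[OF Tc t]] by simp
      then have "x < \<gamma>" using False by simp
      then show "t x = s x" using eq[OF t s(1) x] s(2) by simp
    qed
    then show ?thesis by blast
  qed
  have len: "\<gamma> \<le> len t" if "t \<in> ?T" "s \<subseteq>\<^sub>m t" for t
    using seq_le_iff[OF sn(1) ctree_node(1)[OF Tc that(1)]] that(2) s(2) by blast
  have "|Succ ?T t| =o |{..<k (len t)}|" if t: "t \<in> ?T" "s \<subseteq>\<^sub>m t" for t
  proof -
    note tl = ctree_node(2)[OF Tc t(1)]
    have "|S (len t)| \<le>o |{..<k (len t)}|" using S[OF tl] card_of_mono1 by blast
    moreover have "|{..<k (len t)}| \<le>o |S (len t)|" using full[OF len[OF t] tl] by blast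
    ultimately have "|OSucc ?T t| =o |{..<k (len t)}|" unfolding O[OF t(1)] by (simp add: ordIso_iff_ordLeq)
    then show ?thesis using card_Succ ordIso_transitive by blast
  qed
  then have "laver_stem lam k ?T s" unfolding laver_stem_def using s(1) comp by blast
  moreover have "\<Theta> (len t) (OSucc ?T t)" if t: "t \<in> ?T" "s \<subseteq>\<^sub>m t" for t
    using full[OF len[OF t] ctree_node(2)[OF Tc t(1)]] O[OF t(1)] by simp
  ultimately show "?T \<in> laver_kind \<Theta>" using Tc unfolding laver_kind_def by blast
qed

lemma product_tree_scl_kind:
  assumes full: "\<And>\<beta>. \<beta> < lam \<Longrightarrow> \<Theta> \<beta> (S \<beta>) \<and> |{..<k \<beta>}| \<le>o |S \<beta>|"
  shows "product_tree S \<in> scl_kind \<Theta>"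
proof -
  let ?T = "product_tree S"
  note Tc = product_tree_ctree and O = OSucc_product_tree
  obtain z :: 'o where z: "\<And>x. \<not> x < z" using least_ord by blast
  have "z < lam" using z omega_lam by (meson leI le_less_trans)
  then have "?T \<in> perfect_kind \<Theta>" using product_tree_kinds(1)[of z] z full by blast
  moreover have "\<exists>u\<in>?T. Map.graph u = (\<Union>\<alpha>\<in>{..<\<delta>}. Map.graph (w \<alpha>)) \<and> splitting k ?T \<delta> u \<and> \<Theta> (len u) (OSucc ?T u)"
    if \<delta>: "\<delta> < lam" "is_limit \<delta>" and wT: "\<forall>\<alpha><\<delta>. w \<alpha> \<in> ?T"
      and inc: "\<forall>\<alpha> \<beta>. \<alpha> < \<beta> \<and> \<beta> < \<delta> \<longrightarrow> w \<alpha> \<subseteq>\<^sub>m w \<beta> \<and> w \<alpha> \<noteq> w \<beta>" for \<delta> w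
  proof -
    have wn: "is_seq (w \<alpha>)" "len (w \<alpha>) < lam" "w \<alpha> \<in> ?T" if "\<alpha> < \<delta>" for \<alpha>
      using wT that ctree_node[OF Tc] by blast+
    have len_inc: "len (w \<alpha>) < len (w \<beta>)" if "\<alpha> < \<beta>" "\<beta> < \<delta>" for \<alpha> \<beta>
    proof (rule initial_rel_len)
      have "\<alpha> < \<delta>" using that by (rule less_trans)
      then show "(w \<alpha>, w \<beta>) \<in> initial_rel" unfolding initial_rel_def using inc that wn(1) by blast
    qed
    \<comment> \<open>Strictly increasing lengths are at least their indices, so the union has
      length \<open>d\<close> with \<open>\<delta> \<le> d\<close>, and its full splitting of degree
      \<open>d\<close> covers the required degree \<open>\<delta>\<close>.\<close>
    have ge: "\<alpha> \<le> len (w \<alpha>)" if "\<alpha> < \<delta>" for \<alpha>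
      using that
    proof (induction \<alpha> rule: less_induct)
      case (less \<alpha>)
      show ?case
      proof (rule ccontr)
        assume "\<not> \<alpha> \<le> len (w \<alpha>)"
        then have l: "len (w \<alpha>) < \<alpha>" by simp
        then have "len (w \<alpha>) \<le> len (w (len (w \<alpha>)))" using less less_trans by blast
        then show False using len_inc[OF l less.prems] by simp
      qed
    qed
    have "(\<lambda>\<alpha>. len (w \<alpha>)) ` {..<\<delta>} \<subseteq> {..<lam}" using wn(2) by blast
    from lam_regular[OF \<delta>(1) this] obtain y where y: "y < lam" "\<forall>\<alpha><\<delta>. len (w \<alpha>) < y" by blast
    define d where "d = (LEAST y. \<forall>\<alpha><\<delta>. len (w \<alpha>) < y)"
    have "d \<le> y" unfolding d_def using y(2) by (rule Least_le)
    then have dl: "d < lam" using y(1) by (rule le_less_trans)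
    have wd: "len (w \<alpha>) < d" if "\<alpha> < \<delta>" for \<alpha>
      using LeastI[of "\<lambda>y. \<forall>\<alpha><\<delta>. len (w \<alpha>) < y", OF y(2)] that unfolding d_def by blast
    have ex: "\<exists>\<alpha><\<delta>. x < len (w \<alpha>)" if x: "x < d" for x
    proof -
      obtain \<alpha> where a: "\<alpha> < \<delta>" "x \<le> len (w \<alpha>)"
        using not_less_Least[of x "\<lambda>y. \<forall>\<alpha><\<delta>. len (w \<alpha>) < y"] x unfolding d_def by (auto simp: not_less)
      obtain \<beta> where "\<alpha> < \<beta>" "\<beta> < \<delta>" using \<delta>(2) a(1) unfolding is_limit_def by blast
      then show ?thesis using len_inc[of \<alpha> \<beta>] a(2) le_less_trans by blast
    qed
    obtain u where dom: "dom u = {..<d}" and u: "\<And>\<alpha> x. \<alpha> \<in> {..<\<delta>} \<Longrightarrow> x < len (w \<alpha>) \<Longrightarrow> u x = w \<alpha> x"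
    proof (rule increasing_union[of "{..<\<delta>}" w d])
      show "\<exists>\<alpha>\<in>{..<\<delta>}. x < len (w \<alpha>)" if "x < d" for x using ex[OF that] by blast
    qed (use wn(1) wd inc that in auto)
    note us = is_seqI[OF dom] len_eq[OF dom]
    have "the (u x) \<in> S x" if xd: "x < d" for x
    proof -
      obtain \<alpha> where a: "\<alpha> < \<delta>" "x < len (w \<alpha>)" using ex[OF xd] by blast
      then show ?thesis using u[OF lessThan_iff[THEN iffD2, OF a(1)] a(2)] wn(3)[OF a(1)] unfolding product_tree_def by simp
    qed
    then have uT: "u \<in> ?T" unfolding product_tree_def using us dl by simp
    have graph: "Map.graph u = (\<Union>\<alpha>\<in>{..<\<delta>}. Map.graph (w \<alpha>))"
    proof (intro set_eqI iffI)
      fix e assume e: "e \<in> Map.graph u"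
      obtain x y where xy: "e = (x, y)" "u x = Some y" using e by (metis in_graphD surj_pair)
      then have "x < d" using dom by blast
      then obtain \<alpha> where a: "\<alpha> < \<delta>" "x < len (w \<alpha>)" using ex by blast
      then have "e \<in> Map.graph (w \<alpha>)" using xy u[OF lessThan_iff[THEN iffD2, OF a(1)] a(2)] by (simp add: in_graphI)
      then show "e \<in> (\<Union>\<alpha>\<in>{..<\<delta>}. Map.graph (w \<alpha>))" using a(1) by blast
    next
      fix e assume "e \<in> (\<Union>\<alpha>\<in>{..<\<delta>}. Map.graph (w \<alpha>))"
      then obtain \<alpha> where a: "\<alpha> < \<delta>" "e \<in> Map.graph (w \<alpha>)" by blast
      obtain x y where xy: "e = (x, y)" "w \<alpha> x = Some y" using a(2) by (metis in_graphD surj_pair)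
      then have "x < len (w \<alpha>)" using dom_seq[OF wn(1)[OF a(1)]] by blast
      then show "e \<in> Map.graph u" using xy u[OF lessThan_iff[THEN iffD2, OF a(1)]] by (simp add: in_graphI)
    qed
    have "\<delta> \<le> d"
    proof (rule ccontr)
      assume "\<not> \<delta> \<le> d"
      then have "d < \<delta>" by simp
      then show False using ge wd by (meson leD)
    qed
    moreover have "splitting k ?T d u" unfolding splitting_iff O[OF uT] us(2) using full[OF dl] by blast
    ultimately have "splitting k ?T \<delta> u" using splitting_mono dl by blast
    moreover have "\<Theta> (len u) (OSucc ?T u)" unfolding O[OF uT] us(2) using full[OF dl] by blast
    ultimately show ?thesis using uT graph by blast
  qed
  ultimately show ?thesis unfolding scl_kind_def splitting_closed_def by blast
qed

end

lemma full_kinds: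
  assumes \<Theta>: "\<And>\<beta>. \<beta> < lam \<Longrightarrow> \<Theta> \<beta> {..<k \<beta>}"
  shows "perfect_kind \<Theta> \<noteq> {}" "scl_kind \<Theta> \<noteq> {}" "laver_kind \<Theta> \<noteq> {}"
proof -
  define S where "S \<beta> = {..<k \<beta>}" for \<beta>
  have S: "S \<beta> \<noteq> {} \<and> S \<beta> \<subseteq> {..<k \<beta>}" if "\<beta> < lam" for \<beta>
    using infinite_imp_nonempty[OF k_infinite[OF that]] unfolding S_def by blast
  have full: "\<Theta> \<beta> (S \<beta>) \<and> |{..<k \<beta>}| \<le>o |S \<beta>|" if "\<beta> < lam" for \<beta>
    using \<Theta>[OF that] card_of_mono1[OF subset_refl] unfolding S_def by blast
  obtain z :: 'o where z: "\<And>x. \<not> x < z" using least_ord by blast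
  have "z < lam" using z omega_lam by (meson leI le_less_trans)
  then show "perfect_kind \<Theta> \<noteq> {}" "laver_kind \<Theta> \<noteq> {}"
    using product_tree_kinds[of S z \<Theta>, OF S] z full by blast+
  show "scl_kind \<Theta> \<noteq> {}" using product_tree_scl_kind[of S \<Theta>, OF S full] by blast
qed

lemma stat_kinds: "perfect_kind stat_kind \<noteq> {}" "laver_kind stat_kind \<noteq> {}"
proof -
  obtain \<gamma> where \<gamma>: "\<gamma> < lam" "lam < k \<gamma>" using lam_less_k by blast
  \<comment> \<open>The first cardinals may be too small to have points of cofinality \<omega> below
    them, as \<omega> itself is; so the tree does not branch before \<open>\<gamma>\<close>.\<close>
  define S where "S \<beta> = (if \<beta> < \<gamma> then {SOME b. b < k \<beta>} else {b. b < k \<beta> \<and> cf b = omega})" for \<beta>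
  have st: "stat_kind \<beta> {b. b < k \<beta> \<and> cf b = omega}" if b: "\<gamma> \<le> \<beta>" "\<beta> < lam" for \<beta>
  proof -
    have "lam < k \<beta>" using \<gamma>(2) k_mono_le[OF b] by (rule less_le_trans)
    then have "omega < k \<beta>" using omega_lam less_trans by blast
    then have "\<exists>b\<in>C. b < k \<beta> \<and> cf b = omega" if "club_in C (k \<beta>)" for C
    proof -
      have "C \<subseteq> {..<k \<beta>}" using that unfolding club_in_def by blast
      then show ?thesis using club_cf_omega[OF k_regular[OF b(2)] \<open>omega < k \<beta>\<close> that] by blast
    qed
    then have "stationary_in {b. b < k \<beta> \<and> cf b = omega} (k \<beta>)"
      unfolding stationary_in_def by blast
    then show ?thesis unfolding stat_kind_def by blast
  qed
  have S: "S \<beta> \<noteq> {} \<and> S \<beta> \<subseteq> {..<k \<beta>}" if b: "\<beta> < lam" for \<beta>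
  proof (cases "\<beta> < \<gamma>")
    case True
    have "\<exists>x. x < k \<beta>" using infinite_imp_nonempty[OF k_infinite[OF b]] by blast
    then have "(SOME b. b < k \<beta>) < k \<beta>" by (rule someI_ex)
    then show ?thesis using True unfolding S_def by simp
  next
    case False
    then have "|{..<k \<beta>}| \<le>o |S \<beta>|" using stat_kind_card[OF b st] b unfolding S_def by simp
    then have "infinite (S \<beta>)" using two_elements(2)[OF _ b] by blast
    then have "S \<beta> \<noteq> {}" by auto
    moreover have "S \<beta> \<subseteq> {..<k \<beta>}" using False unfolding S_def by auto
    ultimately show ?thesis by blast
  qed
  have "\<exists>b. S \<beta> = {b}" if "\<beta> < \<gamma>" for \<beta> using that unfolding S_def by simp
  moreover have "stat_kind \<beta> (S \<beta>) \<and> |{..<k \<beta>}| \<le>o |S \<beta>|" if "\<gamma> \<le> \<beta>" "\<beta> < lam" for \<beta>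
    using st[OF that] stat_kind_card[OF that(2) st[OF that]] that unfolding S_def by (simp add: leD)
  ultimately show "perfect_kind stat_kind \<noteq> {}" "laver_kind stat_kind \<noteq> {}"
    using product_tree_kinds[of S \<gamma> stat_kind, OF S \<gamma>(1)] by blast+
qed

lemma club_kind_full: "\<beta> < lam \<Longrightarrow> club_kind \<beta> {..<k \<beta>}"
  unfolding club_kind_def club_in_def by (intro exI[of _ "{..<k \<beta>}"]) auto

theorem forcings_add_new_function:
  assumes "P \<in> {MM lam k, MM_stat lam k, MM_club lam k, scl_MM lam k, scl_MM_club lam k,
               LL lam k, LL_stat lam k, LL_club lam k}"
  shows "adds_new_function P (\<subseteq>) {..<lam} {0, 1 :: nat}" "P \<noteq> {}"
proof -
  have P: "P \<in> {perfect_kind (\<lambda>_ _. True), perfect_kind stat_kind, perfect_kind club_kind,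
    scl_kind (\<lambda>_ _. True), scl_kind club_kind,
    laver_kind (\<lambda>_ _. True), laver_kind stat_kind, laver_kind club_kind}"
    using assms unfolding MM_eq MM_stat_eq MM_club_eq scl_MM_eq scl_MM_club_eq LL_eq LL_stat_eq LL_club_eq .
  show "adds_new_function P (\<subseteq>) {..<lam} {0, 1 :: nat}"
    using P perfect_kind_adds scl_kind_adds scl_club_kind_adds laver_kind_adds by (elim insertE) simp_all
  show "P \<noteq> {}"
    using P full_kinds[of "\<lambda>_ _. True"] full_kinds[of club_kind, OF club_kind_full] stat_kinds
    by (elim insertE) simp_all
qed

end

section \<open>From the hypotheses of the theorem to the locale\<close>

lemma cardinal_towerI:
  fixes \<kappa> lam :: "'o::wellorder"
  assumes sing: "singular_cardinal \<kappa>" and cf: "cf \<kappa> = lam" and om: "omega < lam"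
    and pow: "\<And>\<tau>. \<tau> < \<kappa> \<Longrightarrow> is_cardinal \<tau> \<Longrightarrow> ord_rel \<tau> ^c ord_rel lam <o ord_rel \<kappa>"
    and seq: "cardinal_sequence \<kappa> lam k"
  shows "cardinal_tower lam k"
proof
  have C\<kappa>: "Card_order (ord_rel \<kappa>)" "cinfinite (ord_rel \<kappa>)" and lk: "lam < \<kappa>"
    using sing cf unfolding singular_cardinal_def by auto
  show reg: "regular_infinite_cardinal (k \<alpha>)" if "\<alpha> < lam" for \<alpha> using seq that unfolding cardinal_sequence_def by blast
  show mono: "k \<alpha> < k \<beta>" if "\<alpha> < \<beta>" "\<beta> < lam" for \<alpha> \<beta>
    using seq that unfolding cardinal_sequence_def strict_mono_on_def by (meson lessThan_iff less_trans)
  have kle: "k \<alpha> \<le> \<kappa>" if "\<alpha> < lam" for \<alpha> using seq that unfolding cardinal_sequence_def by blast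
  have cof: "\<exists>\<alpha><lam. x < k \<alpha>" if "x < \<kappa>" for x
  proof (rule ccontr)
    assume "\<not> ?thesis"
    then have "\<kappa> \<le> x" using seq unfolding cardinal_sequence_def by (meson leI)
    then show False using that by simp
  qed
  let ?cof = "\<lambda>b. \<exists>f. f ` {..<b} \<subseteq> {..<\<kappa>} \<and> (\<forall>x<\<kappa>. \<exists>y<b. x \<le> f y)"
  have "?cof \<kappa>" by (intro exI[of _ id]) auto
  from LeastI[of ?cof, OF this] have "?cof lam" using cf unfolding cf_def by simp
  then obtain h where h: "h ` {..<lam} \<subseteq> {..<\<kappa>}" "\<And>x. x < \<kappa> \<Longrightarrow> \<exists>y<lam. x \<le> h y" by blast
  have min: "\<not> ?cof b" if "b < lam" for b using not_less_Least[of b ?cof] that cf unfolding cf_def by blast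
  \<comment> \<open>Otherwise \<open>\<kappa>\<close> would be regular, contradicting the cofinal
    map \<open>h\<close> from the smaller ordinal \<open>lam\<close>.\<close>
  have kless: "k \<alpha> < \<kappa>" if a: "\<alpha> < lam" for \<alpha>
  proof (rule ccontr)
    assume "\<not> k \<alpha> < \<kappa>"
    then have r: "regular_infinite_cardinal \<kappa>" using reg[OF a] kle[OF a] by (metis le_less)
    have "|h ` {..<lam}| <o |{..<\<kappa>}|"
      using ordLeq_ordLess_trans[OF card_of_image card_lessThan_less[OF C\<kappa>(1) lk]] .
    then obtain z where "z < \<kappa>" "\<forall>x\<in>h ` {..<lam}. x < z" using regular_bounded[OF r h(1)] by blast
    then show False using h(2) by (meson imageI leD lessThan_iff)
  qed
  \<comment> \<open>A short unbounded map into \<open>lam\<close> composed with \<open>k\<close>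
    would be cofinal in \<open>\<kappa>\<close>, against the minimality of the cofinality.\<close>
  show "\<exists>z<lam. \<forall>y<b. f y < z" if b: "b < lam" and f: "f ` {..<b} \<subseteq> {..<lam}" for b f
  proof (rule ccontr)
    assume no: "\<not> ?thesis"
    have "\<exists>y<b. x \<le> k (f y)" if x: "x < \<kappa>" for x
    proof -
      obtain \<alpha> where a: "\<alpha> < lam" "x < k \<alpha>" using cof[OF x] by blast
      then obtain y where y: "y < b" "\<alpha> \<le> f y" using no by (meson leI)
      have "f y < lam" using f y(1) by blast
      then have "k \<alpha> \<le> k (f y)" using y(2) mono[of \<alpha> "f y"] by (metis le_less)
      then show ?thesis using a(2) y(1) by (meson less_imp_le less_le_trans)
    qed
    moreover have "(\<lambda>y. k (f y)) ` {..<b} \<subseteq> {..<\<kappa>}" using f kless by blast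
    ultimately show False using min[OF b] by blast
  qed
  show "omega < lam" by (fact om)
  have "infinite {..<\<kappa>}" using C\<kappa>(2) unfolding cinfinite_def Field_ord_rel .
  from LeastI[of "\<lambda>b. infinite {..<b}", OF this] show "infinite {..<omega::'o}" unfolding omega_def .
  show "\<exists>\<beta><lam. lam < k \<beta>" using cof[OF lk] .
  \<comment> \<open>A convenient cardinal below \<open>\<kappa>\<close> with at least two elements;
    its power with exponent \<open>lam\<close> dominates the continuum.\<close>
  have "k omega < \<kappa>" "is_cardinal (k omega)"
    using kless[OF om] reg[OF om] unfolding is_cardinal_def regular_infinite_cardinal_def by blast+
  then have "ord_rel (k omega) ^c ord_rel lam <o ord_rel \<kappa>" by (rule pow)
  moreover have "|UNIV :: nat set set| \<le>o ord_rel (k omega) ^c ord_rel lam"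
  proof -
    obtain i :: "nat \<Rightarrow> 'o" where i: "inj i" "range i \<subseteq> {..<lam}"
      using infinite_countable_subset[of "{..<lam}"] \<open>infinite {..<omega::'o}\<close> om
      by (metis finite_subset less_imp_le lessThan_subset_iff)
    obtain x y where xy: "x < k omega" "y < k omega" "x \<noteq> y"
    proof -
      have "infinite {..<k omega}" using regular_infinite[OF reg[OF om]] .
      then obtain x where "x < k omega" using infinite_imp_nonempty by blast
      moreover from this obtain y where "y < k omega" "x < y" using regular_limit[OF reg[OF om]] by blast
      ultimately show ?thesis using that by blast
    qed
    \<comment> \<open>The characteristic function of the image of \<open>A\<close>, with
      \<open>x\<close> and \<open>y\<close> as truth values and \<open>undefined\<close> outside
      \<open>lam\<close> as \<open>Func\<close> demands.\<close>
    define e where "e A a = (if a < lam then if a \<in> i ` A then x else y else undefined)" for A a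
    have "inj e"
    proof (rule injI)
      fix A A' assume eq: "e A = e A'"
      have "n \<in> A \<longleftrightarrow> n \<in> A'" for n
      proof -
        have il: "i n < lam" using i(2) by blast
        have "e A (i n) = e A' (i n)" using eq by simp
        then have "i n \<in> i ` A \<longleftrightarrow> i n \<in> i ` A'" using il xy(3) unfolding e_def by (auto split: if_splits)
        then show ?thesis using i(1) by (simp add: inj_image_mem_iff)
      qed
      then show "A = A'" by blast
    qed
    moreover have "range e \<subseteq> Func {..<lam} {..<k omega}" unfolding Func_def e_def using xy(1,2) by auto
    ultimately show ?thesis unfolding cexp_def Field_ord_rel using card_of_ordLeq by blast
  qed
  ultimately have "|UNIV :: nat set set| <o ord_rel \<kappa>" by (rule ordLeq_ordLess_trans[rotated])
  \<comment> \<open>The continuum is strictly below \<open>\<kappa>\<close> in cardinality, hence is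
    matched by a proper initial segment \<open>{..<a}\<close> and so lies below some
    \<open>k \<gamma>\<close>.\<close>
  then obtain a where a: "a \<in> Field (ord_rel \<kappa>)" "|UNIV :: nat set set| =o Restr (ord_rel \<kappa>) (underS (ord_rel \<kappa>) a)"
    using ordLess_iff_ordIso_Restr[of "ord_rel \<kappa>" "|UNIV :: nat set set|"] C\<kappa>(1) card_of_Well_order
      card_order_on_well_order_on by blast
  have ak: "a < \<kappa>" using a(1) unfolding Field_ord_rel by simp
  have "Field (Restr (ord_rel \<kappa>) {..<a}) = {..<a}"
    using ak unfolding Field_def ord_rel_def by (auto; force)
  then have "|{..<a}| =o |UNIV :: nat set set|"
    using card_of_cong[OF a(2)] ordIso_symmetric unfolding underS_ord_rel[OF ak] Field_card_of by metis
  then have le: "|UNIV :: nat set set| \<le>o |{..<a}|" using ordIso_iff_ordLeq by blast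
  obtain \<gamma> where g: "\<gamma> < lam" "a < k \<gamma>" using cof[OF ak] by blast
  have "|{..<a}| <o |{..<k \<gamma>}|"
    using card_lessThan_less[OF _ g(2)] reg[OF g(1)] unfolding regular_infinite_cardinal_def by blast
  then show "\<exists>\<gamma><lam. |UNIV :: nat set set| <o |{..<k \<gamma>}|" using le g(1) ordLeq_ordLess_trans by blast
qed

theorem theorem3p1:
  fixes \<kappa> lam :: "'o::wellorder" and k :: "'o \<Rightarrow> 'o" and P :: "'o node set set"
  assumes "singular_cardinal \<kappa>"
    and "cf \<kappa> = lam" and "omega < lam"
    and "\<And>\<tau>. \<tau> < \<kappa> \<Longrightarrow> is_cardinal \<tau> \<Longrightarrow> ord_rel \<tau> ^c ord_rel lam <o ord_rel \<kappa>"
    and "cardinal_sequence \<kappa> lam k"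
    and "P \<in> {MM lam k, MM_stat lam k, MM_club lam k, scl_MM lam k, scl_MM_club lam k,
               LL lam k, LL_stat lam k, LL_club lam k}"
  shows "\<not> distributive P (\<subseteq>) {..<lam} {0, 1 :: nat} \<and>
         adds_new_function P (\<subseteq>) {..<lam} {0, 1 :: nat}"
proof -
  interpret cardinal_tower lam k
    by (rule cardinal_towerI[OF assms(1-3) _ assms(5)]) (rule assms(4))
  show ?thesis
    using forcings_add_new_function[OF assms(6)] adds_new_function_not_distributive by blast
qed

end
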